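(* Let $\alpha>-2$, $p>0$, $\lambda>0$ be constants, $\beta:=\frac{\alpha+2}{p+1}$, and let $$\mathfrak{S}:=\Big\{w\in C^2(S^1):\ w''+\beta^2 w-\frac{\lambda}{w^p}=0,\ w>0\Big\}.$$ Let $\mathscr{M}=\mathscr{M}_1\cup\mathscr{M}_2\cup\mathscr{M}_3\cup\mathscr{M}_4$ be the set of pairs $(\alpha,p)$ defined in the context. (1) If $(\alpha,p)\in\mathscr{M}$, then $\mathfrak{S}=\big\{(\lambda/\beta^2)^{\frac1{p+1}}\big\}$ (only the constant solution). (2) If $\alpha>-2$, $p>0$, $p\neq 3$ and $(\alpha,p)\notin\mathscr{M}$, let $$J_{\alpha,p}=\begin{cases}\big(\frac{\alpha+2}{\sqrt{p+1}},\ \alpha+2\big), & 0<p<1,\\ \big(\frac{\alpha+2}{\sqrt{p+1}},\ \frac{2(\alpha+2)}{p+1}\big), & 1\le p<3,\\ \big(\frac{2(\alpha+2)}{p+1},\ \frac{\alpha+2}{\sqrt{p+1}}\big), & p>3,\end{cases}$$ let $N_0=N_0(\alpha,p)$ be the number of integers in $J_{\alpha,p}$, let $b_{\alpha,p}$ be the left endpoint of $J_{\alpha,p}$, and put $j_i=[b_{\alpha,p}]+i$ for $i=1,\dots,N_0$, where $[\cdot]$ is the integer part. Then $1\le N_0<+\infty$ and $\mathfrak{S}$ contains exactly $1+N_0$ connected components $\mathfrak{S}_0,\mathfrak{S}_1,\dots,\mathfrak{S}_{N_0}$, namely $\mathfrak{S}_0=\big\{(\lambda/\beta^2)^{\frac1{p+1}}\big\}$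 and $$\mathfrak{S}_i=\{w_{j_i}(\cdot+a):\ 0\le a<2\pi\},\qquad i=1,\dots,N_0,$$ where $w_{j_i}$ is the positive solution, with minimal period $\frac{2\pi}{j_i}$, of $w''+\beta^2w-\lambda w^{-p}=0$ on $S^1$. (3) If $p=3$ and $\alpha\in\{0,2,4,\dots\}$, then $\mathfrak{S}$ contains exactly one connected component; more precisely, $\mathfrak{S}=\{w_{\epsilon,a}:\ (\epsilon,a)\in(0,1]\times[0,\pi/\beta)\}$ with $\beta=(\alpha+2)/4$ and $$w_{\epsilon,a}(\theta)=\Big(\frac{\lambda}{\beta^2}\Big)^{\frac14}\Big[\epsilon\cos^2(\beta(\theta+a))+\epsilon^{-1}\sin^2(\beta(\theta+a))\Big]^{\frac12}.$$ Moreover the minimum half-period of $w_{\epsilon,a}$ is $\frac{2\pi}{\alpha+2}$ for all $(\epsilon,a)\in(0,1)\times[0,\pi/\beta)$, and this connected component contains the trivial solution $w_{1,a}\equiv(\lambda/\beta^2)^{\frac14}$.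
   Context: $S^1=\mathbb{R}/2\pi\mathbb{Z}$; functions on $S^1$ are identified with $2\pi$-periodic functions of $\theta$, and connectedness is with respect to the $C^2(S^1)$ topology. The half-period of a periodic function is half of its period. The sets are $$\mathscr{M}_1=\Big\{(\alpha,p):\alpha>-2,\ 0<p<1,\ \text{and either } \alpha\le-1 \text{ or there is an integer } j\ge1 \text{ with } \alpha\le j-1 \text{ and } p\le\big(\tfrac{\alpha+2}{j}\big)^2-1\Big\},$$ $$\mathscr{M}_2=\Big\{(\alpha,p):\alpha>-2,\ 1\le p<3,\ \text{and either } p\ge2\alpha+3 \text{ or there is an integer } j\ge1 \text{ with } \tfrac{2(\alpha+2)}{j+1}-1\le p\le\big(\tfrac{\alpha+2}{j}\big)^2-1\Big\},$$ $$\mathscr{M}_3=\{(\alpha,3):\alpha>-2,\ \alpha\notin\{0,2,4,\dots\}\},$$ $$\mathscr{M}_4=\Big\{(\alpha,p):\alpha>-2,\ p>3,\ \text{and either } p\ge(\alpha+2)^2-1 \text{ or there is an integer } j\ge1 \text{ with } \big(\tfrac{\alpha+2}{j+1}\big)^2-1\le p\le\tfrac{2(\alpha+2)}{j}-1\Big\}.$$ *)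

theory Defs
  imports "HOL-Analysis.Analysis"
begin

section \<open>The space of twice continuously differentiable functions on the circle\<close>

text \<open>Functions on the circle of length \<open>2 * pi\<close> are \<open>2 * pi\<close>-periodic functions on the real line.\<close>

definition C2_circle :: "(real \<Rightarrow> real) set" where
  "C2_circle = {w. (\<forall>\<theta>. w (\<theta> + 2 * pi) = w \<theta>)
      \<and> (\<forall>\<theta>. w field_differentiable at \<theta>)
      \<and> (\<forall>\<theta>. deriv w field_differentiable at \<theta>)
      \<and> continuous_on UNIV (deriv (deriv w))}"

definition C2_norm :: "(real \<Rightarrow> real) \<Rightarrow> real" where
  "C2_norm w = (SUP \<theta>. \<bar>w \<theta>\<bar>) + (SUP \<theta>. \<bar>deriv w \<theta>\<bar>) + (SUP \<theta>. \<bar>deriv (deriv w) \<theta>\<bar>)"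

text \<open>The value 0 outside \<open>C2_circle\<close> is immaterial: it is there because \<open>Metric_space\<close>
  asks for non-negativity on the whole type, and \<open>SUP\<close> of an unbounded set is unspecified.\<close>

definition C2_dist :: "(real \<Rightarrow> real) \<Rightarrow> (real \<Rightarrow> real) \<Rightarrow> real" where
  "C2_dist v w = (if v \<in> C2_circle \<and> w \<in> C2_circle then C2_norm (\<lambda>\<theta>. v \<theta> - w \<theta>) else 0)"

lemma periodic_deriv:
  fixes w :: "real \<Rightarrow> real"
  assumes "\<forall>\<theta>. w (\<theta> + c) = w \<theta>" and "\<forall>\<theta>. w field_differentiable at \<theta>"
  shows "deriv w (\<theta> + c) = deriv w \<theta>"
proof -
  have "(w has_field_derivative deriv w (\<theta> + c)) (at (\<theta> + c))"
    using assms(2) field_differentiable_derivI by blast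
  then have "((\<lambda>x. w (x + c)) has_field_derivative deriv w (\<theta> + c)) (at \<theta>)"
    using DERIV_shift by blast
  then have "(w has_field_derivative deriv w (\<theta> + c)) (at \<theta>)"
    using assms(1) by simp
  then show ?thesis
    by (simp add: DERIV_imp_deriv)
qed

lemma periodic_continuous_bdd_above:
  fixes f :: "real \<Rightarrow> real"
  assumes per: "\<forall>\<theta>. f (\<theta> + 2 * pi) = f \<theta>" and cont: "continuous_on UNIV f"
  shows "bdd_above (range (\<lambda>\<theta>. \<bar>f \<theta>\<bar>))"
proof -
  interpret periodic_fun_simple f "2 * pi"
    by standard (use per in simp)
  have "compact ((\<lambda>\<theta>. \<bar>f \<theta>\<bar>) ` {0..2*pi})"
    by (intro compact_continuous_image continuous_intros continuous_on_subset[OF cont]) auto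
  then have bdd: "bdd_above ((\<lambda>\<theta>. \<bar>f \<theta>\<bar>) ` {0..2*pi})"
    by (simp add: bounded_imp_bdd_above compact_imp_bounded)
  have "range (\<lambda>\<theta>. \<bar>f \<theta>\<bar>) \<subseteq> (\<lambda>\<theta>. \<bar>f \<theta>\<bar>) ` {0..2*pi}"
  proof clarify
    fix \<theta> :: real
    define k where "k = \<lfloor>\<theta> / (2*pi)\<rfloor>"
    have "of_int k \<le> \<theta> / (2*pi)" "\<theta> / (2*pi) < of_int k + 1"
      by (simp_all add: k_def)
    then have "\<theta> - of_int k * (2*pi) \<in> {0..2*pi}"
      by (auto simp: field_simps)
    moreover have "f (\<theta> - of_int k * (2*pi)) = f \<theta>"
      by (rule minus_of_int)
    ultimately show "\<bar>f \<theta>\<bar> \<in> (\<lambda>\<theta>. \<bar>f \<theta>\<bar>) ` {0..2*pi}"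
      by (metis image_eqI)
  qed
  with bdd show ?thesis
    by (rule bdd_above_mono)
qed

lemma C2_circle_bdd:
  assumes "w \<in> C2_circle"
  shows "bdd_above (range (\<lambda>\<theta>. \<bar>w \<theta>\<bar>))"
    and "bdd_above (range (\<lambda>\<theta>. \<bar>deriv w \<theta>\<bar>))"
    and "bdd_above (range (\<lambda>\<theta>. \<bar>deriv (deriv w) \<theta>\<bar>))"
proof -
  have p0: "\<forall>\<theta>. w (\<theta> + 2 * pi) = w \<theta>"
    and d0: "\<forall>\<theta>. w field_differentiable at \<theta>" and d1: "\<forall>\<theta>. deriv w field_differentiable at \<theta>"
    and c2: "continuous_on UNIV (deriv (deriv w))"
    using assms by (auto simp: C2_circle_def)
  have p1: "\<forall>\<theta>. deriv w (\<theta> + 2 * pi) = deriv w \<theta>"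
    using periodic_deriv[OF p0 d0] by blast
  have p2: "\<forall>\<theta>. deriv (deriv w) (\<theta> + 2 * pi) = deriv (deriv w) \<theta>"
    using periodic_deriv[OF p1 d1] by blast
  have "continuous_on UNIV w" "continuous_on UNIV (deriv w)"
    using d0 d1 by (simp_all add: continuous_at_imp_continuous_on field_differentiable_imp_continuous_at)
  then show "bdd_above (range (\<lambda>\<theta>. \<bar>w \<theta>\<bar>))"
    "bdd_above (range (\<lambda>\<theta>. \<bar>deriv w \<theta>\<bar>))"
    "bdd_above (range (\<lambda>\<theta>. \<bar>deriv (deriv w) \<theta>\<bar>))"
    by (auto intro!: periodic_continuous_bdd_above simp: p0 p1 p2 c2)
qed

lemma C2_circle_diff:
  assumes "v \<in> C2_circle" "w \<in> C2_circle"
  shows "deriv (\<lambda>\<theta>. v \<theta> - w \<theta>) = (\<lambda>\<theta>. deriv v \<theta> - deriv w \<theta>)"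
    and "deriv (deriv (\<lambda>\<theta>. v \<theta> - w \<theta>)) = (\<lambda>\<theta>. deriv (deriv v) \<theta> - deriv (deriv w) \<theta>)"
    and "(\<lambda>\<theta>. v \<theta> - w \<theta>) \<in> C2_circle"
    and "deriv (\<lambda>\<theta>. deriv v \<theta> - deriv w \<theta>) = (\<lambda>\<theta>. deriv (deriv v) \<theta> - deriv (deriv w) \<theta>)"
proof -
  show 1: "deriv (\<lambda>\<theta>. v \<theta> - w \<theta>) = (\<lambda>\<theta>. deriv v \<theta> - deriv w \<theta>)"
    using assms by (auto simp: C2_circle_def)
  show 2: "deriv (deriv (\<lambda>\<theta>. v \<theta> - w \<theta>)) = (\<lambda>\<theta>. deriv (deriv v) \<theta> - deriv (deriv w) \<theta>)"
    unfolding 1 using assms by (auto simp: C2_circle_def)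
  show "(\<lambda>\<theta>. v \<theta> - w \<theta>) \<in> C2_circle"
    unfolding C2_circle_def mem_Collect_eq 2 unfolding 1
    using assms by (auto simp: C2_circle_def intro!: continuous_intros derivative_intros)
  show "deriv (\<lambda>\<theta>. deriv v \<theta> - deriv w \<theta>) = (\<lambda>\<theta>. deriv (deriv v) \<theta> - deriv (deriv w) \<theta>)"
    using 2 unfolding 1 .
qed

lemma SUP_abs_triangle:
  fixes f g :: "real \<Rightarrow> real"
  assumes "bdd_above (range (\<lambda>\<theta>. \<bar>f \<theta>\<bar>))" "bdd_above (range (\<lambda>\<theta>. \<bar>g \<theta>\<bar>))"
  shows "(SUP \<theta>. \<bar>f \<theta> + g \<theta>\<bar>) \<le> (SUP \<theta>. \<bar>f \<theta>\<bar>) + (SUP \<theta>. \<bar>g \<theta>\<bar>)"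
proof (rule cSUP_least)
  fix \<theta> :: real
  have "\<bar>f \<theta> + g \<theta>\<bar> \<le> \<bar>f \<theta>\<bar> + \<bar>g \<theta>\<bar>" by simp
  also have "\<dots> \<le> (SUP \<theta>. \<bar>f \<theta>\<bar>) + (SUP \<theta>. \<bar>g \<theta>\<bar>)"
    by (intro add_mono cSUP_upper assms UNIV_I)
  finally show "\<bar>f \<theta> + g \<theta>\<bar> \<le> \<dots>" .
qed simp

lemma SUP_abs_nonneg:
  fixes f :: "real \<Rightarrow> real"
  assumes "bdd_above (range (\<lambda>\<theta>. \<bar>f \<theta>\<bar>))"
  shows "0 \<le> (SUP \<theta>. \<bar>f \<theta>\<bar>)"
  by (rule order_trans[OF abs_ge_zero cSUP_upper[OF UNIV_I[of 0] assms]])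

interpretation C2: Metric_space C2_circle C2_dist
proof
  fix u v w :: "real \<Rightarrow> real"
  show "0 \<le> C2_dist v w"
    unfolding C2_dist_def C2_norm_def
    using C2_circle_bdd[OF C2_circle_diff(3)[of v w]]
    by (auto intro!: add_nonneg_nonneg SUP_abs_nonneg)
  show "C2_dist v w = C2_dist w v"
    unfolding C2_dist_def C2_norm_def by (auto simp: C2_circle_diff abs_minus_commute)
  show "C2_dist v w = 0 \<longleftrightarrow> v = w" if vw: "v \<in> C2_circle" "w \<in> C2_circle"
  proof
    note bdd = C2_circle_bdd[OF C2_circle_diff(3)[OF vw]]
    assume "C2_dist v w = 0"
    then have "(SUP \<theta>. \<bar>v \<theta> - w \<theta>\<bar>) = 0"
      using vw SUP_abs_nonneg[OF bdd(1)] SUP_abs_nonneg[OF bdd(2)] SUP_abs_nonneg[OF bdd(3)]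
      by (simp add: C2_dist_def C2_norm_def)
    then have "\<bar>v \<theta> - w \<theta>\<bar> \<le> 0" for \<theta>
      using cSUP_upper[OF UNIV_I[of \<theta>] bdd(1)] by simp
    then show "v = w" by auto
  next
    assume "v = w"
    have "deriv (\<lambda>\<theta>::real. 0::real) = (\<lambda>\<theta>. 0)" by auto
    then show "C2_dist v w = 0"
      using \<open>v = w\<close> by (simp add: C2_dist_def C2_norm_def)
  qed
  show "C2_dist u w \<le> C2_dist u v + C2_dist v w"
    if uvw: "u \<in> C2_circle" "v \<in> C2_circle" "w \<in> C2_circle"
  proof -
    note b1 = C2_circle_bdd[OF C2_circle_diff(3)[OF uvw(1,2)]]
    note b2 = C2_circle_bdd[OF C2_circle_diff(3)[OF uvw(2,3)]]
    show ?thesis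
      using uvw SUP_abs_triangle[OF b1(1) b2(1)] SUP_abs_triangle[OF b1(2) b2(2)]
        SUP_abs_triangle[OF b1(3) b2(3)]
      by (simp add: C2_dist_def C2_norm_def C2_circle_diff)
  qed
qed

definition C2_components :: "(real \<Rightarrow> real) set \<Rightarrow> (real \<Rightarrow> real) set set" where
  "C2_components A = connected_components_of (subtopology C2.mtopology A)"

definition is_minimal_period :: "(real \<Rightarrow> real) \<Rightarrow> real \<Rightarrow> bool" where
  "is_minimal_period w T \<longleftrightarrow> 0 < T \<and> (\<forall>\<theta>. w (\<theta> + T) = w \<theta>)
      \<and> (\<forall>s. 0 < s \<and> s < T \<longrightarrow> \<not> (\<forall>\<theta>. w (\<theta> + s) = w \<theta>))"

definition is_minimal_half_period :: "(real \<Rightarrow> real) \<Rightarrow> real \<Rightarrow> bool" where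
  "is_minimal_half_period w h \<longleftrightarrow> is_minimal_period w (2 * h)"

section \<open>The equation and its parameters\<close>

definition beta :: "real \<Rightarrow> real \<Rightarrow> real" where
  "beta \<alpha> p = (\<alpha> + 2) / (p + 1)"

definition solutions :: "real \<Rightarrow> real \<Rightarrow> real \<Rightarrow> (real \<Rightarrow> real) set" where
  "solutions \<alpha> p l = {w \<in> C2_circle.
      (\<forall>\<theta>. deriv (deriv w) \<theta> + (beta \<alpha> p)\<^sup>2 * w \<theta> - l / (w \<theta> powr p) = 0) \<and> (\<forall>\<theta>. 0 < w \<theta>)}"

definition const_solution :: "real \<Rightarrow> real \<Rightarrow> real \<Rightarrow> real \<Rightarrow> real" where
  "const_solution \<alpha> p l = (\<lambda>\<theta>. (l / (beta \<alpha> p)\<^sup>2) powr (1 / (p + 1)))"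

definition M1 :: "(real \<times> real) set" where
  "M1 = {(\<alpha>, p). \<alpha> > -2 \<and> 0 < p \<and> p < 1 \<and>
      (\<alpha> \<le> -1 \<or> (\<exists>j::int. j \<ge> 1 \<and> \<alpha> \<le> of_int j - 1 \<and> p \<le> ((\<alpha> + 2) / of_int j)\<^sup>2 - 1))}"

definition M2 :: "(real \<times> real) set" where
  "M2 = {(\<alpha>, p). \<alpha> > -2 \<and> 1 \<le> p \<and> p < 3 \<and>
      (p \<ge> 2 * \<alpha> + 3 \<or> (\<exists>j::int. j \<ge> 1 \<and> 2 * (\<alpha> + 2) / (of_int j + 1) - 1 \<le> p
          \<and> p \<le> ((\<alpha> + 2) / of_int j)\<^sup>2 - 1))}"

definition M3 :: "(real \<times> real) set" where
  "M3 = {(\<alpha>, p). p = 3 \<and> \<alpha> > -2 \<and> \<not> (\<exists>n::nat. \<alpha> = 2 * of_nat n)}"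

definition M4 :: "(real \<times> real) set" where
  "M4 = {(\<alpha>, p). \<alpha> > -2 \<and> p > 3 \<and>
      (p \<ge> (\<alpha> + 2)\<^sup>2 - 1 \<or> (\<exists>j::int. j \<ge> 1 \<and> ((\<alpha> + 2) / (of_int j + 1))\<^sup>2 - 1 \<le> p
          \<and> p \<le> 2 * (\<alpha> + 2) / of_int j - 1))}"

definition MM :: "(real \<times> real) set" where
  "MM = M1 \<union> M2 \<union> M3 \<union> M4"

text \<open>The open interval \<open>J\<close> is used for \<open>p \<noteq> 3\<close> only.\<close>

definition J_left :: "real \<Rightarrow> real \<Rightarrow> real" where
  "J_left \<alpha> p = (if p < 3 then (\<alpha> + 2) / sqrt (p + 1) else 2 * (\<alpha> + 2) / (p + 1))"

definition J_right :: "real \<Rightarrow> real \<Rightarrow> real" where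
  "J_right \<alpha> p = (if p < 1 then \<alpha> + 2 else if p < 3 then 2 * (\<alpha> + 2) / (p + 1)
      else (\<alpha> + 2) / sqrt (p + 1))"

definition J_integers :: "real \<Rightarrow> real \<Rightarrow> int set" where
  "J_integers \<alpha> p = {j. of_int j \<in> {J_left \<alpha> p <..< J_right \<alpha> p}}"

definition N0 :: "real \<Rightarrow> real \<Rightarrow> nat" where
  "N0 \<alpha> p = card (J_integers \<alpha> p)"

definition jj :: "real \<Rightarrow> real \<Rightarrow> nat \<Rightarrow> int" where
  "jj \<alpha> p i = \<lfloor>J_left \<alpha> p\<rfloor> + int i"

definition translates :: "(real \<Rightarrow> real) \<Rightarrow> (real \<Rightarrow> real) set" where
  "translates w = {(\<lambda>\<theta>. w (\<theta> + a)) | a. 0 \<le> a \<and> a < 2 * pi}"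

definition w_family :: "real \<Rightarrow> real \<Rightarrow> real \<Rightarrow> real \<Rightarrow> real \<Rightarrow> real" where
  "w_family b l \<epsilon> a = (\<lambda>\<theta>. (l / b\<^sup>2) powr (1 / 4) *
      sqrt (\<epsilon> * (cos (b * (\<theta> + a)))\<^sup>2 + inverse \<epsilon> * (sin (b * (\<theta> + a)))\<^sup>2))"

end

theory Submission
  imports Defs "HOL-Real_Asymp.Real_Asymp"
begin

text \<open>
  Rescaling \<open>w\<close> and \<open>\<theta>\<close> turns the equation into the oscillator \<open>x'' = x powr (- p) - x\<close>,
  whose potential \<open>G\<close> has its only critical point, a minimum, at \<open>x = 1\<close>.  The signed root
  \<open>H = \<plusminus> sqrt (2 * G)\<close> is a global coordinate in which the energy level of amplitude \<open>r\<close> is the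
  circle \<open>(H, x') = r * (sin \<phi>, cos \<phi>)\<close>, and \<open>d\<theta> = (dx / dH) d\<phi>\<close> along it.  Reading this backwards
  constructs all orbits; reading it forwards shows that a periodic solution is a time shift of the
  orbit with its amplitude (lemma \<open>flow_is_orbit\<close>).  The minimal period is
  \<open>T r\<close>, the integral of \<open>dx / dH\<close> at \<open>H = r * sin \<phi>\<close> over a full turn, so the solutions on the circle
  are the constant one and the orbits for which \<open>2 * pi * \<beta>\<close> is a multiple of \<open>T r\<close>.  Everything
  depends on the range and the monotonicity of \<open>T\<close>.

  Monotonicity is the heart of the proof.  Let \<open>W\<close> be the singular part of the potential,
  \<open>N = p * W + 3\<close>, \<open>A\<close> the action and \<open>K\<close> the integral of \<open>N * (dx / dH)\<close> over a full turn.  Then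
  \<open>A' = r * T\<close> and \<open>(p * r\<^sup>2 + 3 * (p + 1)) * T = 2 * p * A + (p + 1) * K\<close>
  (lemma \<open>period_identity\<close>), which makes \<open>T\<close> strictly monotone as soon as \<open>K\<close> is.  The integrand of \<open>K\<close>
  moves away from its value at the equilibrium in one direction only: its derivative has, up to
  positive factors and the sign of \<open>t = ln x\<close>, the sign of an explicit function of \<open>t\<close> which
  vanishes to fourth order at \<open>0\<close> and which the operator
  \<open>(D - 2) (D - 4 + 2 * p) (D - 1 + p) (D - 3 + 3 * p)\<close> maps to \<open>p - 3\<close> times a positive function
  (lemma \<open>test0_sign\<close>).  Hence \<open>T\<close> decreases for \<open>p < 3\<close> and increases for \<open>p > 3\<close>.

  At amplitude zero \<open>T\<close> is the period \<open>2 * pi / sqrt (p + 1)\<close> of the linearisation.  If \<open>p \<ge> 1\<close>, orbits of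
  large energy are half swings of the harmonic oscillator between reflections at \<open>x = 0\<close>, and \<open>T\<close>
  tends to \<open>pi\<close>.  If \<open>p < 1\<close>, the energies of periodic orbits are bounded and the limiting orbit is explicit, with period
  \<open>2 * pi / (p + 1)\<close>.  The frequencies \<open>2 * pi * \<beta> / T\<close> therefore fill the open interval \<open>J\<close>, each once,
  and \<open>MM\<close> consists (for \<open>p \<noteq> 3\<close>) of the parameters for which \<open>J\<close> contains no integer.  Each admissible orbit yields one compact
  connected family of translates; finitely many disjoint ones are the components.

  For \<open>p = 3\<close> the period is constant.  There \<open>w\<^sup>2\<close> solves a linear equation, so all solutions are
  explicit, and letting the amplitude shrink connects each of them to the constant one.
\<close>

section \<open>Auxiliary facts from calculus and topology\<close>

text \<open>The integrating factor \<open>exp (- a * t)\<close> turns the equation \<open>u' = a * u + v\<close> into monotonicity.  In this way a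
sign passes through a product of factors \<open>D - a\<close> one factor at a time, each zero at \<open>0\<close> switching
between an even and an odd sign pattern.\<close>

lemma linear_ode_sign:
  fixes u v :: "real \<Rightarrow> real"
  assumes u: "\<And>t. (u has_field_derivative a * u t + v t) (at t)" and u0: "u 0 = 0" and t: "t \<noteq> 0"
  shows "\<exists>s. 0 < s * t \<and> sgn (u t) = sgn t * sgn (v s)"
proof -
  define e where "e = (\<lambda>t. exp (- a * t) * u t)"
  have d: "(e has_field_derivative exp (- a * s) * v s) (at s)" for s
    unfolding e_def by (rule derivative_eq_intros u refl)+ (simp add: algebra_simps)
  have e0: "e 0 = 0" by (simp add: e_def u0)
  obtain s where s: "0 < s * t" "e t = t * (exp (- a * s) * v s)"
  proof (cases "t < 0")
    case True
    then obtain s where "t < s" "s < 0" "e 0 - e t = (0 - t) * (exp (- a * s) * v s)"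
      using MVT2[of t 0 e, OF _ d] by blast
    then show ?thesis using that[of s] e0 by (simp add: mult_neg_neg)
  next
    case False
    then obtain s where "0 < s" "s < t" "e t - e 0 = (t - 0) * (exp (- a * s) * v s)"
      using MVT2[of 0 t e, OF _ d] t by (metis linorder_neqE_linordered_idom)
    then show ?thesis using that[of s] e0 by simp
  qed
  have "sgn (u t) = sgn (e t)" by (simp add: e_def sgn_mult)
  also have "\<dots> = sgn t * sgn (v s)" unfolding s(2) by (simp add: sgn_mult)
  finally show ?thesis using s(1) by blast
qed

lemma exp_decay:
  fixes c :: real
  assumes "0 < c"
  shows "((\<lambda>t. exp (c * t)) \<longlongrightarrow> 0) at_bot"
    and "((\<lambda>t. \<bar>t\<bar> * exp (c * t)) \<longlongrightarrow> 0) at_bot"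
    and "((\<lambda>t. exp (- c * t)) \<longlongrightarrow> 0) at_top"
    and "((\<lambda>t. \<bar>t\<bar> * exp (- c * t)) \<longlongrightarrow> 0) at_top"
  using assms by real_asymp+

lemma integral_strict_mono_exists:
  fixes f g :: "real \<Rightarrow> real"
  assumes "continuous_on {a..b} f" "continuous_on {a..b} g" "a < b"
    and le: "\<And>x. x \<in> {a..b} \<Longrightarrow> f x \<le> g x" and c: "c \<in> {a..b}" "f c < g c"
  shows "integral {a..b} f < integral {a..b} g"
proof -
  have i: "f integrable_on {a..b}" "g integrable_on {a..b}"
    using assms by (auto intro: integrable_continuous_interval)
  have "integral {a..b} (\<lambda>x. g x - f x) \<noteq> 0"
    using integral_eq_0_iff[of a b "\<lambda>x. g x - f x", OF continuous_on_diff[OF assms(2,1)]] assms by force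
  then have "integral {a..b} g \<noteq> integral {a..b} f"
    using i by (simp add: integral_diff)
  moreover have "integral {a..b} f \<le> integral {a..b} g"
    using i le by (intro integral_le) auto
  ultimately show ?thesis by simp
qed

lemma zero_deriv_const:
  fixes f :: "real \<Rightarrow> real"
  assumes "\<And>x. (f has_field_derivative 0) (at x)"
  shows "f a = f b"
  using DERIV_isconst_all[of f a b] assms by blast

text \<open>Rotating the pair back by the angle \<open>\<Phi>\<close> makes it constant.\<close>

lemma rotating_pair:
  fixes h v \<Phi> :: "real \<Rightarrow> real"
  assumes h: "\<And>s. (h has_field_derivative v s * \<omega> s) (at s)"
    and v: "\<And>s. (v has_field_derivative - h s * \<omega> s) (at s)"
    and \<Phi>: "\<And>s. (\<Phi> has_field_derivative \<omega> s) (at s)"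
  shows "h s = h 0 * cos (\<Phi> s - \<Phi> 0) + v 0 * sin (\<Phi> s - \<Phi> 0)"
    and "v s = v 0 * cos (\<Phi> s - \<Phi> 0) - h 0 * sin (\<Phi> s - \<Phi> 0)"
proof -
  define c where "c = (\<lambda>s. h s * cos (\<Phi> s - \<Phi> 0) - v s * sin (\<Phi> s - \<Phi> 0))"
  define d where "d = (\<lambda>s. h s * sin (\<Phi> s - \<Phi> 0) + v s * cos (\<Phi> s - \<Phi> 0))"
  have "(c has_field_derivative 0) (at s)" "(d has_field_derivative 0) (at s)" for s
    unfolding c_def d_def by (rule derivative_eq_intros h v \<Phi> refl | simp add: algebra_simps)+
  then have "c s = c 0" "d s = d 0"
    using zero_deriv_const[of c s 0] zero_deriv_const[of d s 0] by blast+
  then have 0: "h 0 = c s" "v 0 = d s" by (simp_all add: c_def d_def)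
  let ?one = "(sin (\<Phi> s - \<Phi> 0))\<^sup>2 + (cos (\<Phi> s - \<Phi> 0))\<^sup>2"
  have "c s * cos (\<Phi> s - \<Phi> 0) + d s * sin (\<Phi> s - \<Phi> 0) = h s * ?one"
    "d s * cos (\<Phi> s - \<Phi> 0) - c s * sin (\<Phi> s - \<Phi> 0) = v s * ?one"
    unfolding c_def d_def by algebra+
  then show "h s = h 0 * cos (\<Phi> s - \<Phi> 0) + v 0 * sin (\<Phi> s - \<Phi> 0)"
    and "v s = v 0 * cos (\<Phi> s - \<Phi> 0) - h 0 * sin (\<Phi> s - \<Phi> 0)"
    unfolding 0 by simp_all
qed

text \<open>A member of a finite closed partition is also open, because the union of the others is closed;
a connected set that meets it lies inside it.\<close>

lemma connected_components_of_finite_closed_partition: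
  assumes fin: "finite \<C>"
    and C: "\<And>C. C \<in> \<C> \<Longrightarrow> connectedin X C" "\<And>C. C \<in> \<C> \<Longrightarrow> closedin X C" "\<And>C. C \<in> \<C> \<Longrightarrow> C \<noteq> {}"
    and disj: "\<And>C D. C \<in> \<C> \<Longrightarrow> D \<in> \<C> \<Longrightarrow> C \<noteq> D \<Longrightarrow> C \<inter> D = {}"
    and cov: "\<Union>\<C> = topspace X"
  shows "connected_components_of X = \<C>"
proof -
  have comp: "connected_component_of_set X x = C" if "C \<in> \<C>" "x \<in> C" for C x
  proof
    show "C \<subseteq> connected_component_of_set X x"
      using connected_component_of_maximal[OF C(1)[OF that(1)] that(2)] .
    have "closedin X (\<Union>(\<C> - {C}))"
      using fin C(2) by (intro closedin_Union) auto
    moreover have "topspace X - \<Union>(\<C> - {C}) = C"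
    proof (intro equalityI subsetI)
      fix z assume "z \<in> topspace X - \<Union>(\<C> - {C})"
      then show "z \<in> C" unfolding cov[symmetric] by blast
    next
      fix z assume z: "z \<in> C"
      have "z \<notin> D" if "D \<in> \<C> - {C}" for D using disj[OF \<open>C \<in> \<C>\<close>, of D] that z by auto
      then show "z \<in> topspace X - \<Union>(\<C> - {C})" unfolding cov[symmetric] using z \<open>C \<in> \<C>\<close> by blast
    qed
    ultimately have "openin X C" by (metis openin_diff openin_topspace)
    then have "connected_component_of_set X x \<subseteq> C \<or> disjnt (connected_component_of_set X x) C"
      using connectedin_clopen_cases[OF connectedin_connected_component_of C(2)[OF that(1)]] by blast
    moreover have "x \<in> topspace X" using that cov by blast
    then have "x \<in> connected_component_of_set X x" by (simp add: connected_component_of_refl)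
    ultimately show "connected_component_of_set X x \<subseteq> C"
      using that(2) by (auto simp: disjnt_def)
  qed
  show ?thesis
  proof (intro equalityI subsetI)
    fix D assume "D \<in> connected_components_of X"
    then obtain x where x: "x \<in> topspace X" "D = connected_component_of_set X x"
      by (auto simp: connected_components_of_def)
    then obtain C where "C \<in> \<C>" "x \<in> C" using cov by blast
    then show "D \<in> \<C>" using comp x by simp
  next
    fix D assume D: "D \<in> \<C>"
    then obtain x where x: "x \<in> D" using C(3) by blast
    then have "x \<in> topspace X" using D cov by blast
    then show "D \<in> connected_components_of X"
      using comp[OF D x] by (auto simp: connected_components_of_def)
  qed
qed

lemma periodic_reduce:
  fixes c :: real
  assumes "0 < c"
  shows "\<exists>k::int. 0 \<le> x + of_int k * c \<and> x + of_int k * c < c"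
proof -
  define q :: real where "q = of_int \<lfloor>x / c\<rfloor>"
  have "q \<le> x / c" "x / c < q + 1" unfolding q_def by linarith+
  then have "q * c \<le> x" "x < q * c + c"
    using assms by (simp_all add: field_simps)
  then have "0 \<le> x + of_int (- \<lfloor>x / c\<rfloor>) * c" "x + of_int (- \<lfloor>x / c\<rfloor>) * c < c"
    by (simp_all add: q_def)
  then show ?thesis by blast
qed

lemma periodic_int:
  fixes f :: "real \<Rightarrow> 'a"
  assumes "\<And>x. f (x + c) = f x"
  shows "f (x + of_int k * c) = f x"
proof (induction k rule: int_induct[where k = 0])
  case base then show ?case by simp
next
  case (step1 i)
  then show ?case using assms[of "x + of_int i * c"] by (simp add: algebra_simps)
next
  case (step2 i)
  then show ?case using assms[of "x + of_int (i - 1) * c"] by (simp add: algebra_simps)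
qed

section \<open>The potential of the normalised equation\<close>

text \<open>The locale treats \<open>x'' = x powr (- p) - x\<close> on \<open>x > 0\<close> in the coordinate \<open>t = ln x\<close>, in which all powers of
\<open>x\<close> become exponentials and \<open>x = 1\<close> becomes \<open>t = 0\<close>.\<close>

locale singular_oscillator =
  fixes p :: real
  assumes p_pos: "0 < p"
begin

text \<open>At \<open>x = exp t\<close> these are \<open>x\<^sup>2\<close>, \<open>x powr (1 - p)\<close> and the singular part of the potential.  The latter is
normalised to vanish at \<open>x = 1\<close>, so that \<open>p = 1\<close> is the continuous limit \<open>- ln x\<close> of the other exponents and
the relation \<open>x powr (1 - p) = 1 + (p - 1) * spot t\<close> holds for all of them.\<close>

definition xsq :: "real \<Rightarrow> real" where "xsq t = exp (2 * t)"
definition xpow :: "real \<Rightarrow> real" where "xpow t = exp ((1 - p) * t)"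
definition spot :: "real \<Rightarrow> real" where
  "spot t = (if p = 1 then - t else (exp ((1 - p) * t) - 1) / (p - 1))"

lemma xsq_deriv [derivative_intros]:
  "(xsq has_field_derivative 2 * xsq t) (at t)"
  unfolding xsq_def by (auto intro!: derivative_eq_intros)

lemma xpow_deriv [derivative_intros]:
  "(xpow has_field_derivative (1 - p) * xpow t) (at t)"
  unfolding xpow_def by (auto intro!: derivative_eq_intros)

lemma xpow_eq: "xpow t = 1 + (p - 1) * spot t"
  unfolding xpow_def spot_def by simp

lemma spot_deriv [derivative_intros]:
  "(spot has_field_derivative - xpow t) (at t)"
proof (cases "p = 1")
  case True
  have "spot = (\<lambda>t. - t)" unfolding spot_def using True by (simp add: fun_eq_iff)
  moreover have "xpow t = 1" unfolding xpow_def using True by simp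
  ultimately show ?thesis by (auto intro!: derivative_eq_intros)
next
  case False
  have "spot = (\<lambda>t. (exp ((1 - p) * t) - 1) / (p - 1))"
    unfolding spot_def using False by (simp add: fun_eq_iff)
  then show ?thesis unfolding xpow_def using False
    by (auto simp: divide_simps intro!: derivative_eq_intros) (simp add: algebra_simps)?
qed

lemma xpow_pos: "0 < xpow t" and xsq_pos: "0 < xsq t"
  by (simp_all add: xpow_def xsq_def)

lemma xsq_0 [simp]: "xsq 0 = 1" and xpow_0 [simp]: "xpow 0 = 1" and spot_0 [simp]: "spot 0 = 0"
  by (simp_all add: xsq_def xpow_def spot_def)

text \<open>The potential at \<open>x = exp t\<close>.  Its derivative with respect to \<open>t\<close> is \<open>xsq t - xpow t\<close>, that is, \<open>x\<close> times the
derivative with respect to \<open>x\<close>.\<close>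

definition pot :: "real \<Rightarrow> real" where "pot t = (xsq t - 1) / 2 + spot t"

lemma pot_0 [simp]: "pot 0 = 0" by (simp add: pot_def)

lemma pot_deriv: "(pot has_field_derivative xsq t - xpow t) (at t)"
  unfolding pot_def by (auto intro!: derivative_eq_intros)

lemma force_deriv:
  "((\<lambda>t. xsq t - xpow t) has_field_derivative 2 * xsq t - (1 - p) * xpow t) (at t)"
  by (auto intro!: derivative_eq_intros)

lemma force_eq: "xsq t - xpow t = xpow t * (exp ((p + 1) * t) - 1)"
  unfolding xsq_def xpow_def
  by (simp add: algebra_simps exp_add[symmetric])

lemma force_pos: "0 < t \<Longrightarrow> 0 < xsq t - xpow t"
  using p_pos xpow_pos unfolding force_eq by (intro mult_pos_pos) auto

lemma force_neg: "t < 0 \<Longrightarrow> xsq t - xpow t < 0"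
  using p_pos xpow_pos unfolding force_eq by (intro mult_pos_neg) (auto simp: mult_pos_neg)

lemma force_nz: "t \<noteq> 0 \<Longrightarrow> xsq t - xpow t \<noteq> 0"
  using force_pos[of t] force_neg[of t] by (cases "t < 0") auto

section \<open>A test function with the sign of \<open>p - 3\<close>\<close>

text \<open>Up to positive factors and the sign of \<open>t\<close>, \<open>test0\<close> is the derivative of the integrand \<open>wrate\<close> below (lemma
\<open>wrate_deriv\<close>).  For \<open>p \<notin> {1, 3}\<close>, it is a combination of at most seven exponentials of \<open>t\<close>, whose coefficients
change sign four times when they are ordered by exponent.  As in the proof of Descartes' rule of signs, applying \<open>D - \<lambda>\<close> with \<open>\<lambda>\<close> at each change of
sign leaves coefficients of one sign.  The exponents \<open>3 - 3 * p\<close>, \<open>1 - p\<close>, \<open>4 - 2 * p\<close> and \<open>2\<close> of the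
combination itself are suitable values of \<open>\<lambda>\<close>; \<open>test1\<close> to \<open>test4\<close> are the successive images, written with
\<open>spot\<close> instead of \<open>xpow\<close> so that no denominators \<open>p - 1\<close> arise.\<close>

definition test0 :: "real \<Rightarrow> real" where
  "test0 t = (let y = xsq t; m = xpow t; w = spot t in
     (p * w + 3) * ((y - m)\<^sup>2 + (y - 1 + 2 * w) * ((y - m) - (2 * y - (1 - p) * m)))
      - p * (y - 1 + 2 * w) * m * (y - m))"

definition test1 :: "real \<Rightarrow> real" where
  "test1 t = (let y = xsq t; w = spot t in
    (2*p-2*p^3)*y^2*w - (2*p+2*p^2)*y^2 + (3*p-2*p^2-5*p^3)*y*w^2 - (6*p+8*p^2+2*p^3)*y*w
   + (3+p-2*p^2)*y + (-3+p+3*p^2-p^3)*w^2 + (6-2*p-4*p^2+4*p^3)*w + (-3+p+4*p^2))"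

definition test2 :: "real \<Rightarrow> real" where
  "test2 t = (let y = xsq t; w = spot t in
    (8*p-8*p^3)*y^2*w - (8*p+8*p^2)*y^2 + (9*p-9*p^2-13*p^3+5*p^4)*y*w^2
   + (-18*p-12*p^2+6*p^3)*y*w + (3+10*p+7*p^2)*y + (-3+4*p+2*p^2-4*p^3+p^4)*w^2
   + (6-2*p-6*p^2+2*p^3)*w + (-3-2*p+p^2))"

definition test3 :: "real \<Rightarrow> real" where
  "test3 t = (let y = xsq t; w = spot t in
    (8*p+8*p^2-8*p^3-8*p^4)*y^2*w - (8*p+16*p^2+8*p^3)*y^2 + (12*p^2+8*p^3-4*p^4)*y*w
   + (-6+4*p+18*p^2+8*p^3)*y + (6-8*p-4*p^2+8*p^3-2*p^4)*w^2 + (-12+4*p+12*p^2-4*p^3)*w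
   + (6+4*p-2*p^2))"

definition test4 :: "real \<Rightarrow> real" where
  "test4 t = 4*p*(p+1)*(p-3)*(2*(1+p)*(xsq t)\<^sup>2 * xpow t + p * xsq t * xpow t + (xpow t)\<^sup>2)"

lemma test0_deriv: "(test0 has_field_derivative (3 - 3 * p) * test0 t + test1 t) (at t)"
  unfolding test0_def Let_def
  apply (rule derivative_eq_intros refl)+
  unfolding test1_def Let_def xpow_eq
  by (simp add: power2_eq_square power3_eq_cube power4_eq_xxxx algebra_simps)

lemma test1_deriv: "(test1 has_field_derivative (1 - p) * test1 t + test2 t) (at t)"
  unfolding test1_def Let_def
  apply (rule derivative_eq_intros refl)+
  unfolding test2_def Let_def xpow_eq
  by (simp add: power2_eq_square power3_eq_cube power4_eq_xxxx algebra_simps)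

lemma test2_deriv: "(test2 has_field_derivative (4 - 2 * p) * test2 t + test3 t) (at t)"
  unfolding test2_def Let_def
  apply (rule derivative_eq_intros refl)+
  unfolding test3_def Let_def xpow_eq
  by (simp add: power2_eq_square power3_eq_cube power4_eq_xxxx algebra_simps)

lemma test3_deriv: "(test3 has_field_derivative 2 * test3 t + test4 t) (at t)"
  unfolding test3_def Let_def
  apply (rule derivative_eq_intros refl)+
  unfolding test4_def Let_def xpow_eq
  by (simp add: power2_eq_square power3_eq_cube power4_eq_xxxx algebra_simps)

lemma f_at_0: "test0 0 = 0" "test1 0 = 0" "test2 0 = 0" "test3 0 = 0"
  by (simp_all add: test0_def test1_def test2_def test3_def algebra_simps power2_eq_square)

text \<open>The sign of \<open>test4\<close> is visible, and four zeros at \<open>t = 0\<close> carry it back to \<open>test0\<close>.\<close>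

lemma test0_sign:
  assumes "p \<noteq> 3" "t \<noteq> 0"
  shows "0 < (p - 3) * test0 t"
proof -
  let ?c = "p - 3"
  have m: "\<And>t. ((\<lambda>t. ?c * u t) has_field_derivative a * (?c * u t) + ?c * v t) (at t)"
    if "\<And>t. (u has_field_derivative a * u t + v t) (at t)" for u v :: "real \<Rightarrow> real" and a
    by (rule derivative_eq_intros that refl)+ (simp add: algebra_simps)
  have "0 < ?c * test4 s" for s
  proof -
    have "?c * test4 s = 4 * p * (p+1) * ?c\<^sup>2 * (2*(1+p)*(xsq s)\<^sup>2 * xpow s + p * xsq s * xpow s + (xpow s)\<^sup>2)"
      by (simp add: test4_def power2_eq_square)
    also have "\<dots> > 0"
    proof -
      have "0 < (p - 3)\<^sup>2" using assms by simp
      moreover have "0 < 2*(1+p)*(xsq s)\<^sup>2 * xpow s + p * xsq s * xpow s + (xpow s)\<^sup>2"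
        using p_pos xsq_pos[of s] xpow_pos[of s] by (simp add: add_pos_pos)
      moreover have "0 < 4 * p * (p + 1)" using p_pos by simp
      ultimately show ?thesis by (metis mult_pos_pos)
    qed
    finally show ?thesis .
  qed
  then have 4: "sgn (?c * test4 s) = 1" for s by simp
  have 3: "sgn (?c * test3 t) = sgn t" for t
  proof (cases "t = 0")
    case False
    show ?thesis using linear_ode_sign[OF m[of test3 2 test4, OF test3_deriv] _ False] 4 f_at_0 by auto
  qed (simp add: f_at_0)
  have 2: "sgn (?c * test2 t) = 1" if nz: "t \<noteq> 0" for t
  proof -
    obtain s where "0 < s * t" "sgn (?c * test2 t) = sgn t * sgn (?c * test3 s)"
      using linear_ode_sign[OF m[of test2 "4 - 2 * p" test3, OF test2_deriv] _ nz] f_at_0 by auto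
    then show ?thesis by (simp only: 3 sgn_mult[symmetric] mult.commute[of t]) simp
  qed
  have 1: "sgn (?c * test1 t) = sgn t" for t
  proof (cases "t = 0")
    case False
    then obtain s where "0 < s * t" "sgn (?c * test1 t) = sgn t * sgn (?c * test2 s)"
      using linear_ode_sign[OF m[of test1 "1 - p" test2, OF test1_deriv] _ False] f_at_0 by auto
    moreover from this have "s \<noteq> 0" by auto
    ultimately show ?thesis using 2[of s] by simp
  qed (simp add: f_at_0)
  have "sgn (?c * test0 t) = 1"
  proof -
    obtain s where "0 < s * t" "sgn (?c * test0 t) = sgn t * sgn (?c * test1 s)"
      using linear_ode_sign[OF m[of test0 "3 - 3 * p" test1, OF test0_deriv] _ assms(2)] f_at_0 by auto
    then show ?thesis by (simp only: 1 sgn_mult[symmetric] mult.commute[of t]) simp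
  qed
  then show ?thesis by (simp add: sgn_1_pos)
qed

section \<open>The energy coordinate\<close>

text \<open>The signed square root of twice the potential: along a solution, energy conservation says that
\<open>ecoord\<close> and the velocity lie on a circle.\<close>

definition ecoord :: "real \<Rightarrow> real" where "ecoord t = sgn t * sqrt (2 * pot t)"

text \<open>The derivative of \<open>ecoord\<close>; the value at \<open>0\<close> fills in the removable singularity at the equilibrium.\<close>

definition decoord :: "real \<Rightarrow> real" where
  "decoord t = (if t = 0 then sqrt (1 + p) else (xsq t - xpow t) / ecoord t)"

lemma pot_pos:
  assumes "t \<noteq> 0" shows "0 < pot t"
proof -
  obtain s where s: "0 < s * t" "sgn (pot t) = sgn t * sgn (xsq s - xpow s)"
    using linear_ode_sign[of pot 0 "\<lambda>t. xsq t - xpow t", OF _ _ assms] pot_deriv by auto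
  have "s \<noteq> 0" using s(1) by auto
  then have "sgn (xsq s - xpow s) = sgn s"
    using force_pos[of s] force_neg[of s] by (cases "0 < s") auto
  then have "sgn (pot t) = sgn (s * t)" using s(2) by (simp add: sgn_mult mult.commute)
  then show ?thesis using s(1) by (simp add: sgn_1_pos)
qed

lemma pot_nonneg: "0 \<le> pot t" using pot_pos[of t] by (cases "t = 0") auto

lemma ecoord_sq: "(ecoord t)\<^sup>2 = 2 * pot t"
  using pot_nonneg[of t] by (cases "t = 0") (auto simp: ecoord_def power_mult_distrib sgn_if)

lemma ecoord_0 [simp]: "ecoord 0 = 0" by (simp add: ecoord_def)

lemma ecoord_pos: "0 < t \<Longrightarrow> 0 < ecoord t" and ecoord_neg: "t < 0 \<Longrightarrow> ecoord t < 0"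
  using pot_pos[of t] by (auto simp: ecoord_def)

lemma ecoord_nz: "t \<noteq> 0 \<Longrightarrow> ecoord t \<noteq> 0"
  using ecoord_pos[of t] ecoord_neg[of t] by (cases "t < 0") auto

lemma decoord_pos: "0 < decoord t"
proof -
  consider "t = 0" | "0 < t" | "t < 0" by linarith
  then show ?thesis
  proof cases
    case 1 then show ?thesis using p_pos by (simp add: decoord_def)
  next
    case 2 then show ?thesis using ecoord_pos force_pos by (simp add: decoord_def)
  next
    case 3 then show ?thesis using ecoord_neg force_neg by (simp add: decoord_def divide_neg_neg)
  qed
qed

lemma decoord_ecoord: "ecoord t * decoord t = xsq t - xpow t"
  using ecoord_nz[of t] by (simp add: decoord_def)

lemma force_quotient_lim: "((\<lambda>t. (xsq t - xpow t) / t) \<longlongrightarrow> 1 + p) (at 0)"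
  using force_deriv[of 0] unfolding DERIV_def by (simp add: add.commute)

lemma pot_quotient_lim: "((\<lambda>t. 2 * pot t / t\<^sup>2) \<longlongrightarrow> 1 + p) (at 0)"
proof -
  have "((\<lambda>t. 2 * (xsq t - xpow t) / (2 * t)) \<longlongrightarrow> 1 + p) (at 0)"
  proof -
    have "2 * (xsq t - xpow t) / (2 * t) = (xsq t - xpow t) / t" for t by (rule mult_divide_mult_cancel_left) simp
    then show ?thesis using force_quotient_lim by (simp only:)
  qed
  moreover have "((\<lambda>t. 2 * pot t) \<longlongrightarrow> 0) (at 0)"
    using tendsto_mult[OF tendsto_const[of 2] DERIV_isCont[OF pot_deriv[of 0], unfolded isCont_def]] by simp
  moreover have "((\<lambda>t::real. t\<^sup>2) \<longlongrightarrow> 0) (at 0)"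
    by (auto intro!: tendsto_eq_intros)
  moreover have "\<forall>\<^sub>F t::real in at 0. t \<noteq> 0"
    by (simp add: eventually_at_filter)
  then have "\<forall>\<^sub>F t::real in at 0. t\<^sup>2 \<noteq> 0" "\<forall>\<^sub>F t::real in at 0. 2 * t \<noteq> 0"
    by (auto elim: eventually_mono)
  moreover have "((\<lambda>t. 2 * pot t) has_field_derivative 2 * (xsq t - xpow t)) (at t)" for t
    by (rule DERIV_cmult[OF pot_deriv])
  then have "\<forall>\<^sub>F t in at 0. ((\<lambda>t. 2 * pot t) has_field_derivative 2 * (xsq t - xpow t)) (at t)"
    by (rule always_eventually[OF allI])
  moreover have "((\<lambda>t::real. t\<^sup>2) has_field_derivative 2 * t) (at t)" for t
    by (auto intro!: derivative_eq_intros)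
  then have "\<forall>\<^sub>F t in at 0. ((\<lambda>t::real. t\<^sup>2) has_field_derivative 2 * t) (at t)"
    by (rule always_eventually[OF allI])
  ultimately show ?thesis
    by (intro lhopital[of "\<lambda>t. 2 * pot t" 0 "\<lambda>t. t\<^sup>2" "\<lambda>t. 2 * t" "\<lambda>t. 2 * (xsq t - xpow t)"])
qed

lemma ecoord_quotient_lim: "((\<lambda>t. ecoord t / t) \<longlongrightarrow> sqrt (1 + p)) (at 0)"
proof -
  have "((\<lambda>t. sqrt (2 * pot t / t\<^sup>2)) \<longlongrightarrow> sqrt (1 + p)) (at 0)"
    by (intro tendsto_intros pot_quotient_lim)
  moreover have "sqrt (2 * pot t / t\<^sup>2) = ecoord t / t" for t
    by (simp add: ecoord_def real_sqrt_divide sgn_if)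
  ultimately show ?thesis by simp
qed

lemma ecoord_deriv: "(ecoord has_field_derivative decoord t) (at t)"
proof (cases "t = 0")
  case True
  then show ?thesis
    using ecoord_quotient_lim by (simp add: DERIV_def decoord_def)
next
  case False
  have "((\<lambda>s. sgn t * sqrt (2 * pot s)) has_field_derivative
      sgn t * (2 * (xsq t - xpow t) * (inverse (sqrt (2 * pot t)) / 2))) (at t)"
    using pot_pos[OF False] by (auto intro!: derivative_eq_intros pot_deriv)
  also have "sgn t * (2 * (xsq t - xpow t) * (inverse (sqrt (2 * pot t)) / 2)) = decoord t"
    using False by (simp add: decoord_def ecoord_def divide_simps sgn_if)
  finally have *: "((\<lambda>s. sgn t * sqrt (2 * pot s)) has_field_derivative decoord t) (at t)" .
  have ev: "\<forall>\<^sub>F s in nhds t. s \<in> (if t < 0 then {..<0} else {0<..})"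
    using False by (intro eventually_nhds_in_open) auto
  have "\<forall>\<^sub>F s in nhds t. ecoord s = sgn t * sqrt (2 * pot s)"
    using ev by eventually_elim (use False in \<open>auto simp: ecoord_def sgn_if split: if_splits\<close>)
  then show ?thesis using DERIV_cong_ev[THEN iffD2, OF refl _ refl *] by blast
qed

lemma ecoord_isCont: "isCont ecoord t"
  using ecoord_deriv DERIV_isCont by blast

lemma ecoord_strict_mono: "s < t \<Longrightarrow> ecoord s < ecoord t"
  by (rule DERIV_pos_imp_increasing) (use ecoord_deriv decoord_pos in blast)+

lemma ecoord_less_iff [simp]: "ecoord s < ecoord t \<longleftrightarrow> s < t"
  using ecoord_strict_mono by (metis linorder_less_linear order_less_asym)

lemma ecoord_eq_iff [simp]: "ecoord s = ecoord t \<longleftrightarrow> s = t"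
  using ecoord_strict_mono by (metis linorder_less_linear order_less_irrefl)

lemma decoord_isCont: "isCont decoord t"
proof (cases "t = 0")
  case True
  have "((\<lambda>t. ((xsq t - xpow t) / t) / (ecoord t / t)) \<longlongrightarrow> (1 + p) / sqrt (1 + p)) (at 0)"
    using p_pos by (intro tendsto_divide force_quotient_lim ecoord_quotient_lim) auto
  also have "(1 + p) / sqrt (1 + p) = sqrt (1 + p)"
    using p_pos by (simp add: real_div_sqrt)
  finally have "(decoord \<longlongrightarrow> sqrt (1 + p)) (at 0)"
    by (rule tendsto_cong[THEN iffD1, rotated]) (simp add: eventually_at_filter decoord_def)
  then show ?thesis using True by (simp add: isCont_def decoord_def)
next
  case False
  have "isCont (\<lambda>t. (xsq t - xpow t) / ecoord t) t"
    by (rule isCont_divide[OF DERIV_isCont[OF force_deriv] ecoord_isCont ecoord_nz[OF False]])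
  moreover have "\<forall>\<^sub>F s in nhds t. s \<in> - {0}"
    using False by (intro eventually_nhds_in_open) auto
  then have "\<forall>\<^sub>F s in nhds t. decoord s = (xsq s - xpow s) / ecoord s"
    by eventually_elim (simp add: decoord_def)
  ultimately show ?thesis by (simp only: isCont_cong)
qed

text \<open>The derivative of \<open>x\<close> with respect to \<open>ecoord\<close>, as a function of \<open>t = ln x\<close>.\<close>

definition slope :: "real \<Rightarrow> real" where "slope t = exp t / decoord t"

lemma slope_pos: "0 < slope t" using decoord_pos by (simp add: slope_def)

lemma slope_isCont: "isCont slope t"
  unfolding slope_def using decoord_pos[of t] decoord_isCont by (intro continuous_intros) auto

text \<open>The weight \<open>p * spot t + 3\<close> is chosen such that the derivative vanishes at the equilibrium for every \<open>p\<close>.  For \<open>p = 3\<close>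
the function is even constant, which reflects that the period does not depend on the amplitude.\<close>

definition wrate :: "real \<Rightarrow> real" where "wrate t = (p * spot t + 3) * slope t"

lemma wrate_isCont: "isCont wrate t"
  unfolding wrate_def by (intro continuous_intros slope_isCont DERIV_isCont[OF spot_deriv])

lemma wrate_deriv:
  assumes "t \<noteq> 0"
  shows "(wrate has_field_derivative exp t * test0 t / (ecoord t * (xsq t - xpow t)\<^sup>2)) (at t)"
proof -
  note nz = ecoord_nz[OF assms] force_nz[OF assms]
  have "((\<lambda>t. (p * spot t + 3) * (exp t * ecoord t / (xsq t - xpow t))) has_field_derivative
      exp t * test0 t / (ecoord t * (xsq t - xpow t)\<^sup>2)) (at t)"
    apply (rule derivative_eq_intros ecoord_deriv force_deriv refl nz)+
    using nz ecoord_sq[of t] assms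
    apply (simp add: decoord_def pot_def)
    apply (simp add: divide_simps test0_def Let_def)
    apply (simp add: power2_eq_square)
    apply algebra
    done
  moreover have "\<forall>\<^sub>F s in nhds t. s \<in> - {0}"
    using assms by (intro eventually_nhds_in_open) auto
  then have "\<forall>\<^sub>F s in nhds t. wrate s = (p * spot s + 3) * (exp s * ecoord s / (xsq s - xpow s))"
    by eventually_elim (auto simp: wrate_def slope_def decoord_def)
  ultimately show ?thesis by (simp only: DERIV_cong_ev[OF refl _ refl])
qed

section \<open>Behaviour at the singularity and at infinity\<close>

text \<open>The mean value theorem, with \<open>xpow\<close> monotone between \<open>0\<close> and \<open>t\<close>.\<close>

lemma spot_bound: "\<bar>spot t\<bar> \<le> \<bar>t\<bar> * (1 + xpow t)"
proof -
  have "\<exists>\<xi>. \<bar>\<xi>\<bar> \<le> \<bar>t\<bar> \<and> (0 \<le> \<xi> * t) \<and> \<bar>spot t\<bar> = \<bar>t\<bar> * xpow \<xi>"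
  proof (cases "t = 0")
    case False
    show ?thesis
    proof (cases "t < 0")
      case True
      obtain z where "t < z" "z < 0" "spot 0 - spot t = (0 - t) * (- xpow z)"
        using MVT2[OF True spot_deriv] by blast
      moreover from this have "spot t = - t * xpow z" by simp
      ultimately show ?thesis using True xpow_pos[of z]
        by (intro exI[of _ z]) (auto simp: abs_mult mult_nonpos_nonpos)
    next
      case F2: False
      with False have "0 < t" by simp
      then obtain z where "0 < z" "z < t" "spot t - spot 0 = (t - 0) * (- xpow z)"
        using MVT2[of 0 t spot, OF _ spot_deriv] by blast
      moreover from this have "spot t = - (t * xpow z)" by simp
      ultimately show ?thesis using xpow_pos[of z]
        by (intro exI[of _ z]) (auto simp: abs_mult)
    qed
  qed (auto intro!: exI[of _ 0])
  then obtain z where z: "\<bar>z\<bar> \<le> \<bar>t\<bar>" "0 \<le> z * t" "\<bar>spot t\<bar> = \<bar>t\<bar> * xpow z" by blast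
  have "xpow z \<le> 1 + xpow t"
  proof (cases "(1 - p) * z \<le> 0")
    case True
    then have "xpow z \<le> 1" by (simp add: xpow_def)
    then show ?thesis using xpow_pos[of t] by simp
  next
    case False
    then have "(1 - p) * z \<le> (1 - p) * t" using z(1,2)
      by (cases "0 < z"; cases "p < 1")
        (auto simp: zero_less_mult_iff mult_le_cancel_left zero_le_mult_iff not_le abs_if split: if_splits)
    then have "xpow z \<le> xpow t" by (simp add: xpow_def)
    then show ?thesis by simp
  qed
  then show ?thesis unfolding z(3) by (intro mult_left_mono) auto
qed

lemma pot_over_xsq_lim: "((\<lambda>t. 2 * pot t / xsq t) \<longlongrightarrow> 1) at_top"
proof -
  have "((\<lambda>t. \<bar>t\<bar> * (1 + xpow t) / xsq t) \<longlongrightarrow> 0) at_top"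
  proof -
    have "\<bar>t\<bar> * (1 + xpow t) / xsq t = \<bar>t\<bar> * exp (- 2 * t) + \<bar>t\<bar> * exp (- (p + 1) * t)" for t
      by (simp add: xpow_def xsq_def divide_inverse exp_minus[symmetric] exp_add[symmetric] algebra_simps)
    moreover have "((\<lambda>t. \<bar>t\<bar> * exp (- 2 * t) + \<bar>t\<bar> * exp (- (p + 1) * t)) \<longlongrightarrow> 0 + 0) at_top"
      using p_pos by (intro tendsto_add exp_decay) auto
    ultimately show ?thesis by simp
  qed
  moreover have "\<bar>spot t / xsq t\<bar> \<le> \<bar>t\<bar> * (1 + xpow t) / xsq t" for t
    using spot_bound[of t] xsq_pos[of t] by (simp add: divide_right_mono)
  ultimately have 1: "((\<lambda>t. spot t / xsq t) \<longlongrightarrow> 0) at_top"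
    by (intro Lim_null_comparison[of "\<lambda>t. spot t / xsq t"]) (auto intro!: always_eventually)
  have 2: "((\<lambda>t. 1 / xsq t) \<longlongrightarrow> 0) at_top"
    unfolding xsq_def by real_asymp
  have "((\<lambda>t. 1 - 1 / xsq t + 2 * (spot t / xsq t)) \<longlongrightarrow> 1 - 0 + 2 * 0) at_top"
    by (intro tendsto_intros 1 2)
  moreover have "1 - 1 / xsq t + 2 * (spot t / xsq t) = 2 * pot t / xsq t" for t
    using xsq_pos[of t] by (simp add: pot_def field_simps)
  ultimately show ?thesis by simp
qed

lemma pot_at_top: "filterlim (\<lambda>t. 2 * pot t) at_top at_top"
proof -
  have "filterlim xsq at_top at_top" unfolding xsq_def by real_asymp
  from filterlim_tendsto_pos_mult_at_top[OF pot_over_xsq_lim _ this]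
  have "filterlim (\<lambda>t. 2 * pot t / xsq t * xsq t) at_top at_top" by simp
  moreover have "2 * pot t / xsq t * xsq t = 2 * pot t" for t using xsq_pos[of t] by simp
  ultimately show ?thesis by simp
qed

lemma ecoord_at_top: "filterlim ecoord at_top at_top"
proof -
  have "filterlim (\<lambda>t. sqrt (2 * pot t)) at_top at_top"
    by (rule filterlim_compose[OF sqrt_at_top pot_at_top])
  moreover have "\<forall>\<^sub>F t in at_top. ecoord t = sqrt (2 * pot t)"
    using eventually_gt_at_top[of 0] by eventually_elim (simp add: ecoord_def)
  ultimately show ?thesis by (simp add: filterlim_cong)
qed

lemma slope_sq: "t \<noteq> 0 \<Longrightarrow> (slope t)\<^sup>2 = xsq t * (2 * pot t) / (xsq t - xpow t)\<^sup>2"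
  by (simp add: slope_def decoord_def power_divide power_mult_distrib ecoord_sq xsq_def exp_double)

text \<open>Far out the singular term is negligible, and the oscillator is harmonic.\<close>

lemma slope_at_top: "(slope \<longlongrightarrow> 1) at_top"
proof -
  have "((\<lambda>t. xpow t / xsq t) \<longlongrightarrow> 0) at_top"
  proof -
    have "xpow t / xsq t = exp (- (p + 1) * t)" for t
      by (simp add: xpow_def xsq_def divide_inverse exp_minus[symmetric] exp_add[symmetric] algebra_simps)
    then show ?thesis using exp_decay(3)[of "p + 1"] p_pos by simp
  qed
  then have "((\<lambda>t. sqrt (2 * pot t / xsq t / (1 - xpow t / xsq t)\<^sup>2)) \<longlongrightarrow> sqrt (1 / (1 - 0)\<^sup>2)) at_top"
    by (intro tendsto_intros pot_over_xsq_lim) auto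
  moreover have "\<forall>\<^sub>F t in at_top. sqrt (2 * pot t / xsq t / (1 - xpow t / xsq t)\<^sup>2) = slope t"
    using eventually_gt_at_top[of 0]
  proof eventually_elim
    case (elim t)
    have "2 * pot t / xsq t / (1 - xpow t / xsq t)\<^sup>2 = (slope t)\<^sup>2"
      using elim force_nz[of t] xsq_pos[of t] unfolding slope_sq[of t, OF less_imp_neq[OF elim, symmetric]]
      by (simp add: divide_simps power2_eq_square)
    then show ?case using slope_pos[of t] by simp
  qed
  ultimately show ?thesis by (simp add: tendsto_cong)
qed

text \<open>Close to the singularity the orbit is reflected: the passage takes no time in the limit.\<close>

lemma slope_at_bot: "(slope \<longlongrightarrow> 0) at_bot"
proof -
  \<comment> \<open>after division by \<open>xpow\<^sup>2\<close>, every power of \<open>x\<close> has a positive exponent\<close>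
  define B where "B = (\<lambda>t. 2 * \<bar>t\<bar> * (exp (2 * p * t) + exp ((p + 1) * t)) / (1 - exp ((p + 1) * t))\<^sup>2)"
  have "(B \<longlongrightarrow> 0) at_bot"
  proof -
    have "((\<lambda>t. 2 * (\<bar>t\<bar> * exp (2 * p * t) + \<bar>t\<bar> * exp ((p + 1) * t)) / (1 - exp ((p + 1) * t))\<^sup>2)
        \<longlongrightarrow> 2 * (0 + 0) / (1 - 0)\<^sup>2) at_bot"
      using p_pos by (intro tendsto_intros exp_decay) auto
    then show ?thesis by (simp add: B_def algebra_simps)
  qed
  moreover have "\<forall>\<^sub>F t in at_bot. norm ((slope t)\<^sup>2) \<le> B t"
    using eventually_gt_at_bot[of 0]
  proof eventually_elim
    case (elim t)
    have q: "xsq t = xpow t * exp ((p + 1) * t)" "xsq t = (xpow t)\<^sup>2 * exp (2 * p * t)"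
      by (auto simp: xsq_def xpow_def exp_add[symmetric] exp_double[symmetric] algebra_simps)
    have "2 * pot t \<le> 2 * \<bar>t\<bar> * (1 + xpow t)"
    proof -
      have "xsq t \<le> 1" using elim by (simp add: xsq_def)
      then have "2 * pot t \<le> 2 * spot t" by (simp add: pot_def field_simps)
      also have "\<dots> \<le> 2 * (\<bar>t\<bar> * (1 + xpow t))" using spot_bound[of t] by linarith
      finally show ?thesis by simp
    qed
    then have "(slope t)\<^sup>2 \<le> xsq t * (2 * \<bar>t\<bar> * (1 + xpow t)) / (xsq t - xpow t)\<^sup>2"
      using elim xsq_pos[of t] unfolding slope_sq[of t, OF less_imp_neq[OF elim]]
      by (intro divide_right_mono mult_left_mono) auto
    also have "\<dots> = 2 * \<bar>t\<bar> * (xsq t + xsq t * xpow t) / ((xpow t)\<^sup>2 * (1 - exp ((p + 1) * t))\<^sup>2)"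
    proof -
      have "(xsq t - xpow t)\<^sup>2 = (xpow t)\<^sup>2 * (1 - exp ((p + 1) * t))\<^sup>2"
        unfolding force_eq by (simp add: power_mult_distrib power2_commute)
      then show ?thesis by (simp only:) (simp add: algebra_simps)
    qed
    also have "xsq t + xsq t * xpow t = (xpow t)\<^sup>2 * (exp (2 * p * t) + exp ((p + 1) * t))"
      using q by (simp add: power2_eq_square algebra_simps)
    also have "2 * \<bar>t\<bar> * ((xpow t)\<^sup>2 * (exp (2 * p * t) + exp ((p + 1) * t))) / ((xpow t)\<^sup>2 * (1 - exp ((p + 1) * t))\<^sup>2) = B t"
      using xpow_pos[of t] by (simp add: B_def)
    finally show ?case by simp
  qed
  ultimately have "((\<lambda>t. (slope t)\<^sup>2) \<longlongrightarrow> 0) at_bot"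
    by (rule Lim_null_comparison[rotated])
  then have "((\<lambda>t. sqrt ((slope t)\<^sup>2)) \<longlongrightarrow> sqrt 0) at_bot"
    by (intro tendsto_intros)
  then show ?thesis using slope_pos by (simp add: less_imp_le)
qed

lemma ecoord_at_bot:
  assumes "1 \<le> p"
  shows "filterlim ecoord at_bot at_bot"
proof -
  have "filterlim (\<lambda>t. sqrt (- 1 - 2 * t)) at_top at_bot"
    by real_asymp
  then have *: "filterlim (\<lambda>t. - sqrt (- 1 - 2 * t)) at_bot at_bot"
    by (simp add: filterlim_uminus_at_top)
  have "ecoord t \<le> - sqrt (- 1 - 2 * t)" if "t < 0" for t
  proof -
    have "spot 0 + 0 \<le> spot t + t"
    proof (rule DERIV_nonpos_imp_nonincreasing[of t 0 "\<lambda>t. spot t + t"])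
      fix s assume "t \<le> s" "s \<le> 0"
      then have "1 \<le> xpow s" using assms by (simp add: xpow_def mult_nonpos_nonpos)
      then show "\<exists>y. ((\<lambda>t. spot t + t) has_real_derivative y) (at s) \<and> y \<le> 0"
        by (intro exI[of _ "- xpow s + 1"]) (auto intro!: derivative_eq_intros)
    qed (use that in simp)
    then have "- 1 - 2 * t \<le> 2 * pot t" using xsq_pos[of t] by (simp add: pot_def field_simps)
    then have "sqrt (- 1 - 2 * t) \<le> sqrt (2 * pot t)" by (rule real_sqrt_le_mono)
    then show ?thesis using that by (simp add: ecoord_def)
  qed
  then have "\<forall>\<^sub>F t in at_bot. ecoord t \<le> - sqrt (- 1 - 2 * t)"
    using eventually_gt_at_bot[of 0] by (rule eventually_mono[rotated])
  with * show ?thesis by (rule filterlim_at_bot_mono)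
qed

lemma ecoord_at_bot_sublinear:
  assumes "p < 1"
  shows "(ecoord \<longlongrightarrow> - sqrt ((1 + p) / (1 - p))) at_bot"
proof -
  have "((\<lambda>t. (xsq t - 1) + 2 * ((xpow t - 1) / (p - 1))) \<longlongrightarrow> (0 - 1) + 2 * ((0 - 1) / (p - 1))) at_bot"
    unfolding xsq_def xpow_def
    using exp_decay(1)[of 2] exp_decay(1)[of "1 - p"] assms by (intro tendsto_intros) auto
  moreover have "(xsq t - 1) + 2 * ((xpow t - 1) / (p - 1)) = 2 * pot t" for t
    using assms xpow_eq[of t] by (simp add: pot_def)
  moreover have "(0 - 1) + 2 * ((0 - 1) / (p - 1)) = (1 + p) / (1 - p)"
    using assms by (simp add: field_simps)
  ultimately have "((\<lambda>t. 2 * pot t) \<longlongrightarrow> (1 + p) / (1 - p)) at_bot" by simp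
  then have "((\<lambda>t. - sqrt (2 * pot t)) \<longlongrightarrow> - sqrt ((1 + p) / (1 - p))) at_bot"
    by (intro tendsto_intros)
  moreover have "\<forall>\<^sub>F t in at_bot. - sqrt (2 * pot t) = ecoord t"
    using eventually_gt_at_bot[of 0] by eventually_elim (simp add: ecoord_def)
  ultimately show ?thesis by (simp add: tendsto_cong)
qed

section \<open>The period as a function of the amplitude\<close>

text \<open>The attained values of \<open>ecoord\<close>: the whole line if \<open>p \<ge> 1\<close>, and a half-line \<open>{- amax<..}\<close> if \<open>p < 1\<close>, when the
potential is bounded at the singularity.\<close>

definition erange :: "real set" where "erange = range ecoord"
definition tau :: "real \<Rightarrow> real" where "tau = inv ecoord"

lemma inj_ecoord: "inj ecoord" by (rule injI) simp

lemma tau_ecoord [simp]: "tau (ecoord t) = t"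
  by (simp add: tau_def inj_ecoord)

lemma ecoord_in_erange [simp]: "ecoord t \<in> erange" by (simp add: erange_def)

lemma ecoord_tau: "h \<in> erange \<Longrightarrow> ecoord (tau h) = h"
  by (auto simp: erange_def)

lemma zero_in_erange [simp]: "0 \<in> erange" using ecoord_in_erange[of 0] by simp

lemma tau_0 [simp]: "tau 0 = 0" using tau_ecoord[of 0] by simp

lemma ecoord_cont: "continuous_on S ecoord"
  using ecoord_isCont by (simp add: continuous_at_imp_continuous_on)

lemma erange_up:
  assumes "h \<in> erange" "h \<le> h'"
  shows "h' \<in> erange"
proof -
  obtain t where t: "h = ecoord t" using assms by (auto simp: erange_def)
  have "\<forall>\<^sub>F s in at_top. h' \<le> ecoord s \<and> t \<le> s"
    using ecoord_at_top eventually_ge_at_top[of t] by (auto simp: filterlim_at_top eventually_conj_iff)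
  then obtain s where "h' \<le> ecoord s" "t \<le> s" using eventually_happens by fastforce
  then obtain u where "ecoord u = h'"
    using IVT'[of ecoord t h' s] assms t ecoord_cont by auto
  then show ?thesis using ecoord_in_erange by blast
qed

lemma erange_open_below:
  assumes "h \<in> erange" obtains h' where "h' < h" "h' \<in> erange"
proof -
  obtain t where "h = ecoord t" using assms by (auto simp: erange_def)
  then show ?thesis using that[of "ecoord (t - 1)"] by simp
qed

lemma tau_isCont:
  assumes "h \<in> erange" shows "isCont tau h"
proof -
  have "isCont tau (ecoord (tau h))"
    by (rule isCont_inverse_function2[of "tau h - 1" _ "tau h + 1"]) (auto simp: ecoord_isCont)
  then show ?thesis using assms by (simp add: ecoord_tau)
qed

lemma tau_deriv:
  assumes "h \<in> erange" shows "(tau has_field_derivative inverse (decoord (tau h))) (at h)"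
proof -
  obtain h' where h': "h' < h" "h' \<in> erange" using erange_open_below assms by blast
  show ?thesis
  proof (rule DERIV_inverse_function[of ecoord _ _ _ h' "h + 1"])
    show "(ecoord has_field_derivative decoord (tau h)) (at (tau h))" by (rule ecoord_deriv)
    show "decoord (tau h) \<noteq> 0" using decoord_pos[of "tau h"] by simp
    show "ecoord (tau y) = y" if "h' < y" for y using that h' erange_up by (auto intro!: ecoord_tau)
  qed (use h' assms tau_isCont in auto)
qed

text \<open>The derivative of \<open>x\<close> with respect to the energy coordinate, extended by \<open>0\<close>.\<close>

definition rate :: "real \<Rightarrow> real" where "rate h = (if h \<in> erange then slope (tau h) else 0)"
definition xpos :: "real \<Rightarrow> real" where "xpos h = exp (tau h)"

lemma xpos_deriv:
  assumes "h \<in> erange" shows "(xpos has_field_derivative rate h) (at h)"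
  unfolding xpos_def using assms
  by (auto intro!: derivative_eq_intros tau_deriv simp: rate_def slope_def divide_inverse)

lemma rate_nonneg: "0 \<le> rate h" using slope_pos by (simp add: rate_def less_imp_le)

lemma rate_pos: "h \<in> erange \<Longrightarrow> 0 < rate h" using slope_pos by (simp add: rate_def)

lemma extension_small:
  fixes F :: "real \<Rightarrow> real"
  assumes "(F \<longlongrightarrow> 0) at_bot" "0 < e"
  obtains t0 where "\<And>h. h < ecoord t0 \<Longrightarrow> \<bar>if h \<in> erange then F (tau h) else 0\<bar> < e"
proof -
  have "\<forall>\<^sub>F t in at_bot. \<bar>F t\<bar> < e"
    using tendstoD[OF assms] by (simp add: dist_real_def)
  then obtain t0 where t0: "\<And>t. t \<le> t0 \<Longrightarrow> \<bar>F t\<bar> < e"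
    by (auto simp: eventually_at_bot_linorder)
  have "\<bar>if h \<in> erange then F (tau h) else 0\<bar> < e" if "h < ecoord t0" for h
  proof (cases "h \<in> erange")
    case True
    then have "tau h < t0" using that ecoord_tau[OF True] by (metis ecoord_less_iff)
    then show ?thesis using t0[of "tau h"] True by simp
  qed (use assms in simp)
  then show ?thesis using that by blast
qed

text \<open>A function of \<open>t\<close> that vanishes at the singularity stays continuous when it is regarded as a function of the
energy coordinate and extended by \<open>0\<close> beyond the attained values.  The period is thereby defined and
continuous for all amplitudes, including the limiting one in the case \<open>p < 1\<close>.\<close>

lemma extension_isCont:
  fixes F :: "real \<Rightarrow> real"
  assumes F: "\<And>t. isCont F t" "(F \<longlongrightarrow> 0) at_bot"
  shows "isCont (\<lambda>h. if h \<in> erange then F (tau h) else 0) h"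
    (is "isCont ?E h")
proof (cases "h \<in> erange")
  case True
  obtain h' where h': "h' < h" "h' \<in> erange" using erange_open_below True by blast
  have "\<forall>\<^sub>F s in nhds h. s \<in> {h'<..}"
    using h' by (intro eventually_nhds_in_open) auto
  then have "\<forall>\<^sub>F s in nhds h. ?E s = F (tau s)"
    by eventually_elim (use h' erange_up in auto)
  moreover have "isCont (\<lambda>s. F (tau s)) h"
    using isCont_o2[OF tau_isCont[OF True] F(1)] .
  ultimately show ?thesis by (simp only: isCont_cong)
next
  case False
  show ?thesis unfolding isCont_def
  proof (rule tendstoI)
    fix e :: real assume "0 < e"
    then obtain t0 where t0: "\<And>h. h < ecoord t0 \<Longrightarrow> \<bar>?E h\<bar> < e" using extension_small F(2) by blast
    have "h < ecoord t0" using False erange_up[of "ecoord t0" h] by force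
    then have "\<forall>\<^sub>F s in at h. s \<in> {..<ecoord t0}"
      by (intro eventually_at_in_open') auto
    then show "\<forall>\<^sub>F s in at h. dist (?E s) (?E h) < e"
    proof eventually_elim
      case (elim s)
      then show ?case using t0[of s] False by (simp add: dist_real_def)
    qed
  qed
qed

lemma rate_isCont: "isCont rate h"
  unfolding rate_def[abs_def] by (rule extension_isCont[OF slope_isCont slope_at_bot])

lemma rate_cont: "continuous_on S rate"
  using rate_isCont by (simp add: continuous_at_imp_continuous_on)

definition period :: "real \<Rightarrow> real" where
  "period r = integral {0..2*pi} (\<lambda>\<phi>. rate (r * sin \<phi>))"

lemma rate_sin_cont: "continuous_on S (\<lambda>\<phi>. rate (r * sin \<phi>))"
  by (rule continuous_on_compose2[OF rate_cont[of UNIV]]) (auto intro!: continuous_intros)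

lemma period_cont: "continuous_on S period"
proof -
  have "continuous_on (S \<times> cbox 0 (2*pi)) (\<lambda>(r, \<phi>). rate (r * sin \<phi>))"
    unfolding split_beta
    by (rule continuous_on_compose2[OF rate_cont[of UNIV]]) (auto intro!: continuous_intros)
  from integral_continuous_on_param[OF this] show ?thesis
    by (simp add: period_def[abs_def])
qed

lemma period_0: "period 0 = 2 * pi / sqrt (1 + p)"
  by (simp add: period_def rate_def slope_def decoord_def)

text \<open>The amplitudes of periodic orbits: the innermost point of the orbit has energy coordinate \<open>- r\<close>.  The outermost
point imposes no condition, because \<open>erange\<close> is unbounded above.\<close>

definition amps :: "real set" where "amps = {r. 0 \<le> r \<and> - r \<in> erange}"

lemma amps_erange: "r \<in> amps \<Longrightarrow> r * sin \<phi> \<in> erange"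
  using sin_ge_minus_one[of \<phi>] mult_left_mono[of "-1" "sin \<phi>" r]
  by (auto simp: amps_def intro: erange_up)

lemma amps_down: "r \<in> amps \<Longrightarrow> 0 \<le> s \<Longrightarrow> s \<le> r \<Longrightarrow> s \<in> amps"
  by (auto simp: amps_def intro: erange_up)

lemma zero_amps [simp]: "0 \<in> amps" by (simp add: amps_def)

lemma amps_open_above:
  assumes "r \<in> amps" obtains r' where "r < r'" "r' \<in> amps"
proof -
  obtain h where "h < - r" "h \<in> erange" using assms erange_open_below by (auto simp: amps_def)
  then show ?thesis using that[of "- h"] assms by (auto simp: amps_def)
qed

lemma period_pos: "r \<in> amps \<Longrightarrow> 0 < period r"
proof -
  assume "r \<in> amps"
  then have "integral {0..2*pi} (\<lambda>\<phi>. 0) < integral {0..2*pi} (\<lambda>\<phi>. rate (r * sin \<phi>))"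
    using pi_gt_zero by (intro integral_less_real rate_sin_cont) (auto intro!: rate_pos amps_erange simp del: pi_gt_zero)
  then show ?thesis by (simp add: period_def)
qed

section \<open>Action, and strict monotonicity of the period\<close>

text \<open>This is the area \<open>\<integral> v dx\<close> enclosed by the orbit in the phase plane, after an integration by parts.\<close>

definition action :: "real \<Rightarrow> real" where
  "action r = integral {0..2*pi} (\<lambda>\<phi>. r * sin \<phi> * xpos (r * sin \<phi>))"

definition wperiod :: "real \<Rightarrow> real" where
  "wperiod r = integral {0..2*pi} (\<lambda>\<phi>. wrate (tau (r * sin \<phi>)))"

lemma xpos_isCont: "h \<in> erange \<Longrightarrow> isCont xpos h"
  using xpos_deriv DERIV_isCont by blast

lemma xpos_cont: "S \<subseteq> erange \<Longrightarrow> continuous_on S xpos"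
  using xpos_isCont by (auto intro!: continuous_at_imp_continuous_on)

lemma tau_cont: "S \<subseteq> erange \<Longrightarrow> continuous_on S tau"
  using tau_isCont by (auto intro!: continuous_at_imp_continuous_on)

lemma xpos_sin_cont: "r \<in> amps \<Longrightarrow> continuous_on S (\<lambda>\<phi>. xpos (r * sin \<phi>))"
  by (rule continuous_on_compose2[OF xpos_cont[of erange]]) (auto intro!: continuous_intros amps_erange)

lemma tau_sin_cont: "r \<in> amps \<Longrightarrow> continuous_on S (\<lambda>\<phi>. tau (r * sin \<phi>))"
  by (rule continuous_on_compose2[OF tau_cont[of erange]]) (auto intro!: continuous_intros amps_erange)

lemma wrate_cont: "continuous_on S wrate"
  using wrate_isCont by (simp add: continuous_at_imp_continuous_on)

lemma wrate_sin_cont: "r \<in> amps \<Longrightarrow> continuous_on S (\<lambda>\<phi>. wrate (tau (r * sin \<phi>)))"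
  by (rule continuous_on_compose2[OF wrate_cont[of UNIV]]) (auto intro!: tau_sin_cont)

lemma integral_sin_xpos:
  assumes "r \<in> amps"
  shows "integral {0..2*pi} (\<lambda>\<phi>. sin \<phi> * xpos (r * sin \<phi>))
       = integral {0..2*pi} (\<lambda>\<phi>. r * (cos \<phi>)\<^sup>2 * rate (r * sin \<phi>))"
proof -
  have d: "((\<lambda>\<phi>. - cos \<phi> * xpos (r * sin \<phi>)) has_field_derivative
      sin \<phi> * xpos (r * sin \<phi>) - r * (cos \<phi>)\<^sup>2 * rate (r * sin \<phi>)) (at \<phi>)" for \<phi>
    using amps_erange[OF assms, of \<phi>]
    by (auto intro!: derivative_eq_intros DERIV_chain2[OF xpos_deriv] simp: power2_eq_square algebra_simps)
  have "((\<lambda>\<phi>. sin \<phi> * xpos (r * sin \<phi>) - r * (cos \<phi>)\<^sup>2 * rate (r * sin \<phi>)) has_integral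
     (- cos (2*pi) * xpos (r * sin (2*pi)) - (- cos 0 * xpos (r * sin 0)))) {0..2*pi}"
    by (rule fundamental_theorem_of_calculus)
      (use has_field_derivative_at_within[OF d] in \<open>auto simp: has_real_derivative_iff_has_vector_derivative[symmetric]\<close>)
  then have "integral {0..2*pi} (\<lambda>\<phi>. sin \<phi> * xpos (r * sin \<phi>) - r * (cos \<phi>)\<^sup>2 * rate (r * sin \<phi>)) = 0"
    by (simp add: integral_unique)
  moreover have "(\<lambda>\<phi>. sin \<phi> * xpos (r * sin \<phi>)) integrable_on {0..2*pi}"
    "(\<lambda>\<phi>. r * (cos \<phi>)\<^sup>2 * rate (r * sin \<phi>)) integrable_on {0..2*pi}"
    using assms by (auto intro!: integrable_continuous_interval continuous_intros xpos_sin_cont rate_sin_cont)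
  ultimately show ?thesis by (simp add: integral_diff)
qed

text \<open>The derivative of the action with respect to the energy is the period, and the energy is \<open>r\<^sup>2 / 2\<close>.\<close>

lemma action_deriv:
  assumes "R \<in> amps" "r \<in> {0..R}"
  shows "(action has_field_derivative r * period r) (at r within {0..R})"
proof -
  have amps: "s \<in> amps" if "s \<in> {0..R}" for s using that assms amps_down by auto
  have c1: "continuous_on ({0..R} \<times> cbox 0 (2*pi)) (\<lambda>(r, \<phi>). xpos (r * sin \<phi>))"
    unfolding split_beta
    by (rule continuous_on_compose2[OF xpos_cont[of erange]]) (auto intro!: continuous_intros amps amps_erange)
  have c2: "continuous_on ({0..R} \<times> cbox 0 (2*pi)) (\<lambda>(r, \<phi>). rate (r * sin \<phi>))"
    unfolding split_beta
    by (rule continuous_on_compose2[OF rate_cont[of UNIV]]) (auto intro!: continuous_intros)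
  have "((\<lambda>r. integral (cbox 0 (2*pi)) (\<lambda>\<phi>. r * sin \<phi> * xpos (r * sin \<phi>))) has_field_derivative
     integral (cbox 0 (2*pi)) (\<lambda>\<phi>. sin \<phi> * xpos (r * sin \<phi>) + r * (sin \<phi>)\<^sup>2 * rate (r * sin \<phi>))) (at r within {0..R})"
  proof (rule leibniz_rule_field_derivative)
    fix s \<phi> :: real assume "s \<in> {0..R}"
    then have "s * sin \<phi> \<in> erange" using amps amps_erange by blast
    then have "((\<lambda>r. r * sin \<phi> * xpos (r * sin \<phi>)) has_field_derivative
       sin \<phi> * xpos (s * sin \<phi>) + s * (sin \<phi>)\<^sup>2 * rate (s * sin \<phi>)) (at s)"
      by (auto intro!: derivative_eq_intros DERIV_chain2[OF xpos_deriv] simp: power2_eq_square algebra_simps)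
    then show "((\<lambda>r. r * sin \<phi> * xpos (r * sin \<phi>)) has_field_derivative
       sin \<phi> * xpos (s * sin \<phi>) + s * (sin \<phi>)\<^sup>2 * rate (s * sin \<phi>)) (at s within {0..R})"
      by (rule has_field_derivative_at_within)
  next
    fix s assume "s \<in> {0..R}"
    then show "(\<lambda>\<phi>. s * sin \<phi> * xpos (s * sin \<phi>)) integrable_on cbox 0 (2*pi)"
      using amps by (auto intro!: integrable_continuous_interval continuous_intros xpos_sin_cont)
  next
    show "continuous_on ({0..R} \<times> cbox 0 (2*pi))
       (\<lambda>(r, \<phi>). sin \<phi> * xpos (r * sin \<phi>) + r * (sin \<phi>)\<^sup>2 * rate (r * sin \<phi>))"
      using c1 c2 unfolding split_beta by (auto intro!: continuous_intros)
  qed (use assms in auto)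
  also have "integral (cbox 0 (2*pi)) (\<lambda>\<phi>. sin \<phi> * xpos (r * sin \<phi>) + r * (sin \<phi>)\<^sup>2 * rate (r * sin \<phi>)) = r * period r"
  proof -
    note r = amps[OF assms(2)]
    have i: "(\<lambda>\<phi>. sin \<phi> * xpos (r * sin \<phi>)) integrable_on {0..2*pi}"
      "(\<lambda>\<phi>. r * (sin \<phi>)\<^sup>2 * rate (r * sin \<phi>)) integrable_on {0..2*pi}"
      "(\<lambda>\<phi>. r * (cos \<phi>)\<^sup>2 * rate (r * sin \<phi>)) integrable_on {0..2*pi}"
      using r by (auto intro!: integrable_continuous_interval continuous_intros xpos_sin_cont rate_sin_cont)
    have "integral {0..2*pi} (\<lambda>\<phi>. sin \<phi> * xpos (r * sin \<phi>) + r * (sin \<phi>)\<^sup>2 * rate (r * sin \<phi>))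
      = integral {0..2*pi} (\<lambda>\<phi>. r * (cos \<phi>)\<^sup>2 * rate (r * sin \<phi>) + r * (sin \<phi>)\<^sup>2 * rate (r * sin \<phi>))"
      using i integral_sin_xpos[OF r] by (simp add: integral_add)
    also have "\<dots> = integral {0..2*pi} (\<lambda>\<phi>. r * rate (r * sin \<phi>))"
      by (simp add: distrib_right[symmetric] distrib_left[symmetric] add.commute[of "(cos _)\<^sup>2"])
    finally show ?thesis by (simp add: period_def)
  qed
  finally show ?thesis by (simp add: action_def[abs_def])
qed

text \<open>The action has the two integrands \<open>v\<^sup>2 * rate h\<close>, where \<open>v\<^sup>2 = r\<^sup>2 - h\<^sup>2\<close>, and \<open>h * x\<close>.  In their sum the quadratic part
of the potential cancels, and only the singular part remains.  The weight of \<open>wperiod\<close> absorbs it.\<close>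

lemma period_identity:
  assumes r: "r \<in> amps"
  shows "(p * r\<^sup>2 + 3 * (p + 1)) * period r = 2 * p * action r + (p + 1) * wperiod r"
proof -
  have i: "(\<lambda>\<phi>. r * sin \<phi> * xpos (r * sin \<phi>)) integrable_on {0..2*pi}"
    "(\<lambda>\<phi>. wrate (tau (r * sin \<phi>))) integrable_on {0..2*pi}"
    "(\<lambda>\<phi>. sin \<phi> * xpos (r * sin \<phi>)) integrable_on {0..2*pi}"
    "(\<lambda>\<phi>. r * (cos \<phi>)\<^sup>2 * rate (r * sin \<phi>)) integrable_on {0..2*pi}"
    "(\<lambda>\<phi>. rate (r * sin \<phi>)) integrable_on {0..2*pi}"
    using r by (auto intro!: integrable_continuous_interval continuous_intros xpos_sin_cont rate_sin_cont wrate_sin_cont)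
  have "action r = r * integral {0..2*pi} (\<lambda>\<phi>. sin \<phi> * xpos (r * sin \<phi>))"
    unfolding action_def by (simp add: mult.assoc)
  also have "\<dots> = r * integral {0..2*pi} (\<lambda>\<phi>. r * (cos \<phi>)\<^sup>2 * rate (r * sin \<phi>))"
    by (simp add: integral_sin_xpos[OF r])
  finally have A: "action r = r * integral {0..2*pi} (\<lambda>\<phi>. r * (cos \<phi>)\<^sup>2 * rate (r * sin \<phi>))" .
  have "p * action r + p * action r + (p + 1) * wperiod r =
     integral {0..2*pi} (\<lambda>\<phi>. p * (r * sin \<phi> * xpos (r * sin \<phi>))
       + p * (r * (r * (cos \<phi>)\<^sup>2 * rate (r * sin \<phi>))) + (p + 1) * wrate (tau (r * sin \<phi>)))"
    (is "_ = integral _ ?f")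
  proof -
    have "integral {0..2*pi} ?f = p * integral {0..2*pi} (\<lambda>\<phi>. r * sin \<phi> * xpos (r * sin \<phi>))
       + p * (r * integral {0..2*pi} (\<lambda>\<phi>. r * (cos \<phi>)\<^sup>2 * rate (r * sin \<phi>)))
       + (p + 1) * integral {0..2*pi} (\<lambda>\<phi>. wrate (tau (r * sin \<phi>)))"
      using i by (subst integral_add integral_mult_right integrable_add integrable_on_mult_right | simp add: integrable_on_mult_right integrable_add)+
    then show ?thesis using A by (simp add: action_def wperiod_def)
  qed
  also have "?f = (\<lambda>\<phi>. (p * r\<^sup>2 + 3 * (p + 1)) * rate (r * sin \<phi>))"
  proof
    fix \<phi>
    define t where "t = tau (r * sin \<phi>)"
    have hR: "r * sin \<phi> \<in> erange" using r amps_erange by blast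
    then have h: "ecoord t = r * sin \<phi>" by (simp add: t_def ecoord_tau)
    have K: "rate (r * sin \<phi>) = slope t" using hR by (simp add: rate_def t_def)
    have 1: "r * sin \<phi> * xpos (r * sin \<phi>) = (xsq t - xpow t) * slope t"
      using decoord_ecoord[of t, symmetric] decoord_pos[of t] h by (simp add: xpos_def slope_def t_def[symmetric])
    have "r * (r * (cos \<phi>)\<^sup>2) = r\<^sup>2 - (ecoord t)\<^sup>2"
      unfolding h by (simp add: power2_eq_square[of r] power_mult_distrib cos_squared_eq algebra_simps)
    also have "(ecoord t)\<^sup>2 = xsq t - 1 + 2 * spot t"
      unfolding ecoord_sq pot_def by (simp add: field_simps)
    finally have 2: "r * (r * (cos \<phi>)\<^sup>2 * slope t) = (r\<^sup>2 - (xsq t - 1 + 2 * spot t)) * slope t"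
      by (simp add: mult.assoc[symmetric])
    show "?f \<phi> = (p * r\<^sup>2 + 3 * (p + 1)) * rate (r * sin \<phi>)"
      unfolding 1 K 2 t_def[symmetric] wrate_def xpow_eq by (simp add: algebra_simps)
  qed
  also have "integral {0..2*pi} (\<lambda>\<phi>. (p * r\<^sup>2 + 3 * (p + 1)) * rate (r * sin \<phi>))
      = (p * r\<^sup>2 + 3 * (p + 1)) * period r"
    by (simp only: period_def integral_mult_right)
  finally show ?thesis by simp
qed

lemma wrate_cont_on: "continuous_on S (\<lambda>t. (p - 3) * wrate t)"
  by (intro continuous_intros wrate_cont)

lemma wrate_deriv_sign:
  assumes "p \<noteq> 3" "t \<noteq> 0"
  obtains D where "((\<lambda>t. (p - 3) * wrate t) has_field_derivative D) (at t)" "0 < t * D"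
proof -
  define D where "D = (p - 3) * (exp t * test0 t / (ecoord t * (xsq t - xpow t)\<^sup>2))"
  have "((\<lambda>t. (p - 3) * wrate t) has_field_derivative D) (at t)"
    unfolding D_def by (rule DERIV_cmult[OF wrate_deriv[OF assms(2)]])
  moreover have "t * D = exp t * ((p - 3) * test0 t) * (t / ecoord t) / (xsq t - xpow t)\<^sup>2"
    by (simp add: D_def)
  moreover have "0 < t / ecoord t"
    using assms(2) ecoord_pos[of t] ecoord_neg[of t] by (cases "0 < t") (auto simp: divide_neg_neg)
  then have "0 < exp t * ((p - 3) * test0 t) * (t / ecoord t) / (xsq t - xpow t)\<^sup>2"
    using test0_sign[OF assms] force_nz[OF assms(2)]
    by (intro divide_pos_pos[of "_ * _ * _"] mult_pos_pos[of "_ * _" "t / _"] mult_pos_pos[of "exp t"]) auto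
  ultimately show ?thesis using that by metis
qed

lemma wrate_less:
  assumes "p \<noteq> 3" and st: "0 \<le> s \<and> s < t \<or> t < s \<and> s \<le> 0"
  shows "(p - 3) * wrate s < (p - 3) * wrate t"
  using st
proof
  assume st: "0 \<le> s \<and> s < t"
  show ?thesis
  proof (rule DERIV_pos_imp_increasing_open[of s t "\<lambda>t. (p - 3) * wrate t"])
    fix x assume "s < x" "x < t"
    then have x: "0 < x" using st by simp
    obtain D where "((\<lambda>t. (p - 3) * wrate t) has_field_derivative D) (at x)" "0 < x * D"
      using wrate_deriv_sign[of x] assms(1) x by auto
    then show "\<exists>y. ((\<lambda>t. (p - 3) * wrate t) has_field_derivative y) (at x) \<and> 0 < y"
      using x by (auto simp: zero_less_mult_iff)
  qed (use st wrate_cont_on in auto)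
next
  assume st: "t < s \<and> s \<le> 0"
  show ?thesis
  proof (rule DERIV_neg_imp_decreasing_open[of t s "\<lambda>t. (p - 3) * wrate t"])
    fix x assume "t < x" "x < s"
    then have x: "x < 0" using st by simp
    obtain D where "((\<lambda>t. (p - 3) * wrate t) has_field_derivative D) (at x)" "0 < x * D"
      using wrate_deriv_sign[of x] assms(1) x by auto
    then show "\<exists>y. ((\<lambda>t. (p - 3) * wrate t) has_field_derivative y) (at x) \<and> y < 0"
      using x by (auto simp: zero_less_mult_iff)
  qed (use st wrate_cont_on in auto)
qed

lemma tau_less: "h \<in> erange \<Longrightarrow> k \<in> erange \<Longrightarrow> h < k \<Longrightarrow> tau h < tau k"
  by (metis ecoord_less_iff ecoord_tau)

lemma wperiod_less:
  assumes "p \<noteq> 3" "r \<in> amps" "s \<in> amps" "r < s"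
  shows "(p - 3) * wperiod r < (p - 3) * wperiod s"
proof -
  have nz: "(p - 3) * wrate (tau (r * sin \<phi>)) < (p - 3) * wrate (tau (s * sin \<phi>))" if "sin \<phi> \<noteq> 0" for \<phi>
  proof -
    note R = amps_erange[OF assms(2), of \<phi>] amps_erange[OF assms(3), of \<phi>]
    have r: "0 \<le> r" using assms by (simp add: amps_def)
    show ?thesis
    proof (cases "0 < sin \<phi>")
      case True
      then have "tau (r * sin \<phi>) < tau (s * sin \<phi>)" using tau_less[OF R] assms(4) by simp
      moreover have "tau 0 \<le> tau (r * sin \<phi>)"
        using tau_less[OF zero_in_erange R(1)] r True by (cases "r = 0") auto
      ultimately show ?thesis using assms(1) by (intro wrate_less) auto
    next
      case False
      with that have neg: "sin \<phi> < 0" by simp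
      then have "tau (s * sin \<phi>) < tau (r * sin \<phi>)" using tau_less[OF R(2,1)] assms(4) by simp
      moreover have "tau (r * sin \<phi>) \<le> tau 0"
        using tau_less[OF R(1) zero_in_erange] r neg by (cases "r = 0") (auto simp: mult_pos_neg)
      ultimately show ?thesis using assms(1) by (intro wrate_less) auto
    qed
  qed
  have "integral {0..2*pi} (\<lambda>\<phi>. (p - 3) * wrate (tau (r * sin \<phi>)))
      < integral {0..2*pi} (\<lambda>\<phi>. (p - 3) * wrate (tau (s * sin \<phi>)))"
  proof (rule integral_strict_mono_exists[where c = "pi / 2"])
    show "(p - 3) * wrate (tau (r * sin \<phi>)) \<le> (p - 3) * wrate (tau (s * sin \<phi>))" for \<phi>
      using nz[of \<phi>] by (cases "sin \<phi> = 0") auto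
    show "(p - 3) * wrate (tau (r * sin (pi / 2))) < (p - 3) * wrate (tau (s * sin (pi / 2)))"
      by (rule nz) simp
  qed (use assms wrate_sin_cont in \<open>auto intro!: continuous_intros\<close>)
  then show ?thesis by (simp add: wperiod_def)
qed

text \<open>With \<open>D = p * r\<^sup>2 + 3 * (p + 1)\<close> the identity reads \<open>period = (2 * p * action + (p + 1) * wperiod) / D\<close>.  Freezing \<open>wperiod\<close>
at its value for \<open>r\<close> gives a function \<open>V\<close> whose derivative is a positive multiple of the increase of
\<open>wperiod\<close>.  So \<open>V\<close> is monotone, and unfreezing \<open>wperiod\<close> at \<open>s\<close> adds a strict increase.  The factor \<open>p - 3\<close> makes
both signs one case.\<close>

lemma period_strict_mono:
  assumes "p \<noteq> 3" "s \<in> amps" "0 \<le> r" "r < s"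
  shows "(p - 3) * period r < (p - 3) * period s"
proof -
  have r: "r \<in> amps" using assms amps_down by auto
  define D where "D = (\<lambda>x. p * x\<^sup>2 + 3 * (p + 1))"
  have D: "0 < D x" for x using p_pos by (simp add: D_def add_nonneg_pos)
  define V where "V = (\<lambda>x. (p - 3) * ((2 * p * action x + (p + 1) * wperiod r) / D x))"
  have T: "period x = (2 * p * action x + (p + 1) * wperiod x) / D x" if "x \<in> amps" for x
    using period_identity[OF that] D[of x] by (simp add: D_def field_simps)
  have Vd: "(V has_field_derivative 2 * p * (p + 1) * x * ((p - 3) * wperiod x - (p - 3) * wperiod r) / (D x)\<^sup>2) (at x within {0..s})"
    if x: "x \<in> {0..s}" for x
  proof -
    have xa: "x \<in> amps" using x assms amps_down by auto
    have "(V has_field_derivative (p - 3) * (((2 * p * (x * period x)) * D x - (2 * p * action x + (p + 1) * wperiod r) * (2 * p * x)) / (D x * D x))) (at x within {0..s})"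
      unfolding V_def D_def
      using D[of x] x unfolding D_def
      by (intro DERIV_cmult DERIV_divide)
        (auto intro!: derivative_eq_intros action_deriv[OF assms(2)])
    also have "2 * p * (x * period x) * D x = 2 * p * x * (2 * p * action x + (p + 1) * wperiod x)"
      using T[OF xa] D[of x] by simp
    finally show ?thesis by (simp add: algebra_simps power2_eq_square)
  qed
  have "V r \<le> V s"
  proof (rule DERIV_nonneg_imp_increasing_open[of r s V])
    show "r \<le> s" using assms by simp
    have "continuous_on {0..s} V" using Vd by (rule DERIV_continuous_on)
    then show "continuous_on {r..s} V" by (rule continuous_on_subset) (use assms in auto)
    fix x assume x: "r < x" "x < s"
    have "at x within {0..s} = at x"
      using x assms by (intro at_within_interior) (auto simp: interior_atLeastAtMost_real)
    moreover have "x \<in> amps" using x assms amps_down by auto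
    then have "0 \<le> 2 * p * (p + 1) * x * ((p - 3) * wperiod x - (p - 3) * wperiod r) / (D x)\<^sup>2"
      using wperiod_less[of r x] r x assms p_pos by (intro divide_nonneg_nonneg mult_nonneg_nonneg) auto
    ultimately show "\<exists>y. (V has_field_derivative y) (at x) \<and> 0 \<le> y"
      using Vd[of x] x assms by auto
  qed
  moreover have "V r = (p - 3) * period r" using T[OF r] by (simp add: V_def)
  moreover have "V s < (p - 3) * period s"
  proof -
    have "(p - 3) * period s - V s = (p + 1) * ((p - 3) * wperiod s - (p - 3) * wperiod r) / D s"
      using T[OF assms(2)] by (simp add: V_def diff_divide_distrib add_divide_distrib algebra_simps)
    also have "\<dots> > 0" using wperiod_less[of r s] r assms p_pos D[of s] by (intro divide_pos_pos mult_pos_pos) auto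
    finally show ?thesis by simp
  qed
  ultimately show ?thesis by simp
qed

section \<open>Limits of the period\<close>

lemma erange_UNIV: assumes "1 \<le> p" shows "erange = UNIV"
proof -
  have "h \<in> erange" for h
  proof -
    have "\<forall>\<^sub>F t in at_bot. ecoord t \<le> h"
      using ecoord_at_bot[OF assms] by (simp add: filterlim_at_bot)
    then obtain t where "ecoord t \<le> h" using eventually_happens by fastforce
    then show ?thesis using erange_up ecoord_in_erange by blast
  qed
  then show ?thesis by blast
qed

lemma rate_at_bot: "(rate \<longlongrightarrow> 0) at_bot"
proof (rule tendstoI)
  fix e :: real assume "0 < e"
  then obtain t0 where t0: "\<And>h. h < ecoord t0 \<Longrightarrow> \<bar>rate h\<bar> < e"
    using extension_small[OF slope_at_bot] unfolding rate_def by blast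
  show "\<forall>\<^sub>F h in at_bot. dist (rate h) 0 < e"
    using eventually_gt_at_bot[of "ecoord t0"] by eventually_elim (use t0 in simp)
qed

lemma rate_at_top: "(rate \<longlongrightarrow> 1) at_top"
proof (rule tendstoI)
  fix e :: real assume "0 < e"
  with slope_at_top have "\<forall>\<^sub>F t in at_top. dist (slope t) 1 < e" by (rule tendstoD)
  then obtain t0 where t0: "\<And>t. t0 \<le> t \<Longrightarrow> dist (slope t) 1 < e"
    by (auto simp: eventually_at_top_linorder)
  show "\<forall>\<^sub>F h in at_top. dist (rate h) 1 < e"
    using eventually_gt_at_top[of "ecoord t0"]
  proof eventually_elim
    case (elim h)
    then have "h \<in> erange" using erange_up[of "ecoord t0"] by simp
    moreover from this have "t0 < tau h" using elim ecoord_tau by (metis ecoord_less_iff)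
    ultimately show ?case using t0[of "tau h"] by (simp add: rate_def)
  qed
qed

lemma rate_bounded: obtains B where "\<And>h. rate h \<le> B"
proof -
  have "\<forall>\<^sub>F h in at_top. rate h < 2" by (rule order_tendstoD[OF rate_at_top]) simp
  then obtain a where a: "\<And>h. a \<le> h \<Longrightarrow> rate h < 2" by (auto simp: eventually_at_top_linorder)
  have "\<forall>\<^sub>F h in at_bot. rate h < 2" by (rule order_tendstoD[OF rate_at_bot]) simp
  then obtain b where b: "\<And>h. h \<le> b \<Longrightarrow> rate h < 2" by (auto simp: eventually_at_bot_linorder)
  have "compact (rate ` {b..a})" by (intro compact_continuous_image rate_cont) auto
  then have "bdd_above (rate ` {b..a})"
    by (simp add: bounded_imp_bdd_above compact_imp_bounded)
  then obtain M where M: "\<And>h. h \<in> {b..a} \<Longrightarrow> rate h \<le> M"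
    unfolding bdd_above_def by blast
  have "rate h \<le> max M 2" for h
    using a[of h] b[of h] M[of h] by (cases "h \<le> b"; cases "a \<le> h") (auto simp: max_def)
  then show ?thesis using that by blast
qed

text \<open>The integrand tends to \<open>1\<close> on the outer half turn and to \<open>0\<close> on the inner one.\<close>

lemma period_limit:
  "(\<lambda>n. period (real n)) \<longlonglongrightarrow> pi"
proof -
  \<comment> \<open>the pointwise limit; the value where the sine vanishes is immaterial for the integral\<close>
  define g :: "real \<Rightarrow> real" where "g = (\<lambda>\<phi>. if 0 < sin \<phi> then 1 else if sin \<phi> < 0 then 0 else rate 0)"
  obtain B where B: "\<And>h. rate h \<le> B" using rate_bounded by blast
  have "(\<lambda>n. integral {0..2*pi} (\<lambda>\<phi>. rate (real n * sin \<phi>))) \<longlonglongrightarrow> integral {0..2*pi} g"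
  proof (rule dominated_convergence)
    show "(\<lambda>\<phi>. rate (real n * sin \<phi>)) integrable_on {0..2*pi}" for n
      by (intro integrable_continuous_interval rate_sin_cont)
    show "(\<lambda>_. B) integrable_on {0..2*pi}" by (rule integrable_const_ivl)
    show "norm (rate (real n * sin \<phi>)) \<le> B" for n \<phi> using B rate_nonneg by simp
    fix \<phi> :: real
    consider "0 < sin \<phi>" | "sin \<phi> < 0" | "sin \<phi> = 0" by linarith
    then show "(\<lambda>n. rate (real n * sin \<phi>)) \<longlonglongrightarrow> g \<phi>"
    proof cases
      case 1
      have "filterlim (\<lambda>n. real n * sin \<phi>) at_top sequentially"
        using filterlim_tendsto_pos_mult_at_top[OF tendsto_const 1 filterlim_real_sequentially]
        by (simp add: mult.commute)
      from filterlim_compose[OF rate_at_top this] show ?thesis using 1 by (simp add: g_def)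
    next
      case 2
      have "filterlim (\<lambda>n. real n * sin \<phi>) at_bot sequentially"
        using filterlim_tendsto_neg_mult_at_bot[OF tendsto_const 2 filterlim_real_sequentially]
        by (simp add: mult.commute)
      from filterlim_compose[OF rate_at_bot this] show ?thesis using 2 by (simp add: g_def)
    next
      case 3 then show ?thesis by (simp add: g_def)
    qed
  qed
  moreover have "(g has_integral pi + 0) {0..2*pi}"
  proof (rule has_integral_combine[of 0 pi "2*pi"])
    have "((\<lambda>_. 1::real) has_integral pi) {0..pi}"
      using has_integral_const_real[of "1::real" 0 pi] by (simp add: pi_ge_zero)
    then show "(g has_integral pi) {0..pi}"
    proof (rule has_integral_spike_finite[rotated 2])
      show "g x = 1" if "x \<in> {0..pi} - {0, pi}" for x
        using that sin_gt_zero[of x] by (simp add: g_def)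
    qed simp
    show "(g has_integral 0) {pi..2*pi}"
    proof (rule has_integral_spike_finite[rotated 2])
      show "((\<lambda>_. 0::real) has_integral 0) {pi..2*pi}" by simp
      show "g x = 0" if "x \<in> {pi..2*pi} - {pi, 2*pi}" for x
        using that sin_lt_zero[of x] by (simp add: g_def)
    qed simp
  qed auto
  ultimately show ?thesis by (simp add: period_def integral_unique)
qed

text \<open>For \<open>p < 1\<close>, the supremum of the amplitudes; the orbit of this amplitude just reaches \<open>x = 0\<close>.\<close>

definition amax :: real where "amax = sqrt ((1 + p) / (1 - p))"

lemma erange_sublinear: assumes "p < 1" shows "erange = {- amax<..}"
proof (intro set_eqI iffI)
  note lim = ecoord_at_bot_sublinear[OF assms, folded amax_def]
  fix h
  {
    assume "h \<in> erange"
    then obtain t where t: "h = ecoord t" by (auto simp: erange_def)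
    have "- amax \<le> ecoord (t - 1)"
    proof (rule tendsto_upperbound[OF lim])
      show "\<forall>\<^sub>F s in at_bot. ecoord s \<le> ecoord (t - 1)"
        using eventually_gt_at_bot[of "t - 1"] by eventually_elim (simp add: less_imp_le)
    qed simp
    also have "\<dots> < h" by (simp add: t)
    finally show "h \<in> {- amax<..}" by simp
  next
    assume "h \<in> {- amax<..}"
    then have "- amax < h" by simp
    with lim have "\<forall>\<^sub>F t in at_bot. ecoord t < h" by (rule order_tendstoD)
    then obtain t where "ecoord t < h" using eventually_happens by fastforce
    then show "h \<in> erange" using erange_up[of "ecoord t"] by simp
  }
qed

text \<open>For \<open>p < 1\<close>, the power \<open>x powr (p + 1)\<close> divided by its largest value \<open>2 / (1 - p)\<close> on the orbit of amplitude \<open>amax\<close>.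
On this orbit \<open>x powr ((p + 1) / 2)\<close> is a cosine of time, so \<open>arcsin (2 * zz - 1)\<close> is piecewise linear in time.\<close>

definition zz :: "real \<Rightarrow> real" where
  "zz h = (if h \<in> erange then exp ((p + 1) * tau h) * ((1 - p) / 2) else 0)"

lemma zz_isCont: "isCont zz h"
  unfolding zz_def[abs_def]
proof (rule extension_isCont)
  show "isCont (\<lambda>t. exp ((p + 1) * t) * ((1 - p) / 2)) t" for t by (intro continuous_intros)
  show "((\<lambda>t. exp ((p + 1) * t) * ((1 - p) / 2)) \<longlongrightarrow> 0) at_bot"
    using tendsto_mult_right[OF exp_decay(1)[of "p + 1"], of "(1 - p) / 2"] p_pos by simp
qed

lemma zz_energy:
  assumes "p < 1" "h \<in> erange"
  shows "amax\<^sup>2 - h\<^sup>2 = xpow (tau h) * (2 / (1 - p)) * (1 - zz h)"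
    and "xsq (tau h) = xpow (tau h) * (2 / (1 - p)) * zz h"
proof -
  define t where "t = tau h"
  have h: "h = ecoord t" using assms by (simp add: t_def ecoord_tau)
  have r: "amax\<^sup>2 = (1 + p) / (1 - p)" using assms p_pos by (simp add: amax_def)
  show 2: "xsq (tau h) = xpow (tau h) * (2 / (1 - p)) * zz h"

  proof -
    have "xsq (tau h) = xpow (tau h) * exp ((p + 1) * tau h)"
      by (simp add: xsq_def xpow_def exp_add[symmetric] algebra_simps)
    then show ?thesis using assms by (simp add: zz_def)
  qed
  have W: "spot t = (1 - xpow t) / (1 - p)" using xpow_eq[of t] assms by (simp add: field_simps)
  have "amax\<^sup>2 - h\<^sup>2 = xpow t * (2 / (1 - p)) - xsq t"
  proof -
    have "(1 + p) / (1 - p) = 2 / (1 - p) - 1" using assms by (simp add: field_simps)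
    then show ?thesis unfolding h ecoord_sq pot_def r W by (simp add: diff_divide_distrib algebra_simps)
  qed
  then show "amax\<^sup>2 - h\<^sup>2 = xpow (tau h) * (2 / (1 - p)) * (1 - zz h)"
    using 2 by (simp only: t_def right_diff_distrib mult_1_right)
qed

lemma zz_range:
  assumes "p < 1" "- amax \<le> h" "h \<le> amax"
  shows "0 \<le> zz h" "zz h \<le> 1" "- amax < h \<Longrightarrow> h < amax \<Longrightarrow> 0 < zz h \<and> zz h < 1"
    "h = amax \<Longrightarrow> zz h = 1" "h = - amax \<Longrightarrow> zz h = 0"
proof -
  have amax: "0 < amax" using assms p_pos by (simp add: amax_def)
  have sq: "h\<^sup>2 \<le> amax\<^sup>2" using assms by (simp add: abs_le_square_iff[symmetric] abs_le_iff)
  have pos: "0 < xpow (tau h) * (2 / (1 - p))" using assms xpow_pos by simp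
  show "0 \<le> zz h" using assms by (simp add: zz_def)
  show "zz h \<le> 1"
  proof (cases "h \<in> erange")
    case True
    have "0 \<le> xpow (tau h) * (2 / (1 - p)) * (1 - zz h)" using sq zz_energy(1)[OF assms(1) True] by linarith
    then have "0 \<le> 1 - zz h" using pos by (metis mult_pos_neg not_le)
    then show ?thesis by simp
  qed (simp add: zz_def)
  show "0 < zz h \<and> zz h < 1" if "- amax < h" "h < amax"
  proof -
    have R: "h \<in> erange" using that erange_sublinear[OF assms(1)] by simp
    have "\<bar>h\<bar> < amax" using that amax by auto
    then have "\<bar>h\<bar>\<^sup>2 < amax\<^sup>2" by (intro power_strict_mono) auto
    then have "h\<^sup>2 < amax\<^sup>2" by simp
    then have "0 < xpow (tau h) * (2 / (1 - p)) * (1 - zz h)" using zz_energy(1)[OF assms(1) R] by linarith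
    then have "0 < 1 - zz h" using pos by (metis zero_less_mult_pos)
    then have "zz h < 1" by simp
    then show ?thesis using R assms by (simp add: zz_def)
  qed
  show "zz h = 1" if "h = amax"
  proof -
    have R: "h \<in> erange" using that amax erange_sublinear[OF assms(1)] by simp
    show ?thesis using zz_energy(1)[OF assms(1) R] that assms(1) xpow_pos[of "tau amax"] by simp
  qed
  show "zz h = 0" if "h = - amax" using that erange_sublinear[OF assms(1)] by (simp add: zz_def)
qed

text \<open>Here \<open>s\<close> is the sign of the cosine, that is, the direction of motion.\<close>

lemma period_amax_piece:
  assumes p: "p < 1" and ab: "a \<le> b" and s: "\<bar>s\<bar> = 1"
    and cos: "\<And>\<phi>. a < \<phi> \<Longrightarrow> \<phi> < b \<Longrightarrow> 0 < s * cos \<phi>"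
  shows "((\<lambda>\<phi>. rate (amax * sin \<phi>)) has_integral
     s / (p + 1) * arcsin (2 * zz (amax * sin b) - 1) - s / (p + 1) * arcsin (2 * zz (amax * sin a) - 1)) {a..b}"
proof (rule fundamental_theorem_of_calculus_interior[OF ab])
  have amax: "0 < amax" using p p_pos by (simp add: amax_def)
  have rg: "- amax \<le> amax * sin \<phi>" "amax * sin \<phi> \<le> amax" for \<phi>
    using amax mult_left_mono[of "-1" "sin \<phi>" amax] mult_left_mono[of "sin \<phi>" 1 amax] by auto
  have "continuous_on UNIV zz" using zz_isCont by (simp add: continuous_at_imp_continuous_on)
  then have "continuous_on {a..b} (\<lambda>\<phi>. zz (amax * sin \<phi>))"
    by (rule continuous_on_compose2) (auto intro!: continuous_intros)
  then show "continuous_on {a..b} (\<lambda>\<phi>. s / (p + 1) * arcsin (2 * zz (amax * sin \<phi>) - 1))"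
    using zz_range(1,2)[OF p rg] by (intro continuous_intros) auto
  fix \<phi> assume phi: "\<phi> \<in> {a<..<b}"
  define h where "h = amax * sin \<phi>"
  define t where "t = tau h"
  have sc: "0 < s * cos \<phi>" using cos phi by simp
  then have "cos \<phi> \<noteq> 0" by auto
  then have "\<bar>sin \<phi>\<bar> < 1"
    by (simp add: abs_square_less_1[symmetric] sin_squared_eq)
  then have "\<bar>h\<bar> < amax" using amax by (simp add: h_def abs_mult)
  then have hr: "- amax < h" "h < amax" by auto
  have R: "h \<in> erange" using hr erange_sublinear[OF p] by simp
  have Z: "0 < zz h" "zz h < 1" using zz_range(3)[OF p, of h] hr by auto
  have near: "\<forall>\<^sub>F x in nhds h. zz x = exp ((p + 1) * tau x) * ((1 - p) / 2)"
  proof -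
    have "\<forall>\<^sub>F x in nhds h. x \<in> {- amax<..}" using hr by (intro eventually_nhds_in_open) auto
    then show ?thesis by eventually_elim (simp add: zz_def erange_sublinear[OF p])
  qed
  have "((\<lambda>x. exp ((p + 1) * tau x) * ((1 - p) / 2)) has_field_derivative (p + 1) * inverse (decoord t) * zz h) (at h)"
    using R unfolding t_def by (auto intro!: derivative_eq_intros tau_deriv simp: zz_def)
  then have Zd: "(zz has_field_derivative (p + 1) * inverse (decoord t) * zz h) (at h)"
    by (simp only: DERIV_cong_ev[OF refl near refl])
  have "((\<lambda>\<phi>. zz (amax * sin \<phi>)) has_field_derivative (p + 1) * inverse (decoord t) * zz h * (amax * cos \<phi>)) (at \<phi>)"
    using Zd unfolding h_def by (intro DERIV_chain2[of zz _ "\<lambda>\<phi>. amax * sin \<phi>"]) (auto intro!: derivative_eq_intros)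
  then have "((\<lambda>\<phi>. arcsin (2 * zz (amax * sin \<phi>) - 1)) has_field_derivative
      inverse (sqrt (1 - (2 * zz h - 1)\<^sup>2)) * (2 * ((p + 1) * inverse (decoord t) * zz h * (amax * cos \<phi>)))) (at \<phi>)"
    using Z by (intro DERIV_chain2[of arcsin _ "\<lambda>\<phi>. 2 * zz (amax * sin \<phi>) - 1"])
      (auto intro!: derivative_eq_intros DERIV_arcsin simp: h_def[symmetric])
  from DERIV_cmult[OF this, of "s / (p + 1)"]
  have d: "((\<lambda>\<phi>. s / (p + 1) * arcsin (2 * zz (amax * sin \<phi>) - 1)) has_field_derivative
      s / (p + 1) * (inverse (sqrt (1 - (2 * zz h - 1)\<^sup>2)) * (2 * ((p + 1) * inverse (decoord t) * zz h * (amax * cos \<phi>))))) (at \<phi>)" .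
  have "1 - (2 * zz h - 1)\<^sup>2 = 4 * (zz h * (1 - zz h))"
    by (simp add: power2_eq_square algebra_simps)
  then have s1: "sqrt (1 - (2 * zz h - 1)\<^sup>2) = 2 * sqrt (zz h * (1 - zz h))"
    by (simp add: real_sqrt_mult)
  define M where "M = xpow t * (2 / (1 - p))"
  have M: "0 < M" using p xpow_pos by (simp add: M_def)
  have e: "amax\<^sup>2 - h\<^sup>2 = M * (1 - zz h)" "xsq t = M * zz h"
    using zz_energy[OF p R] by (simp_all add: M_def t_def)
  have "s * (amax * cos \<phi>) = sqrt ((amax * cos \<phi>)\<^sup>2)"
    using sc amax s by (auto simp: abs_if abs_mult mult_less_0_iff zero_less_mult_iff split: if_splits)
  also have "(amax * cos \<phi>)\<^sup>2 = amax\<^sup>2 - h\<^sup>2"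
    by (simp add: h_def power_mult_distrib cos_squared_eq algebra_simps)
  finally have sr: "s * (amax * cos \<phi>) = sqrt M * sqrt (1 - zz h)" by (simp add: e real_sqrt_mult)
  have "exp t = sqrt (xsq t)" by (simp add: xsq_def exp_double)
  then have et: "exp t = sqrt M * sqrt (zz h)" by (simp add: e real_sqrt_mult)
  have "s / (p + 1) * (inverse (sqrt (1 - (2 * zz h - 1)\<^sup>2)) * (2 * ((p + 1) * inverse (decoord t) * zz h * (amax * cos \<phi>))))
     = inverse (sqrt (zz h * (1 - zz h))) * inverse (decoord t) * zz h * (s * (amax * cos \<phi>))"
  proof -
    have "s / q * (inverse (2 * S) * (2 * (q * D * Z * C))) = inverse S * D * Z * (s * C)"
      if "q \<noteq> 0" for q S D Z C :: real
      using that by simp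
    then show ?thesis unfolding s1 using p_pos by simp
  qed
  also have "\<dots> = exp t / decoord t"
  proof -
    have "inverse (a * b) * inverse D * (a * a) * (m * b) = m * a / D"
      if "0 < a" "0 < b" for a b D m :: real
      using that by (simp add: field_simps)
    from this[of "sqrt (zz h)" "sqrt (1 - zz h)" "decoord t" "sqrt M"]
    show ?thesis unfolding sr et using Z by (simp only: real_sqrt_mult) simp
  qed
  also have "\<dots> = rate (amax * sin \<phi>)" using R by (simp add: rate_def slope_def t_def h_def)
  finally show "((\<lambda>\<phi>. s / (p + 1) * arcsin (2 * zz (amax * sin \<phi>) - 1)) has_vector_derivative rate (amax * sin \<phi>)) (at \<phi>)"
    using d by (simp add: has_real_derivative_iff_has_vector_derivative)
qed

lemma period_amax:
  assumes p: "p < 1" shows "period amax = 2 * pi / (p + 1)"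
proof -
  let ?A = "\<lambda>\<phi>. arcsin (2 * zz (amax * sin \<phi>) - 1)"
  let ?I1 = "1 / (p + 1) * ?A (pi / 2) - 1 / (p + 1) * ?A 0"
  let ?I2 = "(-1) / (p + 1) * ?A (3 * pi / 2) - (-1) / (p + 1) * ?A (pi / 2)"
  let ?I3 = "1 / (p + 1) * ?A (2 * pi) - 1 / (p + 1) * ?A (3 * pi / 2)"
  have amax: "0 < amax" using p p_pos by (simp add: amax_def)
  have s3: "sin (3 * pi / 2) = -1"
  proof -
    have "sin (3 * pi / 2) = sin (pi / 2 + pi)" by (rule arg_cong[of _ _ sin]) (simp add: field_simps)
    then show ?thesis by (simp only: sin_periodic_pi sin_pi_half)
  qed
  have v: "?A (pi / 2) = pi / 2" "?A (3 * pi / 2) = - (pi / 2)" "?A (2 * pi) = ?A 0"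
    using zz_range(4)[OF p, of amax] zz_range(5)[OF p, of "- amax"] amax by (simp_all add: s3)
  have 1: "((\<lambda>\<phi>. rate (amax * sin \<phi>)) has_integral ?I1) {0..pi / 2}"
    by (rule period_amax_piece[OF p]) (auto intro!: cos_gt_zero)
  have 2: "((\<lambda>\<phi>. rate (amax * sin \<phi>)) has_integral ?I2) {pi / 2..3 * pi / 2}"
  proof (rule period_amax_piece[OF p])
    fix \<phi> assume "pi / 2 < \<phi>" "\<phi> < 3 * pi / 2"
    then have "0 < cos (\<phi> - pi)" by (intro cos_gt_zero_pi) auto
    then show "0 < - 1 * cos \<phi>" by (simp add: cos_diff)
  qed auto
  have 3: "((\<lambda>\<phi>. rate (amax * sin \<phi>)) has_integral ?I3) {3 * pi / 2..2 * pi}"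
  proof (rule period_amax_piece[OF p])
    fix \<phi> assume "3 * pi / 2 < \<phi>" "\<phi> < 2 * pi"
    then have "0 < cos (\<phi> - 2 * pi)" by (intro cos_gt_zero_pi) auto
    then show "0 < 1 * cos \<phi>" by (simp add: cos_diff)
  qed auto
  have "((\<lambda>\<phi>. rate (amax * sin \<phi>)) has_integral ?I1 + ?I2 + ?I3) {0..2 * pi}"
    using has_integral_combine[OF _ _ has_integral_combine[OF _ _ 1 2] 3] by simp
  then have "period amax = ?I1 + ?I2 + ?I3"
    unfolding period_def by (rule integral_unique)
  also have "\<dots> = 2 * pi / (p + 1)"
  proof -
    have gen: "(1 / q * (pi / 2) - 1 / q * x) + ((-1) / q * (- (pi / 2)) - (-1) / q * (pi / 2)) + (1 / q * x - 1 / q * (- (pi / 2))) = 2 * pi / q"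
      if "q \<noteq> 0" for q x
      using that by (simp add: field_simps)
    show ?thesis unfolding v by (rule gen) (use p_pos in simp)
  qed
  finally show ?thesis .
qed

section \<open>The values of the period\<close>

definition period_lim :: real where "period_lim = (if p < 1 then 2 * pi / (p + 1) else pi)"

text \<open>Both cases in one statement: amplitudes that eventually exceed every admissible one, with a known limit of
the period.\<close>

lemma period_exhaustion:
  obtains \<sigma> :: "nat \<Rightarrow> real" where "\<And>n. \<sigma> n \<in> amps" "\<And>r. r \<in> amps \<Longrightarrow> \<forall>\<^sub>F n in sequentially. r < \<sigma> n"
    "(\<lambda>n. period (\<sigma> n)) \<longlonglongrightarrow> period_lim"
proof (cases "p < 1")
  case False
  show ?thesis
  proof (rule that[of real])
    show "real n \<in> amps" for n using erange_UNIV False by (simp add: amps_def)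
    show "\<forall>\<^sub>F n in sequentially. r < real n" for r
      using filterlim_real_sequentially by (simp add: filterlim_at_top_dense)
    show "(\<lambda>n. period (real n)) \<longlonglongrightarrow> period_lim" using period_limit False by (simp add: period_lim_def)
  qed
next
  case True
  have amax: "0 < amax" using True p_pos by (simp add: amax_def)
  have amps: "amps = {0..<amax}"
    unfolding amps_def erange_sublinear[OF True] by (simp add: set_eq_iff)
  \<comment> \<open>approach \<open>amax\<close> from below\<close>
  define \<sigma> where "\<sigma> = (\<lambda>n. amax - amax * inverse (real (Suc n)))"
  have "(\<lambda>n. amax - amax * inverse (real (Suc n))) \<longlonglongrightarrow> amax - amax * 0"
    by (intro tendsto_intros LIMSEQ_inverse_real_of_nat)
  then have l: "\<sigma> \<longlonglongrightarrow> amax" by (simp add: \<sigma>_def)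
  show ?thesis
  proof (rule that[of \<sigma>])
    show "\<sigma> n \<in> amps" for n
      using amax mult_left_mono[of "inverse (real (Suc n))" 1 amax] unfolding amps \<sigma>_def
      by (simp add: inverse_le_1_iff)
    show "\<forall>\<^sub>F n in sequentially. r < \<sigma> n" if "r \<in> amps" for r
      using order_tendstoD(1)[OF l, of r] that by (simp add: amps)
    have "isCont period amax" using period_cont[of UNIV] by (simp add: continuous_on_eq_continuous_at)
    from isCont_tendsto_compose[OF this l]
    show "(\<lambda>n. period (\<sigma> n)) \<longlonglongrightarrow> period_lim" using period_amax[OF True] True by (simp add: period_lim_def)
  qed
qed

lemma period_range:
  assumes "p \<noteq> 3"
  shows "(\<exists>r\<in>amps. 0 < r \<and> period r = c) \<longleftrightarrow>
    (p - 3) * (2 * pi / sqrt (1 + p)) < (p - 3) * c \<and> (p - 3) * c < (p - 3) * period_lim"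
proof -
  obtain \<sigma> where \<sigma>: "\<And>n. \<sigma> n \<in> amps" "\<And>r. r \<in> amps \<Longrightarrow> \<forall>\<^sub>F n in sequentially. r < \<sigma> n"
    "(\<lambda>n. period (\<sigma> n)) \<longlonglongrightarrow> period_lim" using period_exhaustion by blast
  have lim: "(\<lambda>n. (p - 3) * period (\<sigma> n)) \<longlonglongrightarrow> (p - 3) * period_lim"
    by (intro tendsto_intros \<sigma>)
  show ?thesis
  proof
    assume "\<exists>r\<in>amps. 0 < r \<and> period r = c"
    then obtain r where r: "r \<in> amps" "0 < r" "period r = c" by blast
    have "(p - 3) * period 0 < (p - 3) * period r" using period_strict_mono[OF assms r(1)] r by simp
    moreover obtain s where s: "r < s" "s \<in> amps" using amps_open_above r(1) by blast
    have "(p - 3) * period r < (p - 3) * period s" by (rule period_strict_mono) (use assms r s in auto)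
    moreover have "(p - 3) * period s \<le> (p - 3) * period_lim"
    proof (rule tendsto_lowerbound[OF lim])
      show "\<forall>\<^sub>F n in sequentially. (p - 3) * period s \<le> (p - 3) * period (\<sigma> n)"
        using \<sigma>(2)[OF s(2)]
      proof eventually_elim
        case (elim n)
        then show ?case using period_strict_mono[OF assms \<sigma>(1)[of n], of s] r s by simp
      qed
    qed simp
    ultimately show "(p - 3) * (2 * pi / sqrt (1 + p)) < (p - 3) * c \<and> (p - 3) * c < (p - 3) * period_lim"
      using r by (simp add: period_0)
  next
    assume c: "(p - 3) * (2 * pi / sqrt (1 + p)) < (p - 3) * c \<and> (p - 3) * c < (p - 3) * period_lim"
    have "\<forall>\<^sub>F n in sequentially. (p - 3) * c < (p - 3) * period (\<sigma> n)"
      using c by (intro order_tendstoD(1)[OF lim]) simp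
    then obtain n where n: "(p - 3) * c < (p - 3) * period (\<sigma> n)"
      using eventually_happens by fastforce
    have c0: "(p - 3) * period 0 < (p - 3) * c" using c by (simp add: period_0)
    have s0: "0 \<le> \<sigma> n" using \<sigma>(1)[of n] by (simp add: amps_def)
    have "\<exists>x\<ge>0. x \<le> \<sigma> n \<and> (p - 3) * period x = (p - 3) * c"
      using c0 n s0 by (intro IVT') (auto intro!: continuous_intros period_cont)
    then obtain x where x: "0 \<le> x" "x \<le> \<sigma> n" "(p - 3) * period x = (p - 3) * c" by blast
    have "x \<noteq> 0" using x c0 by auto
    moreover have "x \<in> amps" using x \<sigma>(1) amps_down by blast
    ultimately show "\<exists>r\<in>amps. 0 < r \<and> period r = c" using x assms by (intro bexI[of _ x]) auto
  qed
qed

section \<open>Orbits\<close>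

definition flow :: "(real \<Rightarrow> real) \<Rightarrow> (real \<Rightarrow> real) \<Rightarrow> bool" where
  "flow x v \<longleftrightarrow> (\<forall>s. 0 < x s \<and> (x has_field_derivative v s) (at s)
      \<and> (v has_field_derivative x s powr - p - x s) (at s))"

text \<open>The time at which the phase angle \<open>\<phi>\<close> is reached on the orbit of amplitude \<open>r\<close>.\<close>

definition clock :: "real \<Rightarrow> real \<Rightarrow> real" where
  "clock r = (SOME F. F 0 = 0 \<and> (\<forall>\<phi>. (F has_field_derivative rate (r * sin \<phi>)) (at \<phi>)))"

lemma clock_spec: "clock r 0 = 0 \<and> (\<forall>\<phi>. (clock r has_field_derivative rate (r * sin \<phi>)) (at \<phi>))"
proof -
  have "isCont (\<lambda>\<phi>. rate (r * sin \<phi>)) \<phi>" for \<phi>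
    using rate_sin_cont[of UNIV r] by (simp add: continuous_on_eq_continuous_at)
  then obtain F where F: "\<And>\<phi>. (F has_vector_derivative rate (r * sin \<phi>)) (at \<phi>)"
    using einterval_antiderivative[of "-\<infinity>" "\<infinity>" "\<lambda>\<phi>. rate (r * sin \<phi>)"] by auto
  have "((\<lambda>\<phi>. F \<phi> - F 0) has_field_derivative rate (r * sin \<phi>)) (at \<phi>)" for \<phi>
    using F[of \<phi>] by (auto simp: has_real_derivative_iff_has_vector_derivative[symmetric] intro!: derivative_eq_intros)
  then have "\<exists>F. F 0 = 0 \<and> (\<forall>\<phi>. (F has_field_derivative rate (r * sin \<phi>)) (at \<phi>))"
    by (intro exI[of _ "\<lambda>\<phi>. F \<phi> - F 0"]) auto
  then show ?thesis unfolding clock_def by (rule someI_ex)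
qed

lemma clock_0 [simp]: "clock r 0 = 0"
  and clock_deriv: "(clock r has_field_derivative rate (r * sin \<phi>)) (at \<phi>)"
  using clock_spec by auto

lemma clock_isCont: "isCont (clock r) \<phi>" using clock_deriv DERIV_isCont by blast

lemma clock_2pi: "clock r (\<phi> + 2 * pi) = clock r \<phi> + period r"
proof -
  have "((\<lambda>\<phi>. clock r (\<phi> + 2 * pi) - clock r \<phi>) has_field_derivative 0) (at \<phi>)" for \<phi>
  proof -
    have "(clock r has_field_derivative rate (r * sin (\<phi> + 2 * pi))) (at (\<phi> + 2 * pi))" by (rule clock_deriv)
    then have "((\<lambda>\<phi>. clock r (\<phi> + 2 * pi)) has_field_derivative rate (r * sin \<phi>)) (at \<phi>)"
      by (simp add: DERIV_shift)
    from DERIV_diff[OF this clock_deriv[of r \<phi>]] show ?thesis by simp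
  qed
  then have "clock r (\<phi> + 2 * pi) - clock r \<phi> = clock r (0 + 2 * pi) - clock r 0"
    by (rule zero_deriv_const[of "\<lambda>\<phi>. clock r (\<phi> + 2 * pi) - clock r \<phi>"])
  moreover have "((\<lambda>\<phi>. rate (r * sin \<phi>)) has_integral clock r (2 * pi) - clock r 0) {0..2 * pi}"
    by (rule fundamental_theorem_of_calculus)
      (use has_field_derivative_at_within[OF clock_deriv] in
        \<open>auto simp: has_real_derivative_iff_has_vector_derivative[symmetric]\<close>)
  then have "period r = clock r (2 * pi)" by (simp add: period_def integral_unique)
  ultimately show ?thesis by simp
qed

lemma clock_int: "clock r (\<phi> + 2 * pi * of_int k) = clock r \<phi> + of_int k * period r"
proof (induction k rule: int_induct[where k = 0])
  case base then show ?case by simp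
next
  case (step1 i)
  have "clock r (\<phi> + 2 * pi * of_int (i + 1)) = clock r ((\<phi> + 2 * pi * of_int i) + 2 * pi)"
    by (rule arg_cong[of _ _ "clock r"]) (simp add: algebra_simps)
  then show ?case unfolding clock_2pi step1 by (simp add: algebra_simps)
next
  case (step2 i)
  have "clock r ((\<phi> + 2 * pi * of_int (i - 1)) + 2 * pi) = clock r (\<phi> + 2 * pi * of_int i)"
    by (rule arg_cong[of _ _ "clock r"]) (simp add: algebra_simps)
  then show ?case unfolding clock_2pi step2 by (simp add: algebra_simps)
qed

lemma clock_less: assumes "r \<in> amps" "a < b" shows "clock r a < clock r b"
  by (rule DERIV_pos_imp_increasing[OF assms(2)])
    (use clock_deriv rate_pos amps_erange[OF assms(1)] in blast)

lemma clock_inj: "r \<in> amps \<Longrightarrow> clock r a = clock r b \<longleftrightarrow> a = b"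
  using clock_less[of r a b] clock_less[of r b a] by (cases a b rule: linorder_cases) auto

lemma clock_surj: assumes "r \<in> amps" obtains \<phi> where "clock r \<phi> = s"
proof -
  have T: "0 < period r" by (rule period_pos[OF assms])
  obtain k :: int where k: "s / period r \<le> of_int k" using ex_le_of_int by blast
  obtain j :: int where j: "- (s / period r) \<le> of_int j" using ex_le_of_int by blast
  have 1: "s \<le> clock r (2 * pi * of_int k)"
    using clock_int[of r 0 k] k T by (simp add: field_simps)
  have 2: "clock r (2 * pi * of_int (- j)) \<le> s"
    using clock_int[of r 0 "- j"] j T by (simp add: field_simps)
  have "2 * pi * of_int (- j) \<le> 2 * pi * (of_int k :: real)"
    using clock_less[OF assms, of "2 * pi * of_int k" "2 * pi * of_int (- j)"] 1 2 by linarith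
  then obtain \<phi> where "clock r \<phi> = s"
    using IVT'[of "clock r", OF 2 1] clock_isCont by (meson continuous_at_imp_continuous_on)
  then show ?thesis using that by blast
qed

definition phase :: "real \<Rightarrow> real \<Rightarrow> real" where "phase r = inv (clock r)"

lemma phase_clock [simp]: "r \<in> amps \<Longrightarrow> phase r (clock r \<phi>) = \<phi>"
  unfolding phase_def by (rule inv_f_f) (simp add: inj_def clock_inj)

lemma clock_phase [simp]: "r \<in> amps \<Longrightarrow> clock r (phase r s) = s"
  using clock_surj[of r s] by (metis phase_clock)

lemma phase_0 [simp]: "r \<in> amps \<Longrightarrow> phase r 0 = 0"
  using phase_clock[of r 0] by simp

lemma phase_isCont: assumes "r \<in> amps" shows "isCont (phase r) s"
proof -
  have "isCont (phase r) (clock r (phase r s))"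
    by (rule isCont_inverse_function2[of "phase r s - 1" _ "phase r s + 1"]) (auto simp: clock_isCont assms)
  then show ?thesis using assms by simp
qed

lemma phase_deriv: assumes "r \<in> amps"
  shows "(phase r has_field_derivative inverse (rate (r * sin (phase r s)))) (at s)"
  by (rule DERIV_inverse_function[of "clock r" _ _ _ "s - 1" "s + 1", OF clock_deriv])
    (use assms phase_isCont rate_pos[OF amps_erange[OF assms], of "phase r s"] in auto)

definition orbit :: "real \<Rightarrow> real \<Rightarrow> real" where "orbit r s = xpos (r * sin (phase r s))"
definition orbit_vel :: "real \<Rightarrow> real \<Rightarrow> real" where "orbit_vel r s = r * cos (phase r s)"

text \<open>The chain rule \<open>h = dG/dh = (dG/dx) * (dx/dh)\<close>.\<close>

lemma restoring_force: assumes "h \<in> erange"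
  shows "h / rate h = xpos h - xpos h powr - p"
proof -
  define t where "t = tau h"
  have h: "h = ecoord t" using assms by (simp add: t_def ecoord_tau)
  have "h / rate h = ecoord t * decoord t / exp t" unfolding rate_def using assms h by (simp add: slope_def)
  also have "\<dots> = (exp t * exp t - exp t * exp (- p * t)) / exp t"
    unfolding decoord_ecoord xsq_def xpow_def by (simp add: exp_add[symmetric] algebra_simps)
  also have "\<dots> = exp t - exp (- p * t)" by (simp add: diff_divide_distrib)
  finally show ?thesis by (simp add: xpos_def t_def powr_def)
qed

lemma orbit_flow: assumes r: "r \<in> amps" shows "flow (orbit r) (orbit_vel r)"
  unfolding flow_def
proof (intro allI conjI)
  fix s
  note R = amps_erange[OF r, of "phase r s"]
  note K = rate_pos[OF R]
  show "0 < orbit r s" by (simp add: orbit_def xpos_def)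
  have "((\<lambda>s. r * sin (phase r s)) has_field_derivative r * (cos (phase r s) * inverse (rate (r * sin (phase r s))))) (at s)"
    by (rule derivative_eq_intros phase_deriv[OF r] refl)+ simp
  from DERIV_chain2[OF xpos_deriv[OF R] this]
  show "(orbit r has_field_derivative orbit_vel r s) (at s)"
    unfolding orbit_def[abs_def] orbit_vel_def using K by (simp add: field_simps)
  have "(orbit_vel r has_field_derivative r * (- sin (phase r s) * inverse (rate (r * sin (phase r s))))) (at s)"
    unfolding orbit_vel_def[abs_def] by (rule derivative_eq_intros phase_deriv[OF r] refl)+ simp
  also have "r * (- sin (phase r s) * inverse (rate (r * sin (phase r s)))) = orbit r s powr - p - orbit r s"
    using restoring_force[OF R] by (simp add: orbit_def divide_inverse)
  finally show "(orbit_vel r has_field_derivative orbit r s powr - p - orbit r s) (at s)" .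
qed

lemma flow_deriv_unique: assumes "flow x v" "flow x w" shows "v = w"
  using assms unfolding flow_def by (blast intro: DERIV_unique)

lemma flow_shift: assumes "flow x v" shows "flow (\<lambda>s. x (s + a)) (\<lambda>s. v (s + a))"
  using assms unfolding flow_def by (simp add: DERIV_shift[symmetric])

lemma orbit_0 [simp]: "orbit 0 s = 1" by (simp add: orbit_def xpos_def)

lemma orbit_period_iff:
  assumes r: "r \<in> amps" "0 < r"
  shows "(\<forall>s. orbit r (s + a + S) = orbit r (s + a)) \<longleftrightarrow> (\<exists>k::int. S = of_int k * period r)"
proof
  assume per: "\<forall>s. orbit r (s + a + S) = orbit r (s + a)"
  have per0: "orbit r (s + S) = orbit r s" for s using per[rule_format, of "s - a"] by simp
  then have "(\<lambda>s. orbit r (s + S)) = orbit r" by auto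
  with flow_shift[OF orbit_flow[OF r(1)], of S] have "(\<lambda>s. orbit_vel r (s + S)) = orbit_vel r"
    using flow_deriv_unique orbit_flow[OF r(1)] by metis
  then have "orbit_vel r (0 + S) = orbit_vel r 0" by metis
  then have "cos (phase r S) = 1" using r by (simp add: orbit_vel_def)
  then obtain k :: int where "phase r S = of_int k * 2 * pi" using cos_one_2pi_int by auto
  then have "S = clock r (0 + 2 * pi * of_int k)" using r by (metis clock_phase add_0 mult.commute mult.assoc)
  then show "\<exists>k::int. S = of_int k * period r" unfolding clock_int by auto
next
  assume "\<exists>k::int. S = of_int k * period r"
  then obtain k :: int where S: "S = of_int k * period r" by blast
  have "phase r (s + S) = phase r s + 2 * pi * of_int k" for s
    using clock_int[of r "phase r s" k] r S by (metis clock_phase phase_clock)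
  then have "orbit r (s + S) = orbit r s" for s
    unfolding orbit_def by (simp only: sin_add sin_int_2pin cos_int_2pin) simp
  then show "\<forall>s. orbit r (s + a + S) = orbit r (s + a)" by simp
qed

text \<open>The pair (energy coordinate, velocity) rotates; integrating its angular velocity gives a phase \<open>\<Phi>\<close>
without any lifting argument.  Since \<open>clock r (\<Phi> s) - s\<close> is constant, the solution is a
time shift of the orbit, which replaces a uniqueness theorem for initial value problems.  Periodicity
enters through the admissibility of the amplitude: a full turn passes through the innermost point.\<close>

lemma flow_is_orbit:
  assumes fl: "flow x v" and S: "0 < S" "\<And>s. x (s + S) = x s"
  obtains r a where "r \<in> amps" "\<And>s. x s = orbit r (s + a)"
proof -
  have x: "0 < x s" "(x has_field_derivative v s) (at s)"
    "(v has_field_derivative x s powr - p - x s) (at s)" for s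
    using fl by (auto simp: flow_def)
  define t where "t = (\<lambda>s. ln (x s))"
  define h where "h = (\<lambda>s. ecoord (t s))"
  have hR: "h s \<in> erange" for s by (simp add: h_def)
  have th: "tau (h s) = t s" for s by (simp add: h_def)
  have KP: "rate (h s) = slope (t s)" for s by (simp add: rate_def hR th)
  have Xh: "xpos (h s) = x s" for s using x by (simp add: xpos_def th t_def)
  have td: "(t has_field_derivative v s / x s) (at s)" for s
    unfolding t_def using x[of s] by (auto intro!: derivative_eq_intros)
  have hd: "(h has_field_derivative v s / slope (t s)) (at s)" for s
  proof -
    have "(h has_field_derivative decoord (t s) * (v s / x s)) (at s)"
      unfolding h_def by (rule DERIV_chain2[OF ecoord_deriv td])
    also have "decoord (t s) * (v s / x s) = v s / slope (t s)"
      using x[of s] by (simp add: slope_def t_def)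
    finally show ?thesis .
  qed
  have vd: "(v has_field_derivative - h s / slope (t s)) (at s)" for s
    using x(3)[of s] restoring_force[OF hR[of s]] unfolding Xh KP by simp
  have tc: "isCont t s" for s using td DERIV_isCont by blast
  have "isCont (\<lambda>s. 1 / slope (t s)) s" for s
    using isCont_o2[OF tc slope_isCont] slope_pos[of "t s"] by (intro continuous_intros) auto
  then obtain F where F: "\<And>s. (F has_vector_derivative 1 / slope (t s)) (at s)"
    using einterval_antiderivative[of "-\<infinity>" "\<infinity>" "\<lambda>s. 1 / slope (t s)"] by auto
  define r where "r = sqrt ((h 0)\<^sup>2 + (v 0)\<^sup>2)"
  have r0: "0 \<le> r" by (simp add: r_def)
  obtain \<phi>0 where \<phi>0: "h 0 = r * sin \<phi>0" "v 0 = r * cos \<phi>0"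
  proof (cases "r = 0")
    case True
    then have "h 0 = 0" "v 0 = 0" by (simp_all add: r_def add_nonneg_eq_0_iff)
    then show ?thesis using that[of 0] True by simp
  next
    case False
    then have "(v 0 / r)\<^sup>2 + (h 0 / r)\<^sup>2 = 1"
      by (simp add: r_def power_divide add_divide_distrib[symmetric] add.commute)
    then obtain \<phi> where "v 0 / r = cos \<phi>" "h 0 / r = sin \<phi>" using sincos_total_2pi by metis
    then show ?thesis using that[of \<phi>] False by (simp add: field_simps)
  qed
  define \<Phi> where "\<Phi> = (\<lambda>s. F s - F 0 + \<phi>0)"
  have \<Phi>d: "(\<Phi> has_field_derivative 1 / slope (t s)) (at s)" for s
    using F[of s] unfolding \<Phi>_def
    by (auto simp: has_real_derivative_iff_has_vector_derivative[symmetric] intro!: derivative_eq_intros)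
  have \<Phi>0: "\<Phi> 0 = \<phi>0" by (simp add: \<Phi>_def)
  have hv: "h s = r * sin (\<Phi> s)" "v s = r * cos (\<Phi> s)" for s
  proof -
    have rot: "h s = h 0 * cos (\<Phi> s - \<Phi> 0) + v 0 * sin (\<Phi> s - \<Phi> 0)"
      "v s = v 0 * cos (\<Phi> s - \<Phi> 0) - h 0 * sin (\<Phi> s - \<Phi> 0)"
      by (rule rotating_pair[of h v "\<lambda>s. 1 / slope (t s)"]; use hd vd \<Phi>d in simp)+
    have "sin (\<Phi> s) = sin \<phi>0 * cos (\<Phi> s - \<phi>0) + cos \<phi>0 * sin (\<Phi> s - \<phi>0)"
      "cos (\<Phi> s) = cos \<phi>0 * cos (\<Phi> s - \<phi>0) - sin \<phi>0 * sin (\<Phi> s - \<phi>0)"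
      using sin_add[of \<phi>0 "\<Phi> s - \<phi>0"] cos_add[of \<phi>0 "\<Phi> s - \<phi>0"] by simp_all
    then show "h s = r * sin (\<Phi> s)" "v s = r * cos (\<Phi> s)"
      unfolding rot \<phi>0 \<Phi>0 by (simp_all only:) (simp_all add: right_diff_distrib distrib_left)
  qed
  have \<Phi>_less: "\<Phi> a < \<Phi> b" if "a < b" for a b
    by (rule DERIV_pos_imp_increasing[OF that]) (use \<Phi>d slope_pos in force)
  have amps: "r \<in> amps"
  proof (cases "r = 0")
    case False
    have "flow (\<lambda>s. x (s + S)) (\<lambda>s. v (s + S))" by (rule flow_shift[OF fl])
    then have "(\<lambda>s. v (s + S)) = v" using fl S(2) flow_deriv_unique by simp
    then have "v (0 + S) = v 0" by metis
    moreover have "h (0 + S) = h 0" unfolding h_def t_def S(2) ..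
    ultimately have "v S = v 0" "h S = h 0" by simp_all
    then have "sin (\<Phi> S) = sin (\<Phi> 0)" "cos (\<Phi> S) = cos (\<Phi> 0)"
      using False hv[of S] hv[of 0] by auto
    \<comment> \<open>one period of the solution is a whole number of turns\<close>
    then obtain k :: int where k: "\<Phi> S = \<Phi> 0 + 2 * pi * of_int k"
      using sin_cos_eq_iff by metis
    have "0 < k" using \<Phi>_less[OF S(1)] unfolding k by (simp add: zero_less_mult_iff)
    then have "1 \<le> (of_int k :: real)" by simp
    then have k1: "\<Phi> 0 + 2 * pi \<le> \<Phi> S" unfolding k by simp
    \<comment> \<open>the first angle after \<open>\<Phi> 0\<close> at which the sine is \<open>- 1\<close>\<close>
    define n where "n = \<lceil>(\<Phi> 0 + pi / 2) / (2 * pi)\<rceil>"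
    define \<psi> where "\<psi> = - (pi / 2) + 2 * pi * of_int n"
    have "(\<Phi> 0 + pi / 2) / (2 * pi) \<le> of_int n" "of_int n < (\<Phi> 0 + pi / 2) / (2 * pi) + 1"
      unfolding n_def by linarith+
    then have "\<Phi> 0 \<le> \<psi>" "\<psi> \<le> \<Phi> 0 + 2 * pi"
      by (simp_all add: \<psi>_def field_simps)
    then have "\<Phi> 0 \<le> \<psi>" "\<psi> \<le> \<Phi> S" using k1 by auto
    then obtain s where "\<Phi> s = \<psi>"
      using IVT'[of \<Phi> 0 \<psi> S] S(1) \<Phi>d by (meson DERIV_isCont continuous_at_imp_continuous_on less_imp_le)
    moreover have "sin \<psi> = - 1"
      unfolding \<psi>_def by (simp only: sin_add sin_int_2pin cos_int_2pin) simp
    ultimately have "h s = - r" using hv(1)[of s] by simp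
    then show ?thesis using hR[of s] r0 by (simp add: amps_def)
  qed simp
  have "clock r (\<Phi> s) - s = clock r (\<Phi> 0) - 0" for s
  proof (rule zero_deriv_const[of "\<lambda>s. clock r (\<Phi> s) - s"])
    fix s
    have "((\<lambda>s. clock r (\<Phi> s)) has_field_derivative rate (r * sin (\<Phi> s)) * (1 / slope (t s))) (at s)"
      by (rule DERIV_chain2[OF clock_deriv \<Phi>d])
    moreover have "rate (r * sin (\<Phi> s)) * (1 / slope (t s)) = 1"
      unfolding hv(1)[symmetric] KP using slope_pos[of "t s"] by simp
    ultimately show "((\<lambda>s. clock r (\<Phi> s) - s) has_field_derivative 0) (at s)"
      by (auto intro!: derivative_eq_intros)
  qed
  then have "clock r (\<Phi> s) = s + clock r \<phi>0" for s by (simp add: \<Phi>0 algebra_simps)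
  then have "\<Phi> s = phase r (s + clock r \<phi>0)" for s using phase_clock[OF amps] by metis
  then have "x s = orbit r (s + clock r \<phi>0)" for s
    using Xh[of s] by (simp add: orbit_def hv(1))
  then show ?thesis using that amps by blast
qed

end

section \<open>The circle: topology and translations of solutions\<close>

lemma C2_circle_periodic:
  assumes "w \<in> C2_circle"
  shows "w (\<theta> + 2 * pi) = w \<theta>" "deriv w (\<theta> + 2 * pi) = deriv w \<theta>"
    "deriv (deriv w) (\<theta> + 2 * pi) = deriv (deriv w) \<theta>"
proof -
  have p0: "\<forall>\<theta>. w (\<theta> + 2 * pi) = w \<theta>"
    and d0: "\<forall>\<theta>. w field_differentiable at \<theta>" and d1: "\<forall>\<theta>. deriv w field_differentiable at \<theta>"
    using assms unfolding C2_circle_def by blast+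
  have p1: "\<forall>\<theta>. deriv w (\<theta> + 2 * pi) = deriv w \<theta>"
    using periodic_deriv[OF p0 d0] by blast
  show "w (\<theta> + 2 * pi) = w \<theta>" "deriv w (\<theta> + 2 * pi) = deriv w \<theta>" using p0 p1 by blast+
  show "deriv (deriv w) (\<theta> + 2 * pi) = deriv (deriv w) \<theta>"
    by (rule periodic_deriv[OF p1 d1])
qed

lemma C2_norm_le:
  assumes w: "w \<in> C2_circle"
    and b: "\<And>\<theta>. \<theta> \<in> {0..2*pi} \<Longrightarrow> \<bar>w \<theta>\<bar> \<le> e \<and> \<bar>deriv w \<theta>\<bar> \<le> e \<and> \<bar>deriv (deriv w) \<theta>\<bar> \<le> e"
  shows "C2_norm w \<le> 3 * e"
proof -
  have b': "\<bar>w \<theta>\<bar> \<le> e \<and> \<bar>deriv w \<theta>\<bar> \<le> e \<and> \<bar>deriv (deriv w) \<theta>\<bar> \<le> e" for \<theta>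
  proof -
    obtain k :: int where "0 \<le> \<theta> + of_int k * (2 * pi) \<and> \<theta> + of_int k * (2 * pi) < 2 * pi"
      using periodic_reduce[of "2 * pi" \<theta>] pi_gt_zero by (metis mult_pos_pos zero_less_numeral)
    then have k: "\<theta> + of_int k * (2 * pi) \<in> {0..2*pi}" by simp
    have "w (\<theta> + of_int k * (2 * pi)) = w \<theta>"
      by (rule periodic_int) (rule C2_circle_periodic[OF w])
    moreover have "deriv w (\<theta> + of_int k * (2 * pi)) = deriv w \<theta>"
      by (rule periodic_int) (rule C2_circle_periodic[OF w])
    moreover have "deriv (deriv w) (\<theta> + of_int k * (2 * pi)) = deriv (deriv w) \<theta>"
      by (rule periodic_int) (rule C2_circle_periodic[OF w])
    ultimately show ?thesis using b[OF k] by (simp only:)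
  qed
  have "(SUP \<theta>. \<bar>w \<theta>\<bar>) \<le> e" "(SUP \<theta>. \<bar>deriv w \<theta>\<bar>) \<le> e" "(SUP \<theta>. \<bar>deriv (deriv w) \<theta>\<bar>) \<le> e"
    using b' by (auto intro!: cSUP_least)
  then show ?thesis by (simp add: C2_norm_def)
qed

text \<open>Uniformity over the compact period interval follows from joint continuity.\<close>

lemma C2_continuous_family:
  fixes F :: "real \<Rightarrow> real \<Rightarrow> real"
  assumes F: "\<And>s. s \<in> S \<Longrightarrow> F s \<in> C2_circle"
    and c: "continuous_on (S \<times> UNIV) (\<lambda>(s, \<theta>). F s \<theta>)"
      "continuous_on (S \<times> UNIV) (\<lambda>(s, \<theta>). deriv (F s) \<theta>)"
      "continuous_on (S \<times> UNIV) (\<lambda>(s, \<theta>). deriv (deriv (F s)) \<theta>)"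
  shows "continuous_map (top_of_set S) C2.mtopology F"
  unfolding C2.continuous_map_to_metric
proof (intro ballI allI impI)
  fix s0 and e :: real assume s0: "s0 \<in> topspace (top_of_set S)" and e: "0 < e"
  then have s0S: "s0 \<in> S" by simp
  have nb: "\<exists>U. s0 \<in> U \<and> open U \<and> (\<forall>s\<in>U \<inter> S. \<forall>\<theta>\<in>{0..2*pi}. dist (g s \<theta>) (g s0 \<theta>) \<le> e / 4)"
    if "continuous_on (S \<times> UNIV) (\<lambda>(s, \<theta>). g s \<theta>)" for g :: "real \<Rightarrow> real \<Rightarrow> real"
  proof -
    have "continuous_on (S \<times> {0..2*pi}) (\<lambda>(s, \<theta>). g s \<theta>)"
      using that by (rule continuous_on_subset) auto
    then obtain U where "s0 \<in> U" "open U"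
      "\<forall>s\<in>U \<inter> S. \<forall>\<theta>\<in>{0..2*pi}. dist ((\<lambda>(s, \<theta>). g s \<theta>) (s, \<theta>)) ((\<lambda>(s, \<theta>). g s \<theta>) (s0, \<theta>)) \<le> e / 4"
      using continuous_on_prod_compactE[of S "{0..2*pi}" "\<lambda>(s, \<theta>). g s \<theta>" s0 "e / 4"] s0S e
      by (metis compact_Icc divide_pos_pos zero_less_numeral)
    then show ?thesis by auto
  qed
  obtain U1 where U1: "s0 \<in> U1" "open U1"
    "\<forall>s\<in>U1 \<inter> S. \<forall>\<theta>\<in>{0..2*pi}. dist (F s \<theta>) (F s0 \<theta>) \<le> e / 4" using nb[OF c(1)] by blast
  obtain U2 where U2: "s0 \<in> U2" "open U2"
    "\<forall>s\<in>U2 \<inter> S. \<forall>\<theta>\<in>{0..2*pi}. dist (deriv (F s) \<theta>) (deriv (F s0) \<theta>) \<le> e / 4" using nb[OF c(2)] by blast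
  obtain U3 where U3: "s0 \<in> U3" "open U3"
    "\<forall>s\<in>U3 \<inter> S. \<forall>\<theta>\<in>{0..2*pi}. dist (deriv (deriv (F s)) \<theta>) (deriv (deriv (F s0)) \<theta>) \<le> e / 4"
    using nb[OF c(3)] by blast
  define U where "U = S \<inter> (U1 \<inter> U2 \<inter> U3)"
  have "openin (top_of_set S) U" using U1 U2 U3 by (auto simp: U_def)
  moreover have "s0 \<in> U" using U1 U2 U3 s0S by (simp add: U_def)
  moreover have "F s \<in> C2.mball (F s0) e" if "s \<in> U" for s
  proof -
    have sS: "s \<in> S" using that by (simp add: U_def)
    have "C2_norm (\<lambda>\<theta>. F s0 \<theta> - F s \<theta>) \<le> 3 * (e / 4)"
    proof (rule C2_norm_le)
      show "(\<lambda>\<theta>. F s0 \<theta> - F s \<theta>) \<in> C2_circle" using F sS s0S C2_circle_diff(3) by blast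
      fix \<theta> :: real assume t: "\<theta> \<in> {0..2*pi}"
      have "dist (F s \<theta>) (F s0 \<theta>) \<le> e / 4" "dist (deriv (F s) \<theta>) (deriv (F s0) \<theta>) \<le> e / 4"
        "dist (deriv (deriv (F s)) \<theta>) (deriv (deriv (F s0)) \<theta>) \<le> e / 4"
        using U1(3) U2(3) U3(3) that t by (simp_all add: U_def)
      then show "\<bar>F s0 \<theta> - F s \<theta>\<bar> \<le> e / 4 \<and> \<bar>deriv (\<lambda>\<theta>. F s0 \<theta> - F s \<theta>) \<theta>\<bar> \<le> e / 4
         \<and> \<bar>deriv (deriv (\<lambda>\<theta>. F s0 \<theta> - F s \<theta>)) \<theta>\<bar> \<le> e / 4"
        unfolding dist_real_def C2_circle_diff(1)[OF F[OF s0S] F[OF sS]] C2_circle_diff(4)[OF F[OF s0S] F[OF sS]]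
        by (simp only: abs_minus_commute)
    qed
    also have "\<dots> < e" using e by simp
    finally show ?thesis using F sS s0S by (simp add: C2_dist_def)
  qed
  ultimately show "\<exists>U. openin (top_of_set S) U \<and> s0 \<in> U \<and> (\<forall>s\<in>U. F s \<in> C2.mball (F s0) e)" by blast
qed

lemma solutions_subset_C2: "solutions \<alpha> p l \<subseteq> C2_circle"
  by (auto simp: solutions_def)

lemma solution_deriv:
  assumes "w \<in> solutions \<alpha> p l"
  shows "(w has_field_derivative deriv w \<theta>) (at \<theta>)"
    and "(deriv w has_field_derivative l / (w \<theta> powr p) - (beta \<alpha> p)\<^sup>2 * w \<theta>) (at \<theta>)"
    and "deriv (deriv w) \<theta> = l / (w \<theta> powr p) - (beta \<alpha> p)\<^sup>2 * w \<theta>"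
    and "0 < w \<theta>"
proof -
  show "(w has_field_derivative deriv w \<theta>) (at \<theta>)"
    using assms by (auto simp: solutions_def C2_circle_def field_differentiable_derivI)
  have "deriv (deriv w) \<theta> + (beta \<alpha> p)\<^sup>2 * w \<theta> - l / (w \<theta> powr p) = 0"
    using assms by (simp add: solutions_def)
  then show e: "deriv (deriv w) \<theta> = l / (w \<theta> powr p) - (beta \<alpha> p)\<^sup>2 * w \<theta>" by simp
  have "(deriv w has_field_derivative deriv (deriv w) \<theta>) (at \<theta>)"
    using assms by (auto simp: solutions_def C2_circle_def field_differentiable_derivI)
  then show "(deriv w has_field_derivative l / (w \<theta> powr p) - (beta \<alpha> p)\<^sup>2 * w \<theta>) (at \<theta>)" using e by simp
  show "0 < w \<theta>" using assms by (simp add: solutions_def)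
qed

lemma solutionI:
  assumes "\<And>\<theta>. (w has_field_derivative v \<theta>) (at \<theta>)"
    and "\<And>\<theta>. (v has_field_derivative l / (w \<theta> powr p) - (beta \<alpha> p)\<^sup>2 * w \<theta>) (at \<theta>)"
    and pos: "\<And>\<theta>. 0 < w \<theta>" and per: "\<And>\<theta>. w (\<theta> + 2 * pi) = w \<theta>"
  shows "w \<in> solutions \<alpha> p l" "deriv w = v"
proof -
  show v: "deriv w = v" using assms(1) by (auto intro!: DERIV_imp_deriv)
  have vv: "deriv v = (\<lambda>\<theta>. l / (w \<theta> powr p) - (beta \<alpha> p)\<^sup>2 * w \<theta>)"
    using assms(2) by (auto intro!: DERIV_imp_deriv)
  have "continuous_on UNIV w"
    using assms(1) DERIV_isCont by (blast intro: continuous_at_imp_continuous_on)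
  then have "continuous_on UNIV (deriv v)"
    unfolding vv using pos by (intro continuous_intros) (auto simp: less_imp_neq[symmetric])
  then show "w \<in> solutions \<alpha> p l"
    unfolding solutions_def C2_circle_def using assms(1,2) pos per vv v
    by (auto simp: field_differentiable_def)
qed

text \<open>For solutions, the equation expresses the second derivative by the function itself.\<close>

lemma solutions_continuous_family:
  fixes F :: "real \<Rightarrow> real \<Rightarrow> real"
  assumes F: "\<And>s. s \<in> S \<Longrightarrow> F s \<in> solutions \<alpha> p l"
    and c: "continuous_on (S \<times> UNIV) (\<lambda>(s, \<theta>). F s \<theta>)"
      "continuous_on (S \<times> UNIV) (\<lambda>(s, \<theta>). deriv (F s) \<theta>)"
  shows "continuous_map (top_of_set S) C2.mtopology F"
proof (rule C2_continuous_family[OF _ c])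
  show "F s \<in> C2_circle" if "s \<in> S" for s using F[OF that] solutions_subset_C2 by blast
  have pos: "0 < F s \<theta>" if "s \<in> S" for s \<theta> using solution_deriv(4)[OF F[OF that]] .
  have "continuous_on (S \<times> UNIV) (\<lambda>(s, \<theta>). l / (F s \<theta> powr p) - (beta \<alpha> p)\<^sup>2 * F s \<theta>)"
    using c(1) pos unfolding split_beta
    by (intro continuous_intros) (auto simp: less_imp_neq[symmetric])
  then show "continuous_on (S \<times> UNIV) (\<lambda>(s, \<theta>). deriv (deriv (F s)) \<theta>)"
    by (rule continuous_on_eq) (auto simp: solution_deriv(3)[OF F])
qed

lemma solution_translate:
  assumes "w \<in> solutions \<alpha> p l"
  shows "(\<lambda>\<theta>. w (\<theta> + a)) \<in> solutions \<alpha> p l" "deriv (\<lambda>\<theta>. w (\<theta> + a)) = (\<lambda>\<theta>. deriv w (\<theta> + a))"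
proof -
  have w: "w \<in> C2_circle" using assms solutions_subset_C2 by blast
  have per: "w (\<theta> + 2 * pi + a) = w (\<theta> + a)" for \<theta>
    using C2_circle_periodic(1)[OF w, of "\<theta> + a"] by (simp add: algebra_simps)
  note D = solution_deriv[OF assms]
  have d: "((\<lambda>\<theta>. w (\<theta> + a)) has_field_derivative deriv w (\<theta> + a)) (at \<theta>)"
    "((\<lambda>\<theta>. deriv w (\<theta> + a)) has_field_derivative l / (w (\<theta> + a) powr p) - (beta \<alpha> p)\<^sup>2 * w (\<theta> + a)) (at \<theta>)" for \<theta>
    using D(1,2)[of "\<theta> + a"] by (simp_all add: DERIV_shift)
  show "(\<lambda>\<theta>. w (\<theta> + a)) \<in> solutions \<alpha> p l" "deriv (\<lambda>\<theta>. w (\<theta> + a)) = (\<lambda>\<theta>. deriv w (\<theta> + a))"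
    using solutionI[of "\<lambda>\<theta>. w (\<theta> + a)", OF d D(4) per] by auto
qed

lemma translates_topology:
  assumes w: "w \<in> solutions \<alpha> p l"
  shows "connectedin C2.mtopology (translates w)" "compactin C2.mtopology (translates w)"
    "translates w \<subseteq> solutions \<alpha> p l" "w \<in> translates w"
    "\<And>a. (\<lambda>\<theta>. w (\<theta> + a)) \<in> translates w"
proof -
  have wC: "w \<in> C2_circle" using w solutions_subset_C2 by blast
  have wc: "continuous_on UNIV w" "continuous_on UNIV (deriv w)"
    using solution_deriv(1,2)[OF w] DERIV_isCont by (blast intro: continuous_at_imp_continuous_on)+
  have cm: "continuous_map (top_of_set {0..2*pi}) C2.mtopology (\<lambda>a \<theta>. w (\<theta> + a))"
  proof (rule solutions_continuous_family[where l = l and \<alpha> = \<alpha> and p = p])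
    show "continuous_on ({0..2*pi} \<times> UNIV) (\<lambda>(a, \<theta>). w (\<theta> + a))"
      unfolding split_beta by (rule continuous_on_compose2[OF wc(1)]) (auto intro!: continuous_intros)
    show "continuous_on ({0..2*pi} \<times> UNIV) (\<lambda>(a, \<theta>). deriv (\<lambda>\<theta>. w (\<theta> + a)) \<theta>)"
      unfolding split_beta solution_translate(2)[OF w]
      by (rule continuous_on_compose2[OF wc(2)]) (auto intro!: continuous_intros)
  qed (rule solution_translate(1)[OF w])
  show all: "(\<lambda>\<theta>. w (\<theta> + a)) \<in> translates w" for a
  proof -
    obtain k :: int where k: "0 \<le> a + of_int k * (2 * pi)" "a + of_int k * (2 * pi) < 2 * pi"
      using periodic_reduce[of "2 * pi" a] pi_gt_zero by (metis mult_pos_pos zero_less_numeral)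
    have "w (\<theta> + (a + of_int k * (2 * pi))) = w (\<theta> + a)" for \<theta>
      using periodic_int[of w "2 * pi" "\<theta> + a" k] C2_circle_periodic(1)[OF wC] by (simp add: add.assoc)
    then have "(\<lambda>\<theta>. w (\<theta> + a)) = (\<lambda>\<theta>. w (\<theta> + (a + of_int k * (2 * pi))))" by simp
    then show ?thesis unfolding translates_def using k by blast
  qed
  have im: "translates w = (\<lambda>a \<theta>. w (\<theta> + a)) ` {0..2*pi}"
    using all by (auto simp: translates_def)
  show "connectedin C2.mtopology (translates w)"
    unfolding im by (rule connectedin_continuous_map_image[OF cm]) (simp add: connectedin_subtopology)
  show "compactin C2.mtopology (translates w)"
    unfolding im by (rule image_compactin[OF _ cm]) (simp add: compactin_subtopology)
  show "translates w \<subseteq> solutions \<alpha> p l"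
    using solution_translate(1)[OF w] by (auto simp: translates_def)
  show "w \<in> translates w" using all[of 0] by simp
qed

section \<open>Solutions on the circle as rescaled orbits\<close>

lemma is_minimal_period_unique:
  "is_minimal_period w S \<Longrightarrow> is_minimal_period w T \<Longrightarrow> S = T"
  unfolding is_minimal_period_def by (metis linorder_neqE_linordered_idom)

lemma is_minimal_period_translate:
  "is_minimal_period (\<lambda>\<theta>. w (\<theta> + a)) T \<longleftrightarrow> is_minimal_period w T"
proof -
  have "(\<forall>\<theta>. w (\<theta> + S + a) = w (\<theta> + a)) \<longleftrightarrow> (\<forall>\<theta>. w (\<theta> + S) = w \<theta>)" for S
  proof
    assume h: "\<forall>\<theta>. w (\<theta> + S + a) = w (\<theta> + a)"
    show "\<forall>\<theta>. w (\<theta> + S) = w \<theta>" using h[rule_format, of "_ - a"] by (simp add: algebra_simps)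
  next
    assume h: "\<forall>\<theta>. w (\<theta> + S) = w \<theta>"
    show "\<forall>\<theta>. w (\<theta> + S + a) = w (\<theta> + a)" using h[rule_format, of "_ + a"] by (simp add: algebra_simps)
  qed
  then show ?thesis unfolding is_minimal_period_def by simp
qed

lemma not_minimal_period_const: "\<not> is_minimal_period (\<lambda>\<theta>. c) T"
  unfolding is_minimal_period_def by (auto intro!: exI[of _ "T / 2"])

locale circle_problem = singular_oscillator +
  fixes \<alpha> l :: real
  assumes alpha: "- 2 < \<alpha>" and l_pos: "0 < l"
begin

abbreviation "b \<equiv> beta \<alpha> p"

text \<open>The value of the constant solution serves as the unit of length.\<close>

definition c0 :: real where "c0 = (l / b\<^sup>2) powr (1 / (p + 1))"

lemma b_pos: "0 < b" using alpha p_pos by (simp add: beta_def)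

lemma c0_pos: "0 < c0" using l_pos b_pos by (simp add: c0_def)

lemma const_solution_c0: "const_solution \<alpha> p l = (\<lambda>\<theta>. c0)"
  by (simp add: const_solution_def c0_def)

lemma l_eq: "l = b\<^sup>2 * (c0 powr p * c0)"
proof -
  have "c0 powr p * c0 = c0 powr (p + 1)" using c0_pos by (simp add: powr_add)
  also have "\<dots> = l / b\<^sup>2" using l_pos b_pos p_pos by (simp add: c0_def powr_powr)
  finally show ?thesis using b_pos by simp
qed

lemma force_scaling:
  assumes "0 < x"
  shows "l / ((c0 * x) powr p) - b\<^sup>2 * (c0 * x) = b\<^sup>2 * c0 * (x powr - p - x)"
proof -
  have "L / ((c * x) powr p) - B * (c * x) = B * c * (x powr - p - x)"
    if "L = B * (c powr p * c)" "0 < c" for L B c :: real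
    using that assms by (simp add: powr_mult powr_minus field_simps)
  from this[OF l_eq c0_pos] show ?thesis .
qed

lemma solution_to_flow:
  assumes w: "w \<in> solutions \<alpha> p l"
  shows "flow (\<lambda>s. w (s / b) / c0) (\<lambda>s. deriv w (s / b) / (b * c0))"
    "w (((s + 2 * pi * b) / b)) / c0 = w (s / b) / c0"
proof -
  note D = solution_deriv[OF w]
  show "flow (\<lambda>s. w (s / b) / c0) (\<lambda>s. deriv w (s / b) / (b * c0))"
    unfolding flow_def
  proof (intro allI conjI)
    fix s
    define x where "x = w (s / b) / c0"
    have x: "0 < x" "w (s / b) = c0 * x" using D(4)[of "s / b"] c0_pos by (simp_all add: x_def)
    show "0 < w (s / b) / c0" using x(1) unfolding x_def .
    have "((\<lambda>s. w (s / b)) has_field_derivative deriv w (s / b) * (1 / b)) (at s)"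
      by (rule DERIV_chain2[where f = w and g = "\<lambda>s. s / b", OF D(1)]) (use b_pos in \<open>auto intro!: derivative_eq_intros\<close>)
    from DERIV_cdivide[OF this, of c0]
    show "((\<lambda>s. w (s / b) / c0) has_field_derivative deriv w (s / b) / (b * c0)) (at s)"
      by (simp only: times_divide_eq_right mult_1_right divide_divide_eq_left)
    have "((\<lambda>s. deriv w (s / b)) has_field_derivative (l / (w (s / b) powr p) - b\<^sup>2 * w (s / b)) * (1 / b)) (at s)"
      by (rule DERIV_chain2[where f = "deriv w" and g = "\<lambda>s. s / b", OF D(2)]) (use b_pos in \<open>auto intro!: derivative_eq_intros\<close>)
    from DERIV_cdivide[OF this, of "b * c0"]
    have "((\<lambda>s. deriv w (s / b) / (b * c0)) has_field_derivative
        (b\<^sup>2 * c0 * (x powr - p - x)) * (1 / b) / (b * c0)) (at s)"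
      unfolding x(2) force_scaling[OF x(1)] .
    also have "(b\<^sup>2 * c0 * (x powr - p - x)) * (1 / b) / (b * c0) = x powr - p - x"
      using b_pos c0_pos by (simp add: power2_eq_square)
    finally show "((\<lambda>s. deriv w (s / b) / (b * c0)) has_field_derivative
       (w (s / b) / c0) powr - p - w (s / b) / c0) (at s)" unfolding x_def .
  qed
  have "(s + 2 * pi * b) / b = s / b + 2 * pi" using b_pos by (simp add: field_simps)
  then show "w (((s + 2 * pi * b) / b)) / c0 = w (s / b) / c0"
    using C2_circle_periodic(1)[of w "s / b"] w solutions_subset_C2 by auto
qed

text \<open>The orbit of amplitude \<open>r\<close> in the original variables.\<close>

definition circle_orbit :: "real \<Rightarrow> real \<Rightarrow> real \<Rightarrow> real" where
  "circle_orbit r a = (\<lambda>\<theta>. c0 * orbit r (b * \<theta> + a))"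

lemma circle_orbit_0: "circle_orbit 0 a = const_solution \<alpha> p l"
  by (simp add: circle_orbit_def const_solution_c0)

lemma circle_orbit_shift: "circle_orbit r a = (\<lambda>\<theta>. circle_orbit r a' (\<theta> + (a - a') / b))"
proof -
  have "b * (\<theta> + (a - a') / b) + a' = b * \<theta> + a" for \<theta>
    using b_pos by (simp add: distrib_left)
  then show ?thesis unfolding circle_orbit_def by (simp only:)
qed

lemma circle_orbit_solution:
  assumes r: "r \<in> amps" and per: "\<And>s. orbit r (s + 2 * pi * b) = orbit r s"
  shows "circle_orbit r a \<in> solutions \<alpha> p l"
proof -
  have fl: "flow (orbit r) (orbit_vel r)" by (rule orbit_flow[OF r])
  have lin: "((\<lambda>\<theta>. b * \<theta> + a) has_field_derivative b) (at \<theta>)" for \<theta>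
    by (auto intro!: derivative_eq_intros)
  have d1: "(circle_orbit r a has_field_derivative c0 * (orbit_vel r (b * \<theta> + a) * b)) (at \<theta>)" for \<theta>
    unfolding circle_orbit_def
    by (intro DERIV_cmult DERIV_chain2[OF _ lin]) (use fl in \<open>simp add: flow_def\<close>)
  have d2: "((\<lambda>\<theta>. c0 * (orbit_vel r (b * \<theta> + a) * b)) has_field_derivative
      l / (circle_orbit r a \<theta> powr p) - b\<^sup>2 * circle_orbit r a \<theta>) (at \<theta>)" for \<theta>
  proof -
    have x: "0 < orbit r (b * \<theta> + a)" using fl by (simp add: flow_def)
    have "((\<lambda>\<theta>. c0 * (orbit_vel r (b * \<theta> + a) * b)) has_field_derivative
      c0 * ((orbit r (b * \<theta> + a) powr - p - orbit r (b * \<theta> + a)) * b * b)) (at \<theta>)"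
      by (intro DERIV_cmult DERIV_cmult_right DERIV_chain2[OF _ lin]) (use fl in \<open>simp add: flow_def\<close>)
    moreover have "c0 * ((orbit r (b * \<theta> + a) powr - p - orbit r (b * \<theta> + a)) * b * b)
      = l / (circle_orbit r a \<theta> powr p) - b\<^sup>2 * circle_orbit r a \<theta>"
      unfolding circle_orbit_def force_scaling[OF x] by (simp add: power2_eq_square)
    ultimately show ?thesis by simp
  qed
  show ?thesis
  proof (rule solutionI(1)[OF d1 d2])
    show "0 < circle_orbit r a \<theta>" for \<theta> using fl c0_pos by (simp add: circle_orbit_def flow_def)
    show "circle_orbit r a (\<theta> + 2 * pi) = circle_orbit r a \<theta>" for \<theta>
      using per[of "b * \<theta> + a"] by (simp add: circle_orbit_def algebra_simps)
  qed
qed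

lemma solutionE:
  assumes "w \<in> solutions \<alpha> p l"
  obtains r a where "r \<in> amps" "w = circle_orbit r a" "r = 0 \<or> 0 < r \<and> (\<exists>k::int. 2 * pi * b = of_int k * period r)"
proof -
  define x where "x = (\<lambda>s. w (s / b) / c0)"
  have per: "x (s + 2 * pi * b) = x s" for s using solution_to_flow(2)[OF assms] by (simp add: x_def)
  obtain r a where r: "r \<in> amps" and x: "\<And>s. x s = orbit r (s + a)"
    using flow_is_orbit[OF solution_to_flow(1)[OF assms, folded x_def], of "2 * pi * b"] per b_pos by auto
  have "w \<theta> = circle_orbit r a \<theta>" for \<theta>
    using x[of "b * \<theta>"] b_pos c0_pos by (simp add: x_def circle_orbit_def field_simps)
  moreover have "\<exists>k::int. 2 * pi * b = of_int k * period r" if "0 < r"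
    using orbit_period_iff[OF r that, of a "2 * pi * b"] per x by (simp add: algebra_simps)
  moreover have "0 \<le> r" using r by (simp add: amps_def)
  ultimately show ?thesis using that[OF r, of a] by (auto simp: order_le_less)
qed

lemma circle_orbit_period_iff:
  assumes "r \<in> amps" "0 < r"
  shows "(\<forall>\<theta>. circle_orbit r a (\<theta> + S) = circle_orbit r a \<theta>) \<longleftrightarrow> (\<exists>k::int. b * S = of_int k * period r)"
proof -
  have "(\<forall>\<theta>. circle_orbit r a (\<theta> + S) = circle_orbit r a \<theta>) \<longleftrightarrow> (\<forall>s. orbit r (s + a + b * S) = orbit r (s + a))"
  proof
    assume h: "\<forall>\<theta>. circle_orbit r a (\<theta> + S) = circle_orbit r a \<theta>"
    show "\<forall>s. orbit r (s + a + b * S) = orbit r (s + a)"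
    proof
      fix s
      have "circle_orbit r a (s / b + S) = circle_orbit r a (s / b)" using h by blast
      then show "orbit r (s + a + b * S) = orbit r (s + a)"
        using b_pos c0_pos by (simp add: circle_orbit_def algebra_simps)
    qed
  next
    assume h: "\<forall>s. orbit r (s + a + b * S) = orbit r (s + a)"
    have e: "b * (\<theta> + S) + a = b * \<theta> + a + b * S" for \<theta> by (simp add: algebra_simps)
    show "\<forall>\<theta>. circle_orbit r a (\<theta> + S) = circle_orbit r a \<theta>" unfolding circle_orbit_def e using h by simp
  qed
  then show ?thesis using orbit_period_iff[OF assms] by simp
qed

lemma circle_orbit_minimal_period:
  assumes r: "r \<in> amps" "0 < r"
  shows "is_minimal_period (circle_orbit r a) (period r / b)"
  unfolding is_minimal_period_def circle_orbit_period_iff[OF r]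
proof (intro conjI allI impI)
  have T: "0 < period r" by (rule period_pos[OF r(1)])
  show "0 < period r / b" using T b_pos by simp
  show "\<exists>k::int. b * (period r / b) = of_int k * period r" using b_pos by (intro exI[of _ 1]) simp
  fix s assume s: "0 < s \<and> s < period r / b"
  show "\<not> (\<exists>k::int. b * s = of_int k * period r)"
  proof
    assume "\<exists>k::int. b * s = of_int k * period r"
    then obtain k :: int where k: "b * s = of_int k * period r" by blast
    have "0 < b * s" using s b_pos by simp
    then have "0 < k" unfolding k using T by (simp add: zero_less_mult_iff)
    then have "1 * period r \<le> of_int k * period r" using T by (intro mult_right_mono) auto
    also have "\<dots> = b * s" by (simp add: k)
    also have "\<dots> < period r" using s b_pos by (simp add: field_simps)
    finally show False by simp
  qed
qed

section \<open>Counting frequencies\<close>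

lemma J_left_pos: "0 < J_left \<alpha> p"
  using alpha p_pos by (simp add: J_left_def)

text \<open>An integer \<open>k\<close> is admissible if the period \<open>2 * pi * b / k\<close> lies strictly between the limits of \<open>period\<close>; the
factor \<open>p - 3\<close> reverses the order of the limits for \<open>p < 3\<close>, exactly as in lemma \<open>period_range\<close>.\<close>

lemma J_integers_iff_period:
  assumes "p \<noteq> 3"
  shows "k \<in> J_integers \<alpha> p \<longleftrightarrow> 0 < k \<and>
    (p - 3) * (2 * pi / sqrt (1 + p)) < (p - 3) * (2 * pi * b / of_int k) \<and>
    (p - 3) * (2 * pi * b / of_int k) < (p - 3) * period_lim"
proof (cases "0 < k")
  case False
  then have "of_int k \<le> (0::real)" by simp
  then have "\<not> J_left \<alpha> p < of_int k" using J_left_pos by linarith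
  then show ?thesis using False by (simp add: J_integers_def)
next
  case True
  then have k: "0 < (of_int k :: real)" by simp
  have q: "0 < sqrt (p + 1)" using p_pos by simp
  have bq: "b = (\<alpha> + 2) / sqrt (p + 1) / sqrt (p + 1)" using p_pos by (simp add: beta_def)
  have u: "u * (v / c) < u \<longleftrightarrow> v < c" "u < u * (v / c) \<longleftrightarrow> c < v" if "0 < u" "0 < c" for u v c :: real
    using that by (simp_all add: field_simps)
  have 1: "2 * pi * b / of_int k < 2 * pi / sqrt (1 + p) \<longleftrightarrow> (\<alpha> + 2) / sqrt (p + 1) < of_int k"
    "2 * pi / sqrt (1 + p) < 2 * pi * b / of_int k \<longleftrightarrow> of_int k < (\<alpha> + 2) / sqrt (p + 1)"
  proof -
    have e: "2 * pi * b / of_int k = (2 * pi / sqrt (p + 1)) * ((\<alpha> + 2) / sqrt (p + 1) / of_int k)"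
      unfolding bq by simp
    have f: "0 < 2 * pi / sqrt (p + 1)" using q by simp
    show "2 * pi * b / of_int k < 2 * pi / sqrt (1 + p) \<longleftrightarrow> (\<alpha> + 2) / sqrt (p + 1) < of_int k"
      "2 * pi / sqrt (1 + p) < 2 * pi * b / of_int k \<longleftrightarrow> of_int k < (\<alpha> + 2) / sqrt (p + 1)"
      unfolding e add.commute[of 1 p] by (rule u[OF f k])+
  qed
  have 2: "pi < 2 * pi * b / of_int k \<longleftrightarrow> of_int k < 2 * (\<alpha> + 2) / (p + 1)"
    "2 * pi * b / of_int k < pi \<longleftrightarrow> 2 * (\<alpha> + 2) / (p + 1) < of_int k"
  proof -
    have e: "2 * pi * b / of_int k = pi * (2 * (\<alpha> + 2) / (p + 1) / of_int k)"
      by (simp add: beta_def)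
    show "pi < 2 * pi * b / of_int k \<longleftrightarrow> of_int k < 2 * (\<alpha> + 2) / (p + 1)"
      "2 * pi * b / of_int k < pi \<longleftrightarrow> 2 * (\<alpha> + 2) / (p + 1) < of_int k"
      unfolding e by (rule u[OF pi_gt_zero k])+
  qed
  have 3: "2 * pi / (p + 1) < 2 * pi * b / of_int k \<longleftrightarrow> of_int k < \<alpha> + 2"
  proof -
    have e: "2 * pi * b / of_int k = 2 * pi / (p + 1) * ((\<alpha> + 2) / of_int k)"
      by (simp add: beta_def)
    have f: "0 < 2 * pi / (p + 1)" using p_pos by simp
    show ?thesis unfolding e by (rule u(2)[OF f k])
  qed
  show ?thesis
  proof (cases "p < 3")
    case p: True
    have lt: "(p - 3) * x < (p - 3) * y \<longleftrightarrow> y < x" for x y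
      by (rule mult_less_cancel_left_neg) (use p in simp)
    have R: "period_lim < 2 * pi * b / of_int k \<longleftrightarrow> of_int k < J_right \<alpha> p"
      by (cases "p < 1") (simp_all only: period_lim_def J_right_def p if_True if_False 2 3)
    have L: "J_left \<alpha> p = (\<alpha> + 2) / sqrt (p + 1)" using p by (simp add: J_left_def)
    show ?thesis unfolding lt R L J_integers_def mem_Collect_eq greaterThanLessThan_iff 1 using True by blast
  next
    case False
    with assms have p: "3 < p" by simp
    have lt: "(p - 3) * x < (p - 3) * y \<longleftrightarrow> x < y" for x y
      by (rule mult_less_cancel_left_pos) (use p in simp)
    have T: "period_lim = pi" and J: "J_right \<alpha> p = (\<alpha> + 2) / sqrt (p + 1)" "J_left \<alpha> p = 2 * (\<alpha> + 2) / (p + 1)"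
      using p by (simp_all add: period_lim_def J_left_def J_right_def)
    show ?thesis unfolding lt T J J_integers_def mem_Collect_eq greaterThanLessThan_iff 1 2 using True by blast
  qed
qed

lemma J_integers_eq: "J_integers \<alpha> p = {\<lfloor>J_left \<alpha> p\<rfloor> + 1..\<lceil>J_right \<alpha> p\<rceil> - 1}"
  by (auto simp: J_integers_def less_ceiling_iff floor_less_iff) linarith+

lemma finite_J_integers: "finite (J_integers \<alpha> p)"
  by (simp add: J_integers_eq)

lemma J_integers_jj: "k \<in> J_integers \<alpha> p \<longleftrightarrow> (\<exists>i\<in>{1..N0 \<alpha> p}. k = jj \<alpha> p i)"
proof -
  have N: "N0 \<alpha> p = nat (\<lceil>J_right \<alpha> p\<rceil> - 1 - \<lfloor>J_left \<alpha> p\<rfloor>)"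
    by (simp add: N0_def J_integers_eq)
  show ?thesis
  proof
    assume "k \<in> J_integers \<alpha> p"
    then have "\<lfloor>J_left \<alpha> p\<rfloor> + 1 \<le> k" "k \<le> \<lceil>J_right \<alpha> p\<rceil> - 1" by (auto simp: J_integers_eq)
    then show "\<exists>i\<in>{1..N0 \<alpha> p}. k = jj \<alpha> p i"
      by (intro bexI[of _ "nat (k - \<lfloor>J_left \<alpha> p\<rfloor>)"]) (auto simp: jj_def N)
  qed (auto simp: J_integers_eq jj_def N)
qed

lemma jj_inj: "jj \<alpha> p i = jj \<alpha> p j \<longleftrightarrow> i = j"
  by (simp add: jj_def)

text \<open>An open interval without integers lies between consecutive ones; since it starts at a positive number, the lower
one is \<open>0\<close> or positive.  These are the alternatives in the definition of the sets of parameters.\<close>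

lemma J_integers_empty_iff:
  "J_integers \<alpha> p = {} \<longleftrightarrow> J_right \<alpha> p \<le> 1 \<or>
     (\<exists>j::int. 1 \<le> j \<and> of_int j \<le> J_left \<alpha> p \<and> J_right \<alpha> p \<le> of_int j + 1)"
proof
  assume "J_integers \<alpha> p = {}"
  then have "\<lfloor>J_left \<alpha> p\<rfloor> + 1 \<notin> J_integers \<alpha> p" by simp
  then have R: "J_right \<alpha> p \<le> of_int \<lfloor>J_left \<alpha> p\<rfloor> + 1"
    unfolding J_integers_def by simp
  have "0 \<le> \<lfloor>J_left \<alpha> p\<rfloor>" using J_left_pos by simp
  then show "J_right \<alpha> p \<le> 1 \<or>
     (\<exists>j::int. 1 \<le> j \<and> of_int j \<le> J_left \<alpha> p \<and> J_right \<alpha> p \<le> of_int j + 1)"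
  proof (cases "\<lfloor>J_left \<alpha> p\<rfloor> = 0")
    case False
    with \<open>0 \<le> \<lfloor>J_left \<alpha> p\<rfloor>\<close> have "1 \<le> \<lfloor>J_left \<alpha> p\<rfloor>" by linarith
    then show ?thesis using R of_int_floor_le[of "J_left \<alpha> p"] by blast
  qed (use R in simp)
next
  assume "J_right \<alpha> p \<le> 1 \<or>
     (\<exists>j::int. 1 \<le> j \<and> of_int j \<le> J_left \<alpha> p \<and> J_right \<alpha> p \<le> of_int j + 1)"
  then have "\<exists>j::int. of_int j \<le> J_left \<alpha> p \<and> J_right \<alpha> p \<le> of_int j + 1"
  proof
    assume "J_right \<alpha> p \<le> 1"
    then show ?thesis using J_left_pos by (intro exI[of _ 0]) simp
  qed blast
  then obtain j :: int where j: "of_int j \<le> J_left \<alpha> p" "J_right \<alpha> p \<le> of_int j + 1" by blast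
  have "\<not> (J_left \<alpha> p < of_int k \<and> of_int k < J_right \<alpha> p)" for k :: int
  proof
    assume "J_left \<alpha> p < of_int k \<and> of_int k < J_right \<alpha> p"
    then have "of_int j < (of_int k :: real)" "of_int k < (of_int (j + 1) :: real)" using j by auto
    then show False by (simp only: of_int_less_iff)
  qed
  then show "J_integers \<alpha> p = {}" by (auto simp: J_integers_def)
qed

lemma MM_iff:
  assumes "p \<noteq> 3"
  shows "(\<alpha>, p) \<in> MM \<longleftrightarrow> J_integers \<alpha> p = {}"
proof -
  have a: "0 < \<alpha> + 2" using alpha by simp
  have s1: "of_int j \<le> (\<alpha> + 2) / sqrt (p + 1) \<longleftrightarrow> p \<le> ((\<alpha> + 2) / of_int j)\<^sup>2 - 1" if "1 \<le> j" for j :: int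
  proof -
    have j: "0 < (of_int j :: real)" using that by simp
    have "of_int j \<le> (\<alpha> + 2) / sqrt (p + 1) \<longleftrightarrow> sqrt (p + 1) \<le> (\<alpha> + 2) / of_int j"
      using j p_pos by (simp add: field_simps)
    also have "\<dots> \<longleftrightarrow> p + 1 \<le> ((\<alpha> + 2) / of_int j)\<^sup>2"
      using j a real_sqrt_le_iff[of "p + 1" "((\<alpha> + 2) / of_int j)\<^sup>2"] by simp
    finally show ?thesis by (simp add: algebra_simps)
  qed
  have s2: "(\<alpha> + 2) / sqrt (p + 1) \<le> of_int j \<longleftrightarrow> ((\<alpha> + 2) / of_int j)\<^sup>2 - 1 \<le> p" if "1 \<le> j" for j :: int
  proof -
    have j: "0 < (of_int j :: real)" using that by simp
    have "(\<alpha> + 2) / sqrt (p + 1) \<le> of_int j \<longleftrightarrow> (\<alpha> + 2) / of_int j \<le> sqrt (p + 1)"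
      using j p_pos by (simp add: field_simps)
    also have "\<dots> \<longleftrightarrow> ((\<alpha> + 2) / of_int j)\<^sup>2 \<le> p + 1"
      using j a real_sqrt_le_iff[of "((\<alpha> + 2) / of_int j)\<^sup>2" "p + 1"] by simp
    finally show ?thesis by (simp add: algebra_simps)
  qed
  have s3: "2 * (\<alpha> + 2) / (p + 1) \<le> of_int j \<longleftrightarrow> 2 * (\<alpha> + 2) / of_int j - 1 \<le> p"
    "of_int j \<le> 2 * (\<alpha> + 2) / (p + 1) \<longleftrightarrow> p \<le> 2 * (\<alpha> + 2) / of_int j - 1" if "1 \<le> j" for j :: int
    using that p_pos by (simp_all add: field_simps)
  consider "p < 1" | "1 \<le> p" "p < 3" | "3 < p" using assms by linarith
  then show ?thesis
  proof cases
    case 1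
    have "(\<alpha>, p) \<in> MM \<longleftrightarrow> \<alpha> \<le> -1 \<or> (\<exists>j::int. j \<ge> 1 \<and> \<alpha> \<le> of_int j - 1 \<and> p \<le> ((\<alpha> + 2) / of_int j)\<^sup>2 - 1)"
      using 1 alpha p_pos by (simp add: MM_def M1_def M2_def M3_def M4_def)
    also have "\<dots> \<longleftrightarrow> J_integers \<alpha> p = {}"
    proof -
      have "\<alpha> + 2 \<le> 1 \<longleftrightarrow> \<alpha> \<le> -1" by auto
      moreover have "\<alpha> + 2 \<le> of_int j + 1 \<longleftrightarrow> \<alpha> \<le> of_int j - 1" for j :: int by auto
      ultimately show ?thesis
        unfolding J_integers_empty_iff J_left_def J_right_def using 1 s1 by auto
    qed
    finally show ?thesis .
  next
    case 2
    have "(\<alpha>, p) \<in> MM \<longleftrightarrow> p \<ge> 2 * \<alpha> + 3 \<or> (\<exists>j::int. j \<ge> 1 \<and> 2 * (\<alpha> + 2) / (of_int j + 1) - 1 \<le> p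
          \<and> p \<le> ((\<alpha> + 2) / of_int j)\<^sup>2 - 1)"
      using 2 alpha p_pos by (simp add: MM_def M1_def M2_def M3_def M4_def)
    also have "\<dots> \<longleftrightarrow> J_integers \<alpha> p = {}"
    proof -
      have "2 * (\<alpha> + 2) / (p + 1) \<le> 1 \<longleftrightarrow> 2 * \<alpha> + 3 \<le> p" using p_pos by (simp add: field_simps)
      moreover have "2 * (\<alpha> + 2) / (p + 1) \<le> of_int j + 1 \<longleftrightarrow> 2 * (\<alpha> + 2) / (of_int j + 1) - 1 \<le> p"
        if "1 \<le> j" for j :: int
        using s3(1)[of "j + 1"] that by simp
      ultimately show ?thesis
        unfolding J_integers_empty_iff J_left_def J_right_def using 2 s1 by auto
    qed
    finally show ?thesis .
  next
    case 3
    have "(\<alpha>, p) \<in> MM \<longleftrightarrow> p \<ge> (\<alpha> + 2)\<^sup>2 - 1 \<or> (\<exists>j::int. j \<ge> 1 \<and> ((\<alpha> + 2) / (of_int j + 1))\<^sup>2 - 1 \<le> p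
          \<and> p \<le> 2 * (\<alpha> + 2) / of_int j - 1)"
      using 3 alpha p_pos by (simp add: MM_def M1_def M2_def M3_def M4_def)
    also have "\<dots> \<longleftrightarrow> J_integers \<alpha> p = {}"
    proof -
      have "(\<alpha> + 2) / sqrt (p + 1) \<le> 1 \<longleftrightarrow> (\<alpha> + 2)\<^sup>2 - 1 \<le> p" using s2[of 1] by simp
      moreover have "(\<alpha> + 2) / sqrt (p + 1) \<le> of_int j + 1 \<longleftrightarrow> ((\<alpha> + 2) / (of_int j + 1))\<^sup>2 - 1 \<le> p"
        if "1 \<le> j" for j :: int
        using s2[of "j + 1"] that by simp
      ultimately show ?thesis
        unfolding J_integers_empty_iff J_left_def J_right_def using 3 s3(2) by auto
    qed
    finally show ?thesis .
  qed
qed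

section \<open>Components away from the isochronous case\<close>

lemma const_in_solutions: "const_solution \<alpha> p l \<in> solutions \<alpha> p l"
  using circle_orbit_solution[of 0 0] by (simp add: circle_orbit_0)

lemma period_inj:
  assumes "p \<noteq> 3" "r \<in> amps" "s \<in> amps" "period r = period s"
  shows "r = s"
proof (rule ccontr)
  assume "r \<noteq> s"
  then consider "r < s" | "s < r" by linarith
  then show False
  proof cases
    case 1
    show False using period_strict_mono[OF assms(1,3) _ 1] assms by (simp add: amps_def)
  next
    case 2
    show False using period_strict_mono[OF assms(1,2) _ 2] assms by (simp add: amps_def)
  qed
qed

lemma period_multiple_in_J:
  assumes "p \<noteq> 3" "r \<in> amps" "0 < r" "2 * pi * b = of_int k * period r"
  shows "k \<in> J_integers \<alpha> p"
proof -
  have T: "0 < period r" using period_pos assms by blast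
  have "0 < 2 * pi * b" using b_pos by simp
  then have k: "0 < k" unfolding assms(4) using T by (simp add: zero_less_mult_iff)
  then have "period r = 2 * pi * b / of_int k" using assms(4) by (simp add: field_simps)
  then show ?thesis
    using J_integers_iff_period[OF assms(1), of k] period_range[OF assms(1), of "2 * pi * b / of_int k"] k assms by blast
qed

lemma solution_with_minimal_period:
  assumes "p \<noteq> 3" "k \<in> J_integers \<alpha> p"
  shows "\<exists>w\<in>solutions \<alpha> p l. is_minimal_period w (2 * pi / of_int k)"
proof -
  have k: "0 < k" using J_integers_iff_period[OF assms(1)] assms(2) by blast
  obtain r where r: "r \<in> amps" "0 < r" "period r = 2 * pi * b / of_int k"
    using J_integers_iff_period[OF assms(1), of k] period_range[OF assms(1), of "2 * pi * b / of_int k"] assms(2) by blast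
  have "2 * pi * b = of_int k * period r" using r(3) k by simp
  then have "orbit r (s + 2 * pi * b) = orbit r s" for s
    using orbit_period_iff[OF r(1,2), of 0 "2 * pi * b"] by auto
  then have "circle_orbit r 0 \<in> solutions \<alpha> p l" by (rule circle_orbit_solution[OF r(1)])
  moreover have "is_minimal_period (circle_orbit r 0) (2 * pi / of_int k)"
    using circle_orbit_minimal_period[OF r(1,2), of 0] r(3) b_pos by simp
  ultimately show ?thesis by blast
qed

text \<open>The period is an injective function of the amplitude, so a minimal period determines the orbit.\<close>

lemma solution_cases:
  assumes p3: "p \<noteq> 3" and u: "u \<in> solutions \<alpha> p l"
  shows "u = const_solution \<alpha> p l \<or> (\<exists>k\<in>J_integers \<alpha> p. \<forall>w\<in>solutions \<alpha> p l.
      is_minimal_period w (2 * pi / of_int k) \<longrightarrow> u \<in> translates w)"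
proof -
  obtain r a where r: "r \<in> amps" "u = circle_orbit r a" "r = 0 \<or> 0 < r \<and> (\<exists>k::int. 2 * pi * b = of_int k * period r)"
    using solutionE[OF u] by blast
  show ?thesis
  proof (cases "r = 0")
    case True then show ?thesis using r circle_orbit_0 by simp
  next
    case False
    then obtain k :: int where r0: "0 < r" and k: "2 * pi * b = of_int k * period r" using r by blast
    have kJ: "k \<in> J_integers \<alpha> p" by (rule period_multiple_in_J[OF p3 r(1) r0 k])
    have k0: "0 < k" using kJ J_integers_iff_period[OF p3] by blast
    have "u \<in> translates w" if w: "w \<in> solutions \<alpha> p l" and mp: "is_minimal_period w (2 * pi / of_int k)" for w
    proof -
      obtain s c where s: "s \<in> amps" "w = circle_orbit s c" "s = 0 \<or> 0 < s"
        using solutionE[OF w] by metis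
      have "s \<noteq> 0" using mp s circle_orbit_0 not_minimal_period_const by (auto simp: const_solution_c0)
      then have s0: "0 < s" using s by simp
      have "period s / b = 2 * pi / of_int k"
        using is_minimal_period_unique mp circle_orbit_minimal_period[OF s(1) s0, of c] s(2) by blast
      then have "period s = period r" using k k0 b_pos by (simp add: field_simps)
      then have "s = r" using period_inj[OF p3 s(1) r(1)] by simp
      then have "u = (\<lambda>\<theta>. w (\<theta> + (a - c) / b))" using circle_orbit_shift[of r a c] r(2) s(2) by simp
      then show ?thesis using translates_topology(5)[OF w] by simp
    qed
    then show ?thesis using kJ by blast
  qed
qed

text \<open>The families of translates are compact, hence closed, and minimal periods tell them apart.\<close>

lemma components_of_solutions:
  fixes w :: "nat \<Rightarrow> real \<Rightarrow> real"
  assumes p3: "p \<noteq> 3"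
    and w: "\<And>i. i \<in> {1..N0 \<alpha> p} \<Longrightarrow> w i \<in> solutions \<alpha> p l"
      "\<And>i. i \<in> {1..N0 \<alpha> p} \<Longrightarrow> is_minimal_period (w i) (2 * pi / of_int (jj \<alpha> p i))"
  shows "C2_components (solutions \<alpha> p l)
       = insert {const_solution \<alpha> p l} ((\<lambda>i. translates (w i)) ` {1..N0 \<alpha> p})"
    and "card (C2_components (solutions \<alpha> p l)) = 1 + N0 \<alpha> p"
proof -
  let ?S = "solutions \<alpha> p l" and ?c = "const_solution \<alpha> p l" and ?I = "{1..N0 \<alpha> p}"
  let ?X = "subtopology C2.mtopology ?S"
  let ?C = "insert {?c} ((\<lambda>i. translates (w i)) ` ?I)"
  have tc: "translates ?c = {?c}" unfolding translates_def const_solution_def by auto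
  have top: "connectedin ?X (translates u)" "closedin ?X (translates u)" "translates u \<noteq> {}"
    if "u \<in> ?S" for u
  proof -
    note t = translates_topology[OF that]
    show "connectedin ?X (translates u)" using t(1,3) by (simp add: connectedin_subtopology)
    have "closedin C2.mtopology (translates u)"
      by (rule compactin_imp_closedin[OF C2.Hausdorff_space_mtopology t(2)])
    then show "closedin ?X (translates u)" using t(3) by (auto simp: closedin_subtopology)
    show "translates u \<noteq> {}" using t(4) by blast
  qed
  have mp: "is_minimal_period u (2 * pi / of_int (jj \<alpha> p i))" if "i \<in> ?I" "u \<in> translates (w i)" for u i
    using that w(2) is_minimal_period_translate by (auto simp: translates_def)
  have jpos: "0 < jj \<alpha> p i" if "i \<in> ?I" for i
    using J_integers_jj J_integers_iff_period[OF p3] that by blast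
  have mpi: "i = j" if "i \<in> ?I" "j \<in> ?I" "u \<in> translates (w i)" "u \<in> translates (w j)" for u i j
  proof -
    have "2 * pi / of_int (jj \<alpha> p i) = (2 * pi / of_int (jj \<alpha> p j) :: real)"
      using is_minimal_period_unique mp that by blast
    then have "jj \<alpha> p i = jj \<alpha> p j" using jpos that by (simp add: field_simps)
    then show "i = j" by (simp add: jj_inj)
  qed
  have nc: "?c \<notin> translates (w i)" if "i \<in> ?I" for i
    using mp[OF that] not_minimal_period_const unfolding const_solution_def by blast
  show eq: "C2_components ?S = ?C"
    unfolding C2_components_def
  proof (rule connected_components_of_finite_closed_partition)
    show "finite ?C" by simp
    show "connectedin ?X C" "closedin ?X C" "C \<noteq> {}" if "C \<in> ?C" for C
    proof -
      have "\<exists>u\<in>?S. C = translates u" using that tc const_in_solutions w(1) by blast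
      then show "connectedin ?X C" "closedin ?X C" "C \<noteq> {}" using top by blast+
    qed
    show "C \<inter> D = {}" if "C \<in> ?C" "D \<in> ?C" "C \<noteq> D" for C D
    proof (rule ccontr)
      assume "C \<inter> D \<noteq> {}"
      then obtain u where u: "u \<in> C" "u \<in> D" by blast
      have "C = {?c} \<and> u = ?c \<or> (\<exists>i\<in>?I. C = translates (w i) \<and> u \<in> translates (w i))"
        using that(1) u(1) by blast
      moreover have "D = {?c} \<and> u = ?c \<or> (\<exists>i\<in>?I. D = translates (w i) \<and> u \<in> translates (w i))"
        using that(2) u(2) by blast
      ultimately show False using that(3) nc mpi by metis
    qed
    show "\<Union>?C = topspace ?X"
    proof -
      have "?S \<subseteq> C2_circle" by (rule solutions_subset_C2)
      then have "topspace ?X = ?S" by auto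
      moreover have "\<Union>?C \<subseteq> ?S"
      proof -
        have "translates (w i) \<subseteq> ?S" if "i \<in> ?I" for i
          by (rule translates_topology(3)[OF w(1)[OF that]])
        then show ?thesis using const_in_solutions by blast
      qed
      moreover have "?S \<subseteq> \<Union>?C"
      proof
        fix u assume "u \<in> ?S"
        then consider "u = ?c" | k where "k \<in> J_integers \<alpha> p"
          "\<forall>w\<in>?S. is_minimal_period w (2 * pi / of_int k) \<longrightarrow> u \<in> translates w"
          using solution_cases[OF p3] by blast
        then show "u \<in> \<Union>?C"
        proof cases
          case 2
          then obtain i where "i \<in> ?I" "k = jj \<alpha> p i" using J_integers_jj by blast
          then have "u \<in> translates (w i)" using 2 w by blast
          then show ?thesis using \<open>i \<in> ?I\<close> by blast
        qed simp
      qed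
      ultimately show ?thesis by blast
    qed
  qed
  have inj: "inj_on (\<lambda>i. translates (w i)) ?I"
    using mpi translates_topology(4)[OF w(1)] by (intro inj_onI) metis
  have "{?c} \<notin> (\<lambda>i. translates (w i)) ` ?I" using nc by blast
  then show "card (C2_components ?S) = 1 + N0 \<alpha> p"
    unfolding eq using inj by (simp add: card_image)
qed

end

section \<open>The isochronous case \<open>p = 3\<close>\<close>

text \<open>The square root of a positive solution of \<open>y'' + \<omega>\<^sup>2 * y = const\<close> (Pinney's solution of the Ermakov equation).
The mean of \<open>y\<close> is tied to its amplitude \<open>R\<close> by \<open>mean\<^sup>2 - R\<^sup>2 = 1\<close>, which fixes the coefficient of the
singular term to be \<open>(\<omega> / 2)\<^sup>2\<close>.\<close>

definition pinney :: "real \<Rightarrow> real \<Rightarrow> real \<Rightarrow> real \<Rightarrow> real" where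
  "pinney \<omega> R a = (\<lambda>\<theta>. sqrt (sqrt (1 + R\<^sup>2) - R * cos (\<omega> * (\<theta> + a))))"

lemma pinney_radicand_pos: "0 < sqrt (1 + R\<^sup>2) - R * cos x"
proof -
  have "\<bar>R * cos x\<bar> \<le> \<bar>R\<bar>" by (simp add: abs_mult mult_left_le)
  also have "\<bar>R\<bar> = sqrt (R\<^sup>2)" by simp
  also have "\<dots> < sqrt (1 + R\<^sup>2)" by (subst real_sqrt_less_iff) simp
  finally show ?thesis by linarith
qed

lemma pinney_pos: "0 < pinney \<omega> R a \<theta>"
  using pinney_radicand_pos by (simp add: pinney_def)

lemma pinney_sq: "(pinney \<omega> R a \<theta>)\<^sup>2 = sqrt (1 + R\<^sup>2) - R * cos (\<omega> * (\<theta> + a))"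
  using pinney_radicand_pos[of R "\<omega> * (\<theta> + a)"] by (simp add: pinney_def)

lemma pinney_0: "pinney \<omega> 0 a = (\<lambda>\<theta>. 1)"
  by (simp add: pinney_def)

lemma pinney_deriv:
  "(pinney \<omega> R a has_field_derivative R * \<omega> * sin (\<omega> * (\<theta> + a)) / (2 * pinney \<omega> R a \<theta>)) (at \<theta>)"
  unfolding pinney_def
  using pinney_radicand_pos[of R "\<omega> * (\<theta> + a)"]
  by (auto intro!: derivative_eq_intros simp: field_simps)

lemma pinney_deriv2:
  "((\<lambda>\<theta>. R * \<omega> * sin (\<omega> * (\<theta> + a)) / (2 * pinney \<omega> R a \<theta>)) has_field_derivative
     (\<omega> / 2)\<^sup>2 * (1 / (pinney \<omega> R a \<theta>) ^ 3 - pinney \<omega> R a \<theta>)) (at \<theta>)"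
proof -
  define s where "s = pinney \<omega> R a \<theta>"
  define C where "C = cos (\<omega> * (\<theta> + a))"
  define S where "S = sin (\<omega> * (\<theta> + a))"
  define M where "M = sqrt (1 + R\<^sup>2)"
  have s: "0 < s" "s\<^sup>2 = M - R * C" using pinney_pos pinney_sq by (auto simp: s_def M_def C_def)
  have M: "M\<^sup>2 = 1 + R\<^sup>2" by (simp add: M_def add_nonneg_nonneg)
  have CS: "S\<^sup>2 = 1 - C\<^sup>2" by (simp add: S_def C_def sin_squared_eq)
  have "((\<lambda>\<theta>. R * \<omega> * sin (\<omega> * (\<theta> + a)) / (2 * pinney \<omega> R a \<theta>)) has_field_derivative
     (R * \<omega> * (C * \<omega>) * (2 * s) - R * \<omega> * S * (2 * (R * \<omega> * S / (2 * s)))) / ((2 * s) * (2 * s))) (at \<theta>)"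
    unfolding s_def C_def S_def
    by (rule DERIV_divide) (use pinney_pos[of \<omega> R a \<theta>] in \<open>auto intro!: derivative_eq_intros pinney_deriv\<close>)
  also have "(R * \<omega> * (C * \<omega>) * (2 * s) - R * \<omega> * S * (2 * (R * \<omega> * S / (2 * s)))) / ((2 * s) * (2 * s))
    = (\<omega> / 2)\<^sup>2 * ((2 * R * C * s\<^sup>2 - R\<^sup>2 * S\<^sup>2) / s ^ 3)"
    using s(1) by (simp add: power2_eq_square power3_eq_cube field_simps)
  also have "2 * R * C * s\<^sup>2 - R\<^sup>2 * S\<^sup>2 = 1 - s\<^sup>2 * s\<^sup>2"
    unfolding s(2) CS using M by algebra
  also have "(1 - s\<^sup>2 * s\<^sup>2) / s ^ 3 = 1 / s ^ 3 - s"
    using s(1) by (simp add: power2_eq_square power3_eq_cube field_simps)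
  finally show ?thesis by (simp add: s_def)
qed

lemma w_family_eq_pinney:
  assumes "0 < \<epsilon>"
  shows "w_family b l \<epsilon> a = (\<lambda>\<theta>. (l / b\<^sup>2) powr (1 / 4) * pinney (2 * b) ((inverse \<epsilon> - \<epsilon>) / 2) a \<theta>)"
proof -
  define R where "R = (inverse \<epsilon> - \<epsilon>) / 2"
  have "1 + R\<^sup>2 = ((inverse \<epsilon> + \<epsilon>) / 2)\<^sup>2"
    using assms by (simp add: R_def power2_eq_square field_simps)
  then have M: "sqrt (1 + R\<^sup>2) = (inverse \<epsilon> + \<epsilon>) / 2" using assms by simp
  have "\<epsilon> * (cos x)\<^sup>2 + inverse \<epsilon> * (sin x)\<^sup>2 = sqrt (1 + R\<^sup>2) - R * cos (2 * x)" for x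
  proof -
    have "\<epsilon> * (cos x)\<^sup>2 + inverse \<epsilon> * (sin x)\<^sup>2
        = (inverse \<epsilon> + \<epsilon>) / 2 - (inverse \<epsilon> - \<epsilon>) / 2 * ((cos x)\<^sup>2 - (sin x)\<^sup>2)"
      unfolding cos_squared_eq by (simp add: diff_divide_distrib add_divide_distrib algebra_simps)
    then show ?thesis by (simp only: M cos_double R_def[symmetric])
  qed
  then have "\<epsilon> * (cos (b * (\<theta> + a)))\<^sup>2 + inverse \<epsilon> * (sin (b * (\<theta> + a)))\<^sup>2
     = sqrt (1 + R\<^sup>2) - R * cos (2 * b * (\<theta> + a))" for \<theta>
    by (simp add: mult.assoc)
  then show ?thesis unfolding w_family_def pinney_def R_def by simp
qed

text \<open>The extreme values of the square are \<open>\<epsilon>\<close> and its inverse.\<close>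

lemma pinney_parameter:
  fixes R :: real
  assumes "0 \<le> R"
  obtains \<epsilon> where "\<epsilon> \<in> {0<..1}" "(inverse \<epsilon> - \<epsilon>) / 2 = R"
proof -
  define M where "M = sqrt (1 + R\<^sup>2)"
  have M: "M\<^sup>2 = 1 + R\<^sup>2" "0 < M" by (simp_all add: M_def add_pos_nonneg)
  have MR: "0 < M - R" using pinney_radicand_pos[of R 0] by (simp add: M_def)
  have "(M - R) * (M + R) = 1" using M by algebra
  then have inv: "inverse (M - R) = M + R" by (metis inverse_unique)
  have "M - R \<le> 1"
  proof (rule ccontr)
    assume "\<not> M - R \<le> 1"
    then have "1 < M - R" "1 < M + R" using assms by auto
    then have "1 * 1 < (M - R) * (M + R)" by (intro mult_strict_mono) auto
    then show False using \<open>(M - R) * (M + R) = 1\<close> by simp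
  qed
  then show ?thesis using that[of "M - R"] MR inv by simp
qed

locale isochronous_problem = circle_problem 3 \<alpha> l for \<alpha> l :: real
begin

lemma b_eq: "b = (\<alpha> + 2) / 4" by (simp add: beta_def)

lemma c0_fourth: "l = b\<^sup>2 * c0 ^ 4"
proof -
  have "c0 powr 3 * c0 = c0 ^ 4" using c0_pos by (simp add: power_numeral_reduce)
  with l_eq show ?thesis by simp
qed

lemma c0_alt: "(l / b\<^sup>2) powr (1 / 4) = c0" by (simp add: c0_def)

lemma pinney_solution:
  assumes "\<And>\<theta>. pinney (2 * b) R a (\<theta> + 2 * pi) = pinney (2 * b) R a \<theta>"
  shows "(\<lambda>\<theta>. c0 * pinney (2 * b) R a \<theta>) \<in> solutions \<alpha> 3 l"
    "deriv (\<lambda>\<theta>. c0 * pinney (2 * b) R a \<theta>)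
      = (\<lambda>\<theta>. c0 * (R * (2 * b) * sin (2 * b * (\<theta> + a)) / (2 * pinney (2 * b) R a \<theta>)))"
proof -
  have d1: "((\<lambda>\<theta>. c0 * pinney (2 * b) R a \<theta>) has_field_derivative
     c0 * (R * (2 * b) * sin (2 * b * (\<theta> + a)) / (2 * pinney (2 * b) R a \<theta>))) (at \<theta>)" for \<theta>
    by (rule DERIV_cmult[OF pinney_deriv])
  have d2: "((\<lambda>\<theta>. c0 * (R * (2 * b) * sin (2 * b * (\<theta> + a)) / (2 * pinney (2 * b) R a \<theta>))) has_field_derivative
     l / ((c0 * pinney (2 * b) R a \<theta>) powr 3) - b\<^sup>2 * (c0 * pinney (2 * b) R a \<theta>)) (at \<theta>)" for \<theta>
  proof -
    have "l / ((c0 * pinney (2 * b) R a \<theta>) powr 3) - b\<^sup>2 * (c0 * pinney (2 * b) R a \<theta>)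
      = b\<^sup>2 * c0 * (pinney (2 * b) R a \<theta> powr - 3 - pinney (2 * b) R a \<theta>)"
      by (rule force_scaling[OF pinney_pos])
    also have "pinney (2 * b) R a \<theta> powr - 3 = 1 / pinney (2 * b) R a \<theta> ^ 3"
      using pinney_pos[of "2 * b" R a \<theta>] by (simp add: powr_minus divide_inverse)
    finally show ?thesis using DERIV_cmult[OF pinney_deriv2[of R "2 * b" a \<theta>], of c0]
      by (simp add: mult_ac)
  qed
  show "(\<lambda>\<theta>. c0 * pinney (2 * b) R a \<theta>) \<in> solutions \<alpha> 3 l"
    "deriv (\<lambda>\<theta>. c0 * pinney (2 * b) R a \<theta>)
      = (\<lambda>\<theta>. c0 * (R * (2 * b) * sin (2 * b * (\<theta> + a)) / (2 * pinney (2 * b) R a \<theta>)))"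
    using solutionI[OF d1 d2] assms c0_pos pinney_pos by auto
qed

text \<open>By conservation of the energy \<open>e\<close>, the square of a solution satisfies \<open>(w\<^sup>2)'' = 2 * e - 4 * b\<^sup>2 * w\<^sup>2\<close>.\<close>

lemma solution_is_pinney:
  assumes w: "w \<in> solutions \<alpha> 3 l"
  obtains R a where "0 \<le> R" "a \<in> {0..<pi / b}" "w = (\<lambda>\<theta>. c0 * pinney (2 * b) R a \<theta>)"
proof -
  define v where "v = deriv w"
  have wp: "0 < w \<theta>" for \<theta> by (rule solution_deriv(4)[OF w])
  have d1: "(w has_field_derivative v \<theta>) (at \<theta>)" for \<theta>
    using solution_deriv(1)[OF w] by (simp add: v_def)
  have d2: "(v has_field_derivative l / w \<theta> ^ 3 - b\<^sup>2 * w \<theta>) (at \<theta>)" for \<theta>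
    using solution_deriv(2)[OF w, of \<theta>] wp[of \<theta>] by (simp add: v_def)
  define E where "E = (\<lambda>\<theta>. (v \<theta>)\<^sup>2 + b\<^sup>2 * (w \<theta>)\<^sup>2 + l / (w \<theta>)\<^sup>2)"
  define e where "e = E 0"
  have "E \<theta> = E 0" for \<theta>
  proof (rule zero_deriv_const[of E])
    fix \<theta>
    show "(E has_field_derivative 0) (at \<theta>)"
      unfolding E_def using wp[of \<theta>]
      by (auto intro!: derivative_eq_intros d1 d2 simp: power2_eq_square power3_eq_cube field_simps)
  qed
  then have E: "(v \<theta>)\<^sup>2 + b\<^sup>2 * (w \<theta>)\<^sup>2 + l / (w \<theta>)\<^sup>2 = e" for \<theta> by (simp add: e_def E_def)
  \<comment> \<open>\<open>Y\<close> is the mean of \<open>w\<^sup>2\<close>; \<open>z\<close> and \<open>u\<close> rotate with angular velocity \<open>2 * b\<close>\<close>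
  define Y where "Y = e / (2 * b\<^sup>2)"
  define z where "z = (\<lambda>\<theta>. (w \<theta>)\<^sup>2 - Y)"
  define u where "u = (\<lambda>\<theta>. w \<theta> * v \<theta> / b)"
  have zd: "(z has_field_derivative 2 * b * u \<theta>) (at \<theta>)" for \<theta>
    unfolding z_def u_def using b_pos by (auto intro!: derivative_eq_intros d1 simp: field_simps)
  have ud: "(u has_field_derivative - (2 * b) * z \<theta>) (at \<theta>)" for \<theta>
  proof -
    have "(u has_field_derivative (v \<theta> * v \<theta> + (l / w \<theta> ^ 3 - b\<^sup>2 * w \<theta>) * w \<theta>) / b) (at \<theta>)"
      unfolding u_def by (intro DERIV_cdivide DERIV_mult d1 d2)
    also have "v \<theta> * v \<theta> + (l / w \<theta> ^ 3 - b\<^sup>2 * w \<theta>) * w \<theta> = (v \<theta>)\<^sup>2 + l / (w \<theta>)\<^sup>2 - b\<^sup>2 * (w \<theta>)\<^sup>2"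
      using wp[of \<theta>] by (simp add: power2_eq_square power3_eq_cube field_simps)
    also have "\<dots> = e - 2 * b\<^sup>2 * (w \<theta>)\<^sup>2" using E[of \<theta>] by linarith
    also have "\<dots> = - (2 * b\<^sup>2) * z \<theta>" using b_pos by (simp add: z_def Y_def field_simps)
    finally show ?thesis using b_pos by (simp add: power2_eq_square mult.assoc)
  qed
  have rot: "z \<theta> = z 0 * cos (2 * b * \<theta>) + u 0 * sin (2 * b * \<theta>)" for \<theta>
  proof -
    have "(z has_field_derivative u s * (2 * b)) (at s)" "(u has_field_derivative - z s * (2 * b)) (at s)" for s
      using zd[of s] ud[of s] by (simp_all add: mult_ac)
    from rotating_pair(1)[OF this DERIV_cmult_Id, of \<theta>] show ?thesis by simp
  qed
  define \<rho> where "\<rho> = sqrt ((z 0)\<^sup>2 + (u 0)\<^sup>2)"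
  have \<rho>0: "0 \<le> \<rho>" by (simp add: \<rho>_def)
  have \<rho>2: "\<rho>\<^sup>2 = (z 0)\<^sup>2 + (u 0)\<^sup>2" by (simp add: \<rho>_def)
  obtain \<delta> where \<delta>: "0 \<le> \<delta>" "\<delta> < 2 * pi" "z 0 = - \<rho> * cos \<delta>" "u 0 = \<rho> * sin \<delta>"
  proof (cases "\<rho> = 0")
    case True
    then have "z 0 = 0" "u 0 = 0" by (simp_all add: \<rho>_def add_nonneg_eq_0_iff)
    then show ?thesis using that[of 0] True by simp
  next
    case False
    then have "(- z 0 / \<rho>)\<^sup>2 + (u 0 / \<rho>)\<^sup>2 = 1"
    proof -
      have "(- z 0 / \<rho>)\<^sup>2 + (u 0 / \<rho>)\<^sup>2 = ((z 0)\<^sup>2 + (u 0)\<^sup>2) / \<rho>\<^sup>2"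
        by (simp add: power_divide add_divide_distrib)
      then show ?thesis using False by (simp only: \<rho>2[symmetric]) simp
    qed
    then obtain t where "0 \<le> t" "t < 2 * pi" "- z 0 / \<rho> = cos t" "u 0 / \<rho> = sin t"
      using sincos_total_2pi by metis
    then show ?thesis using that[of t] False by (simp add: field_simps)
  qed
  \<comment> \<open>a phase in \<open>{0..<2 * pi}\<close> becomes a time shift in \<open>{0..<pi / b}\<close>\<close>
  define a where "a = \<delta> / (2 * b)"
  have a: "a \<in> {0..<pi / b}" using \<delta> b_pos by (simp add: a_def field_simps)
  have ba: "2 * b * (\<theta> + a) = 2 * b * \<theta> + \<delta>" for \<theta> using b_pos by (simp add: a_def field_simps)
  have z: "z \<theta> = - \<rho> * cos (2 * b * (\<theta> + a))" for \<theta>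
    unfolding rot[of \<theta>] ba \<delta> cos_add by (simp add: algebra_simps)
  \<comment> \<open>energy conservation at time \<open>0\<close>\<close>
  have rel: "Y\<^sup>2 - \<rho>\<^sup>2 = (c0\<^sup>2)\<^sup>2"
  proof -
    have "b\<^sup>2 * (u 0)\<^sup>2 = (w 0)\<^sup>2 * (v 0)\<^sup>2" using b_pos by (simp add: u_def power_divide power_mult_distrib)
    also have "(v 0)\<^sup>2 = e - b\<^sup>2 * (w 0)\<^sup>2 - l / (w 0)\<^sup>2" using E[of 0] by linarith
    also have "(w 0)\<^sup>2 * (e - b\<^sup>2 * (w 0)\<^sup>2 - l / (w 0)\<^sup>2) = (w 0)\<^sup>2 * e - b\<^sup>2 * ((w 0)\<^sup>2)\<^sup>2 - l" using wp[of 0] by (simp add: field_simps power2_eq_square)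
    finally have 1: "b\<^sup>2 * (u 0)\<^sup>2 = (w 0)\<^sup>2 * e - b\<^sup>2 * ((w 0)\<^sup>2)\<^sup>2 - l" .
    have 2: "e = 2 * b\<^sup>2 * Y" using b_pos by (simp add: Y_def)
    have "b\<^sup>2 * (Y\<^sup>2 - \<rho>\<^sup>2) = l"
      unfolding \<rho>2 z_def using 1 unfolding 2 by algebra
    also have "\<dots> = b\<^sup>2 * (c0\<^sup>2)\<^sup>2" using c0_fourth by simp
    finally show ?thesis using b_pos by simp
  qed
  have Y0: "0 < Y"
  proof -
    have "0 < b\<^sup>2 * (w 0)\<^sup>2" "0 \<le> (v 0)\<^sup>2" "0 < l / (w 0)\<^sup>2" using b_pos wp[of 0] l_pos by simp_all
    then have "0 < e" using E[of 0] by linarith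
    then show ?thesis using b_pos by (simp add: Y_def)
  qed
  define R where "R = \<rho> / c0\<^sup>2"
  have "1 + R\<^sup>2 = (Y / c0\<^sup>2)\<^sup>2"
    using rel c0_pos by (simp add: R_def power_divide field_simps)
  then have M: "sqrt (1 + R\<^sup>2) = Y / c0\<^sup>2" using Y0 c0_pos by simp
  have "w \<theta> = c0 * pinney (2 * b) R a \<theta>" for \<theta>
  proof -
    have "(c0 * pinney (2 * b) R a \<theta>)\<^sup>2 = c0\<^sup>2 * (Y / c0\<^sup>2 - \<rho> / c0\<^sup>2 * cos (2 * b * (\<theta> + a)))"
      unfolding power_mult_distrib pinney_sq M by (simp add: R_def)
    also have "\<dots> = Y - \<rho> * cos (2 * b * (\<theta> + a))" using c0_pos by (simp add: algebra_simps)
    also have "\<dots> = (w \<theta>)\<^sup>2" using z[of \<theta>] by (simp add: z_def)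
    finally show ?thesis
      using wp[of \<theta>] c0_pos pinney_pos[of "2 * b" R a \<theta>]
      by (metis less_imp_le mult_nonneg_nonneg power2_eq_imp_eq)
  qed
  moreover have "0 \<le> R" using \<rho>0 by (simp add: R_def)
  ultimately show ?thesis using that a by blast
qed

lemma pinney_period_imp:
  assumes "R \<noteq> 0" "\<And>\<theta>. pinney (2 * b) R a (\<theta> + S) = pinney (2 * b) R a \<theta>"
  obtains k :: int where "2 * b * S = 2 * pi * of_int k"
proof -
  have "(pinney (2 * b) R a (- a + S))\<^sup>2 = (pinney (2 * b) R a (- a))\<^sup>2" by (simp only: assms(2))
  then have "cos (2 * b * S) = 1" unfolding pinney_sq using assms(1) by simp
  then show ?thesis using that cos_one_2pi_int by (metis mult.commute mult.assoc)
qed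

lemma pinney_period:
  assumes "2 * b * S = 2 * pi * of_int k"
  shows "pinney (2 * b) R a (\<theta> + S) = pinney (2 * b) R a \<theta>"
proof -
  have "2 * b * (\<theta> + S + a) = 2 * b * (\<theta> + a) + 2 * pi * of_int k"
    using assms by (simp add: algebra_simps)
  then show ?thesis unfolding pinney_def by (simp only: cos_add cos_int_2pin sin_int_2pin) simp
qed

text \<open>A nonconstant solution has minimal period \<open>pi / b\<close>, which divides \<open>2 * pi\<close> only if \<open>\<alpha>\<close> is an even natural number.\<close>

lemma nonresonant_solutions:
  assumes "\<not> (\<exists>n::nat. \<alpha> = 2 * of_nat n)"
  shows "solutions \<alpha> 3 l = {const_solution \<alpha> 3 l}"
proof -
  have "w = const_solution \<alpha> 3 l" if w: "w \<in> solutions \<alpha> 3 l" for w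
  proof -
    obtain R a where R: "0 \<le> R" "w = (\<lambda>\<theta>. c0 * pinney (2 * b) R a \<theta>)"
      using solution_is_pinney[OF w] by metis
    have "R = 0"
    proof (rule ccontr)
      assume "R \<noteq> 0"
      have "w (\<theta> + 2 * pi) = w \<theta>" for \<theta>
        using C2_circle_periodic(1) w solutions_subset_C2 by blast
      then have "pinney (2 * b) R a (\<theta> + 2 * pi) = pinney (2 * b) R a \<theta>" for \<theta>
        using R(2) c0_pos by simp
      then obtain k :: int where "2 * b * (2 * pi) = 2 * pi * of_int k"
        using pinney_period_imp \<open>R \<noteq> 0\<close> by metis
      then have k: "2 * b = of_int k" by simp
      then have "0 < k" using b_pos by simp
      then have "\<alpha> = 2 * of_nat (nat (k - 1))" using k b_eq by (simp add: of_nat_nat)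
      then show False using assms by blast
    qed
    then show ?thesis using R(2) by (simp add: pinney_0 const_solution_c0)
  qed
  then show ?thesis using const_in_solutions by blast
qed

lemma w_family_pinney:
  "0 < \<epsilon> \<Longrightarrow> w_family b l \<epsilon> a = (\<lambda>\<theta>. c0 * pinney (2 * b) ((inverse \<epsilon> - \<epsilon>) / 2) a \<theta>)"
  using w_family_eq_pinney c0_alt by simp

lemma w_family_1: "w_family b l 1 a = const_solution \<alpha> 3 l"
  by (simp add: w_family_pinney pinney_0 const_solution_c0)

context
  fixes n :: nat
  assumes n: "\<alpha> = 2 * of_nat n"
begin

lemma two_b: "2 * b = real n + 1" using n b_eq by simp

lemma resonant_period: "pinney (2 * b) R a (\<theta> + 2 * pi) = pinney (2 * b) R a \<theta>"
  by (rule pinney_period[where k = "int n + 1"]) (simp add: two_b)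

lemma resonant_solutions:
  "solutions \<alpha> 3 l = {w_family b l \<epsilon> a | \<epsilon> a. \<epsilon> \<in> {0<..1} \<and> a \<in> {0..<pi / b}}"
proof (intro equalityI subsetI)
  fix w assume "w \<in> solutions \<alpha> 3 l"
  then obtain R a where R: "0 \<le> R" "a \<in> {0..<pi / b}" "w = (\<lambda>\<theta>. c0 * pinney (2 * b) R a \<theta>)"
    using solution_is_pinney by metis
  obtain \<epsilon> where "\<epsilon> \<in> {0<..1}" "(inverse \<epsilon> - \<epsilon>) / 2 = R" using pinney_parameter[OF R(1)] by metis
  then have "w = w_family b l \<epsilon> a" using R(3) w_family_pinney by simp
  then show "w \<in> {w_family b l \<epsilon> a | \<epsilon> a. \<epsilon> \<in> {0<..1} \<and> a \<in> {0..<pi / b}}"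
    using R(2) \<open>\<epsilon> \<in> {0<..1}\<close> by blast
next
  fix w assume "w \<in> {w_family b l \<epsilon> a | \<epsilon> a. \<epsilon> \<in> {0<..1} \<and> a \<in> {0..<pi / b}}"
  then show "w \<in> solutions \<alpha> 3 l"
    using w_family_pinney pinney_solution(1)[OF resonant_period] by auto
qed

lemma w_family_path_connected:
  "connectedin C2.mtopology ((\<lambda>\<epsilon>. w_family b l \<epsilon> a) ` {0<..1})"
proof (rule connectedin_continuous_map_image)
  show "continuous_map (top_of_set {0<..1}) C2.mtopology (\<lambda>\<epsilon>. w_family b l \<epsilon> a)"
  proof (rule solutions_continuous_family[where \<alpha> = \<alpha> and p = 3 and l = l])
    define Rf :: "real \<Rightarrow> real" where "Rf = (\<lambda>\<epsilon>. (inverse \<epsilon> - \<epsilon>) / 2)"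
    have cR: "continuous_on ({0<..1} \<times> UNIV) (\<lambda>z. Rf (fst z))"
      unfolding Rf_def by (intro continuous_intros) auto
    have cp: "continuous_on ({0<..1} \<times> UNIV) (\<lambda>z. pinney (2 * b) (Rf (fst z)) a (snd z))"
      unfolding pinney_def by (intro continuous_intros cR)
    have cd: "continuous_on ({0<..1} \<times> UNIV)
        (\<lambda>z. c0 * (Rf (fst z) * (2 * b) * sin (2 * b * (snd z + a)) / (2 * pinney (2 * b) (Rf (fst z)) a (snd z))))"
      using pinney_pos by (intro continuous_intros cR cp) (auto simp: less_imp_neq[symmetric])
    show "w_family b l \<epsilon> a \<in> solutions \<alpha> 3 l" if "\<epsilon> \<in> {0<..1}" for \<epsilon>
      using that w_family_pinney pinney_solution(1)[OF resonant_period] by simp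
    show "continuous_on ({0<..1} \<times> UNIV) (\<lambda>(\<epsilon>, \<theta>). w_family b l \<epsilon> a \<theta>)"
      by (rule continuous_on_eq[OF continuous_on_mult_left[OF cp, of c0]])
        (auto simp: w_family_pinney Rf_def)
    show "continuous_on ({0<..1} \<times> UNIV) (\<lambda>(\<epsilon>, \<theta>). deriv (w_family b l \<epsilon> a) \<theta>)"
      by (rule continuous_on_eq[OF cd])
        (auto simp: w_family_pinney pinney_solution(2)[OF resonant_period] Rf_def)
  qed
  show "connectedin (top_of_set {0<..1::real}) {0<..1}"
    by (simp add: connectedin_subtopology)
qed

text \<open>Each solution is joined to the constant one by letting \<open>\<epsilon>\<close> tend to \<open>1\<close>.\<close>

lemma resonant_components: "C2_components (solutions \<alpha> 3 l) = {solutions \<alpha> 3 l}"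
proof -
  let ?S = "solutions \<alpha> 3 l" and ?P = "\<lambda>a. (\<lambda>\<epsilon>. w_family b l \<epsilon> a) ` {0<..1}"
  have S: "?S = \<Union>(?P ` {0..<pi / b})" unfolding resonant_solutions by blast
  have "const_solution \<alpha> 3 l \<in> ?P a" for a
    by (rule image_eqI[of _ _ 1]) (simp_all add: w_family_1)
  then have "\<Inter>(?P ` {0..<pi / b}) \<noteq> {}" by blast
  then have "connectedin C2.mtopology ?S"
    unfolding S using w_family_path_connected by (intro connectedin_Union) auto
  then have "connected_space (subtopology C2.mtopology ?S)"
    by (simp add: connectedin_def)
  moreover have "topspace (subtopology C2.mtopology ?S) = ?S"
    using solutions_subset_C2 by auto
  moreover from this have "subtopology C2.mtopology ?S \<noteq> trivial_topology"
    using const_in_solutions by (metis empty_iff topspace_discrete_topology)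
  ultimately show ?thesis
    unfolding C2_components_def connected_components_of_eq_singleton by simp
qed

lemma resonant_half_period:
  assumes "\<epsilon> \<in> {0<..<1}"
  shows "is_minimal_half_period (w_family b l \<epsilon> a) (2 * pi / (\<alpha> + 2))"
proof -
  define R where "R = (inverse \<epsilon> - \<epsilon>) / 2"
  have "\<epsilon> < 1" "1 < inverse \<epsilon>" using assms by (auto simp: one_less_inverse_iff)
  then have R: "R \<noteq> 0" by (simp add: R_def)
  have w: "w_family b l \<epsilon> a = (\<lambda>\<theta>. c0 * pinney (2 * b) R a \<theta>)" using assms w_family_pinney by (simp add: R_def)
  have P: "2 * (2 * pi / (\<alpha> + 2)) = 2 * pi / (2 * b)" using b_eq alpha by (simp add: field_simps)
  show ?thesis
    unfolding is_minimal_half_period_def is_minimal_period_def w P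
  proof (intro conjI allI impI notI)
    show "0 < 2 * pi / (2 * b)" using b_pos by simp
    show "c0 * pinney (2 * b) R a (\<theta> + 2 * pi / (2 * b)) = c0 * pinney (2 * b) R a \<theta>" for \<theta>
      using pinney_period[of "2 * pi / (2 * b)" 1 R a \<theta>] b_pos by simp
    fix s assume s: "0 < s \<and> s < 2 * pi / (2 * b)"
      and per: "\<forall>\<theta>. c0 * pinney (2 * b) R a (\<theta> + s) = c0 * pinney (2 * b) R a \<theta>"
    have "pinney (2 * b) R a (\<theta> + s) = pinney (2 * b) R a \<theta>" for \<theta> using per c0_pos by simp
    then obtain k :: int where k: "2 * b * s = 2 * pi * of_int k" using pinney_period_imp[OF R] by metis
    have "0 < 2 * b * s" using s b_pos by simp
    then have "0 < k" unfolding k by (simp add: zero_less_mult_iff)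
    then have "2 * pi * 1 \<le> 2 * pi * of_int k" by (intro mult_left_mono) auto
    moreover have "2 * b * s < 2 * pi" using s b_pos by (simp add: field_simps)
    ultimately show False using k by simp
  qed
qed

end

end

section \<open>Classification of the solutions\<close>

theorem theorem1p1:
  fixes \<alpha> p l :: real
  assumes "\<alpha> > -2" and "p > 0" and "l > 0"
  shows
    "((\<alpha>, p) \<in> MM \<longrightarrow> solutions \<alpha> p l = {const_solution \<alpha> p l})
   \<and> (p \<noteq> 3 \<and> (\<alpha>, p) \<notin> MM \<longrightarrow>
        finite (J_integers \<alpha> p) \<and> 1 \<le> N0 \<alpha> p
      \<and> (\<forall>i\<in>{1..N0 \<alpha> p}. \<exists>w\<in>solutions \<alpha> p l. is_minimal_period w (2 * pi / of_int (jj \<alpha> p i)))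
      \<and> (\<forall>w :: nat \<Rightarrow> real \<Rightarrow> real.
           (\<forall>i\<in>{1..N0 \<alpha> p}. w i \<in> solutions \<alpha> p l
               \<and> is_minimal_period (w i) (2 * pi / of_int (jj \<alpha> p i)))
           \<longrightarrow> C2_components (solutions \<alpha> p l)
                 = insert {const_solution \<alpha> p l} ((\<lambda>i. translates (w i)) ` {1..N0 \<alpha> p})
             \<and> card (C2_components (solutions \<alpha> p l)) = 1 + N0 \<alpha> p))
   \<and> (p = 3 \<and> (\<exists>n::nat. \<alpha> = 2 * of_nat n) \<longrightarrow>
        beta \<alpha> p = (\<alpha> + 2) / 4
      \<and> C2_components (solutions \<alpha> p l) = {solutions \<alpha> p l}
      \<and> solutions \<alpha> p l = {w_family (beta \<alpha> p) l \<epsilon> a | \<epsilon> a.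
            \<epsilon> \<in> {0<..1} \<and> a \<in> {0..<pi / beta \<alpha> p}}
      \<and> (\<forall>\<epsilon>\<in>{0<..<1}. \<forall>a\<in>{0..<pi / beta \<alpha> p}.
            is_minimal_half_period (w_family (beta \<alpha> p) l \<epsilon> a) (2 * pi / (\<alpha> + 2)))
      \<and> (\<forall>a\<in>{0..<pi / beta \<alpha> p}.
            w_family (beta \<alpha> p) l 1 a = (\<lambda>\<theta>. (l / (beta \<alpha> p)\<^sup>2) powr (1 / 4)))
      \<and> (\<lambda>\<theta>. (l / (beta \<alpha> p)\<^sup>2) powr (1 / 4)) \<in> solutions \<alpha> p l)"
proof -
  interpret circle_problem p \<alpha> l
    by unfold_locales (use assms in auto)
  interpret iso: isochronous_problem \<alpha> l
    by unfold_locales (use assms in auto)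
  show ?thesis
  proof (rule conjI[OF impI conjI[OF impI impI]], goal_cases)
    case MM: 1
    show ?case
    proof (cases "p = 3")
      case True
      then have "\<not> (\<exists>n::nat. \<alpha> = 2 * of_nat n)"
        using MM by (auto simp: MM_def M1_def M2_def M3_def M4_def)
      then show ?thesis using iso.nonresonant_solutions True by simp
    next
      case False
      then have "J_integers \<alpha> p = {}" using MM MM_iff by blast
      then have "u = const_solution \<alpha> p l" if "u \<in> solutions \<alpha> p l" for u
        using solution_cases[OF False that] by blast
      then show ?thesis using const_in_solutions by blast
    qed
  next
    case 2
    then have p3: "p \<noteq> 3" and nM: "(\<alpha>, p) \<notin> MM" by auto
    show ?case
    proof (intro conjI ballI allI impI, goal_cases)
      case 1
      show ?case by (rule finite_J_integers)
    next
      case 2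
      have "J_integers \<alpha> p \<noteq> {}" using MM_iff[OF p3] nM by blast
      then have "N0 \<alpha> p \<noteq> 0" using finite_J_integers by (simp add: N0_def)
      then show ?case by simp
    next
      case (3 i)
      then show ?case using solution_with_minimal_period[OF p3] J_integers_jj by blast
    next
      case (4 w)
      then show ?case by (intro components_of_solutions(1)[OF p3]) blast+
    next
      case (5 w)
      then show ?case by (intro components_of_solutions(2)[OF p3, of w]) blast+
    qed
  next
    case 3
    then obtain n :: nat where p: "p = 3" and n: "\<alpha> = 2 * of_nat n" by blast
    have c: "const_solution \<alpha> 3 l = (\<lambda>\<theta>. (l / (beta \<alpha> 3)\<^sup>2) powr (1 / 4))"
      by (simp add: const_solution_def)
    have const: "(\<lambda>\<theta>. (l / (beta \<alpha> 3)\<^sup>2) powr (1 / 4)) \<in> solutions \<alpha> 3 l"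
      using const_in_solutions unfolding p c .
    show ?case
      unfolding p
      by (intro conjI ballI iso.b_eq iso.resonant_components[OF n] iso.resonant_solutions[OF n]
          iso.resonant_half_period[OF n] iso.w_family_1[unfolded c] const)
  qed
qed

end
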